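(* For any integer $n\geq 1$, the self-closeness number of the real projective space $\mathbb{R}P^n$ is $N\mathcal{E}(\mathbb{R}P^n)=n$.
   Context: Spaces, maps and homotopies are based; $[X,X]$ is the set of based homotopy classes of self-maps of $X$, and $\mathcal{E}(X)\subset [X,X]$ is the set of homotopy classes of self-homotopy equivalences. For a $0$-connected space $X$, $\mathcal{A}_\sharp^k(X)=\{f\in[X,X] : f_\sharp:\pi_i(X)\to\pi_i(X)\text{ is an isomorphism for all } i\le k\}$, and the self-closeness number is $N\mathcal{E}(X)=\min\{k : \mathcal{A}_\sharp^k(X)=\mathcal{E}(X)\}$, where $k$ ranges over $0,1,2,\dots,\infty$. *)

theory Defs
  imports "HOL-Homology.Homology" "HOL-Library.Extended_Nat"
begin

section \<open>Real projective space\<close>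

text \<open>The finest topology on the image of \<open>X\<close> under \<open>q\<close> that makes \<open>q\<close> continuous.\<close>

definition quotient_topology :: "'a topology \<Rightarrow> ('a \<Rightarrow> 'b) \<Rightarrow> 'b topology" where
  "quotient_topology X q =
     topology (\<lambda>U. U \<subseteq> q ` topspace X \<and> openin X {x \<in> topspace X. q x \<in> U})"

lemma openin_quotient_topology:
  "openin (quotient_topology X q) U \<longleftrightarrow>
     U \<subseteq> q ` topspace X \<and> openin X {x \<in> topspace X. q x \<in> U}"
proof -
  let ?L = "\<lambda>U. U \<subseteq> q ` topspace X \<and> openin X {x \<in> topspace X. q x \<in> U}"
  have "istopology ?L"
    unfolding istopology_def
  proof (intro conjI allI impI)
    fix S T assume S: "?L S" and T: "?L T"
    show "S \<inter> T \<subseteq> q ` topspace X" using S by blast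
    have "{x \<in> topspace X. q x \<in> S \<inter> T}
            = {x \<in> topspace X. q x \<in> S} \<inter> {x \<in> topspace X. q x \<in> T}" by blast
    then show "openin X {x \<in> topspace X. q x \<in> S \<inter> T}"
      using S T by (simp add: openin_Int)
  next
    fix \<K> assume K: "\<forall>K\<in>\<K>. ?L K"
    show "\<Union>\<K> \<subseteq> q ` topspace X" using K by blast
    have "{x \<in> topspace X. q x \<in> \<Union>\<K>} = \<Union>((\<lambda>K. {x \<in> topspace X. q x \<in> K}) ` \<K>)" by blast
    then show "openin X {x \<in> topspace X. q x \<in> \<Union>\<K>}"
      using K by (metis (no_types, lifting) imageE openin_Union)
  qed
  then show ?thesis
    by (simp add: quotient_topology_def)
qed

lemma topspace_quotient_topology [simp]:
  "topspace (quotient_topology X q) = q ` topspace X"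
proof
  show "topspace (quotient_topology X q) \<subseteq> q ` topspace X"
    by (metis openin_quotient_topology openin_topspace)
  have "{x \<in> topspace X. q x \<in> q ` topspace X} = topspace X" by blast
  then have "openin (quotient_topology X q) (q ` topspace X)"
    by (simp add: openin_quotient_topology)
  then show "q ` topspace X \<subseteq> topspace (quotient_topology X q)"
    by (rule openin_subset)
qed

lemma quotient_map_quotient_topology: "quotient_map X (quotient_topology X q) q"
  by (auto simp: quotient_map_def openin_quotient_topology)

definition antipodal_pair :: "(nat \<Rightarrow> real) \<Rightarrow> (nat \<Rightarrow> real) set" where
  "antipodal_pair x = {x, \<lambda>i. - x i}"

definition real_projective_space :: "nat \<Rightarrow> (nat \<Rightarrow> real) set topology" where
  "real_projective_space n = quotient_topology (nsphere n) antipodal_pair"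


section \<open>Based maps and based homotopy classes\<close>

definition based_map :: "'a topology \<Rightarrow> 'a \<Rightarrow> 'b topology \<Rightarrow> 'b \<Rightarrow> ('a \<Rightarrow> 'b) \<Rightarrow> bool" where
  "based_map X x0 Y y0 f \<longleftrightarrow> continuous_map X Y f \<and> f x0 = y0"

definition based_homotopic ::
  "'a topology \<Rightarrow> 'a \<Rightarrow> 'b topology \<Rightarrow> 'b \<Rightarrow> ('a \<Rightarrow> 'b) \<Rightarrow> ('a \<Rightarrow> 'b) \<Rightarrow> bool" where
  "based_homotopic X x0 Y y0 = homotopic_with (\<lambda>h. h x0 = y0) X Y"

text \<open>\<^const>\<open>homotopic_with\<close> does not see values outside the carrier of \<open>X\<close>, so functions that
  agree on the carrier lie in the same class.\<close>

definition based_class ::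
  "'a topology \<Rightarrow> 'a \<Rightarrow> 'b topology \<Rightarrow> 'b \<Rightarrow> ('a \<Rightarrow> 'b) \<Rightarrow> ('a \<Rightarrow> 'b) set" where
  "based_class X x0 Y y0 f = {g. based_homotopic X x0 Y y0 f g}"

definition based_homotopy_equivalence ::
  "'a topology \<Rightarrow> 'a \<Rightarrow> 'b topology \<Rightarrow> 'b \<Rightarrow> ('a \<Rightarrow> 'b) \<Rightarrow> bool" where
  "based_homotopy_equivalence X x0 Y y0 f \<longleftrightarrow>
     based_map X x0 Y y0 f \<and>
     (\<exists>g. based_map Y y0 X x0 g \<and>
          based_homotopic X x0 X x0 (g \<circ> f) id \<and>
          based_homotopic Y y0 Y y0 (f \<circ> g) id)"

definition self_equivalences :: "'a topology \<Rightarrow> 'a \<Rightarrow> ('a \<Rightarrow> 'a) set set" where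
  "self_equivalences X x0 =
     {based_class X x0 X x0 f | f. based_homotopy_equivalence X x0 X x0 f}"


section \<open>Homotopy groups\<close>

text \<open>The cube \<open>[0,1]\<^sup>i\<close>, with points padded by zeros as in \<^const>\<open>Euclidean_space\<close>. For
  \<open>i = 0\<close> it is a single point with empty boundary.\<close>

definition cube :: "nat \<Rightarrow> (nat \<Rightarrow> real) topology" where
  "cube i = subtopology (Euclidean_space i) {s. \<forall>j<i. 0 \<le> s j \<and> s j \<le> 1}"

definition cube_boundary :: "nat \<Rightarrow> (nat \<Rightarrow> real) set" where
  "cube_boundary i = {s \<in> topspace (cube i). \<exists>j<i. s j = 0 \<or> s j = 1}"

definition spheroid :: "nat \<Rightarrow> 'a topology \<Rightarrow> 'a \<Rightarrow> ((nat \<Rightarrow> real) \<Rightarrow> 'a) \<Rightarrow> bool" where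
  "spheroid i X x0 a \<longleftrightarrow> continuous_map (cube i) X a \<and> a ` cube_boundary i \<subseteq> {x0}"

definition spheroid_homotopic ::
  "nat \<Rightarrow> 'a topology \<Rightarrow> 'a \<Rightarrow> ((nat \<Rightarrow> real) \<Rightarrow> 'a) \<Rightarrow> ((nat \<Rightarrow> real) \<Rightarrow> 'a) \<Rightarrow> bool" where
  "spheroid_homotopic i X x0 = homotopic_with (\<lambda>h. h ` cube_boundary i \<subseteq> {x0}) (cube i) X"

definition spheroid_class ::
  "nat \<Rightarrow> 'a topology \<Rightarrow> 'a \<Rightarrow> ((nat \<Rightarrow> real) \<Rightarrow> 'a) \<Rightarrow> ((nat \<Rightarrow> real) \<Rightarrow> 'a) set" where
  "spheroid_class i X x0 a = {b. spheroid_homotopic i X x0 a b}"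

definition spheroid_concat ::
  "((nat \<Rightarrow> real) \<Rightarrow> 'a) \<Rightarrow> ((nat \<Rightarrow> real) \<Rightarrow> 'a) \<Rightarrow> (nat \<Rightarrow> real) \<Rightarrow> 'a" where
  "spheroid_concat a b s =
     (if s 0 \<le> 1/2 then a (s(0 := 2 * s 0)) else b (s(0 := 2 * s 0 - 1)))"

text \<open>The carrier is meaningful for every \<open>i\<close>; for \<open>i = 0\<close> it is the set of path components, and
  the multiplication is then a dummy.\<close>

definition homotopy_group ::
  "nat \<Rightarrow> 'a topology \<Rightarrow> 'a \<Rightarrow> ((nat \<Rightarrow> real) \<Rightarrow> 'a) set monoid" where
  "homotopy_group i X x0 =
     \<lparr>carrier = {spheroid_class i X x0 a | a. spheroid i X x0 a},
      mult = (\<lambda>A B. \<Union>a\<in>A. \<Union>b\<in>B. spheroid_class i X x0 (spheroid_concat a b)),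
      one = spheroid_class i X x0 (\<lambda>s. x0)\<rparr>"

definition induced_map ::
  "nat \<Rightarrow> 'b topology \<Rightarrow> 'b \<Rightarrow> ('a \<Rightarrow> 'b) \<Rightarrow>
     ((nat \<Rightarrow> real) \<Rightarrow> 'a) set \<Rightarrow> ((nat \<Rightarrow> real) \<Rightarrow> 'b) set" where
  "induced_map i Y y0 f A = (\<Union>a\<in>A. spheroid_class i Y y0 (f \<circ> a))"

text \<open>In degree 0 there is no group structure: an isomorphism is a bijection (the induced map of a
  based map preserves the base class).\<close>

definition induces_iso ::
  "nat \<Rightarrow> 'a topology \<Rightarrow> 'a \<Rightarrow> 'b topology \<Rightarrow> 'b \<Rightarrow> ('a \<Rightarrow> 'b) \<Rightarrow> bool" where
  "induces_iso i X x0 Y y0 f \<longleftrightarrow>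
     (if i = 0
      then bij_betw (induced_map i Y y0 f)
             (carrier (homotopy_group i X x0)) (carrier (homotopy_group i Y y0))
      else induced_map i Y y0 f \<in> iso (homotopy_group i X x0) (homotopy_group i Y y0))"


section \<open>The self-closeness number\<close>

text \<open>\<^const>\<open>induces_iso\<close> is invariant under based homotopy, so the choice of the representative
  \<open>f\<close> is immaterial.\<close>

definition A_sharp :: "enat \<Rightarrow> 'a topology \<Rightarrow> 'a \<Rightarrow> ('a \<Rightarrow> 'a) set set" where
  "A_sharp k X x0 =
     {based_class X x0 X x0 f | f.
        based_map X x0 X x0 f \<and> (\<forall>i. enat i \<le> k \<longrightarrow> induces_iso i X x0 X x0 f)}"

definition self_closeness_number :: "'a topology \<Rightarrow> 'a \<Rightarrow> enat" where
  "self_closeness_number X x0 = (LEAST k. A_sharp k X x0 = self_equivalences X x0)"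

end

theory Submission
  imports Defs "HOL-Analysis.Abstract_Topological_Spaces" "HOL-Analysis.Further_Topology"
begin

text \<open>Write \<open>q\<close> for the double cover of \<open>\<real>P\<^sup>n\<close> by the sphere.

  A based self-map \<open>f\<close> that is surjective on \<open>\<pi>\<^sub>1\<close> and \<open>\<pi>\<^sub>n\<close> has a right homotopy inverse: it lifts to an odd
  self-map \<open>F\<close> of the sphere, also surjective on \<open>\<pi>\<^sub>n\<close>. On the equator \<open>F\<close> is oddly homotopic to the
  inclusion, cell by cell, because maps from lower-dimensional cubes into the sphere are homotopic rel
  boundary. A preimage under \<open>F\<close> of a suitable class in \<open>\<pi>\<^sub>n\<close> fills the upper hemisphere, and extending
  oddly yields \<open>G\<close> with \<open>F G\<close> oddly homotopic to the identity. If \<open>f\<close> is an isomorphism on \<open>\<pi>\<^sub>i\<close> for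
  \<open>i \<le> n\<close>, so is the right inverse, which then has a right inverse of its own; hence \<open>f\<close> is an equivalence.

  No smaller bound suffices: for \<open>\<bar>c\<bar> = 1\<close> the map \<open>(z, x) \<mapsto> (c z\<^sup>3 / \<bar>z\<bar>\<^sup>2, x)\<close> on the sphere in
  \<open>\<complex> \<times> \<real>\<^sup>n\<^sup>-\<^sup>1\<close> is odd of degree \<open>3\<close> and, for suitable \<open>c\<close>, fixes a given lift of the base point. The
  map it induces on \<open>\<real>P\<^sup>n\<close> is the identity on \<open>\<pi>\<^sub>i\<close> for \<open>i < n\<close>, but a homotopy inverse would lift
  to a map whose degree is inverse to \<open>3\<close> up to sign.\<close>

section \<open>Cubes, spheroids and induced maps\<close>

text \<open>The sphere has one antipodal pair of cells in each dimension. Surjectivity on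
  \<open>\<pi>\<^sub>1\<close> makes the lift commute with the antipodal map; below dimension
  \<open>n\<close> the cells offer no obstruction, and the one genuine choice, on the top cell, is
  made by surjectivity on \<open>\<pi>\<^sub>n\<close>. Constructing right inverses uses
  surjectivity only; injectivity serves at the end to cancel \<open>f\<close>. The obstacle is that
  every homotopy must be odd and keep the base point fixed. Both are arranged at once: homotopies
  are prescribed on an equator, extended over the closed upper hemisphere and reflected, and the
  first coordinate vector lies on every equator involved. Any other base point is moved there by a
  reflection. That maps of low-dimensional cubes deform rel boundary comes from a null homotopy of
  maps on cube boundaries, by Lipschitz approximation and counting. An odd map of the sphere has odd
  degree, so 3 is the least positive degree other than 1; it is read off from the change of angle on
  the circle and carried up by suspension.\<close>

lemma topspace_cube:
  "topspace (cube i) = {s. (\<forall>j\<ge>i. s j = 0) \<and> (\<forall>j<i. 0 \<le> s j \<and> s j \<le> 1)}"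
  by (auto simp: cube_def topspace_Euclidean_space)

lemma cube_boundary_subset: "cube_boundary i \<subseteq> topspace (cube i)"
  by (auto simp: cube_boundary_def)

lemma continuous_map_cube_projection: "continuous_map (cube i) euclideanreal (\<lambda>s. s k)"
  unfolding cube_def Euclidean_space_def subtopology_subtopology
  by (blast intro: continuous_map_from_subtopology [OF continuous_map_product_projection])

lemma continuous_map_into_cube:
  "continuous_map X (cube i) f \<longleftrightarrow>
     (\<forall>k. continuous_map X euclideanreal (\<lambda>x. f x k)) \<and> (\<forall>x\<in>topspace X. f x \<in> topspace (cube i))"
proof -
  have eq: "cube i = subtopology (powertop_real UNIV) (topspace (cube i))"
    unfolding topspace_cube unfolding cube_def Euclidean_space_def subtopology_subtopology
    by (rule arg_cong[where f = "subtopology (powertop_real UNIV)"]) auto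
  have "continuous_map X (cube i) f \<longleftrightarrow>
      continuous_map X (subtopology (powertop_real UNIV) (topspace (cube i))) f"
    by (rule arg_cong[OF eq, where f = "\<lambda>T. continuous_map X T f"])
  then show ?thesis
    by (auto simp: continuous_map_in_subtopology continuous_map_componentwise_UNIV)
qed

lemma spheroid_homotopic_alt:
  "spheroid_homotopic i X x0 a b \<longleftrightarrow>
     (\<exists>h. continuous_map (prod_topology (top_of_set {0..1::real}) (cube i)) X h \<and>
          (\<forall>s\<in>topspace (cube i). h (0, s) = a s) \<and> (\<forall>s\<in>topspace (cube i). h (1, s) = b s) \<and>
          (\<forall>t\<in>{0..1}. \<forall>s\<in>cube_boundary i. h (t, s) = x0))"
proof -
  have *: "(h ` cube_boundary i \<subseteq> {x0}) \<longleftrightarrow> (k ` cube_boundary i \<subseteq> {x0})"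
    if "\<And>s. s \<in> topspace (cube i) \<Longrightarrow> h s = k s" for h k :: "(nat \<Rightarrow> real) \<Rightarrow> 'a"
    using that cube_boundary_subset[of i] by (simp add: image_subset_iff subset_iff)
  show ?thesis
    unfolding spheroid_homotopic_def
    by (subst homotopic_with, erule *) (simp add: image_subset_iff)
qed

lemma spheroid_homotopic_refl [simp]:
  "spheroid_homotopic i X x0 a a \<longleftrightarrow> spheroid i X x0 a"
  by (simp add: spheroid_homotopic_def spheroid_def)

lemma spheroid_homotopic_sym:
  "spheroid_homotopic i X x0 a b \<Longrightarrow> spheroid_homotopic i X x0 b a"
  by (simp add: spheroid_homotopic_def homotopic_with_symD)

lemma spheroid_homotopic_trans:
  "spheroid_homotopic i X x0 a b \<Longrightarrow> spheroid_homotopic i X x0 b c \<Longrightarrow> spheroid_homotopic i X x0 a c"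
  unfolding spheroid_homotopic_def by (rule homotopic_with_trans)

lemma spheroid_class_eq_iff:
  assumes "spheroid i X x0 b"
  shows "spheroid_class i X x0 a = spheroid_class i X x0 b \<longleftrightarrow> spheroid_homotopic i X x0 a b"
  using assms unfolding spheroid_class_def set_eq_iff mem_Collect_eq
  by (meson spheroid_homotopic_refl spheroid_homotopic_sym spheroid_homotopic_trans)

lemma spheroid_comp:
  assumes "based_map X x0 Y y0 f" "spheroid i X x0 a"
  shows "spheroid i Y y0 (f \<circ> a)"
  using assms unfolding spheroid_def based_map_def
  by (auto intro: continuous_map_compose)

lemma spheroid_homotopic_comp:
  assumes "based_map X x0 Y y0 f" "spheroid_homotopic i X x0 a b"
  shows "spheroid_homotopic i Y y0 (f \<circ> a) (f \<circ> b)"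
  using assms(2) unfolding spheroid_homotopic_def
  by (rule homotopic_with_compose_continuous_map_left) (use assms(1) in \<open>auto simp: based_map_def\<close>)

text \<open>The union in \<open>induced_map\<close> runs over all representatives of the class;
  homotopic representatives contribute the same set, so the union collapses.\<close>

lemma induced_map_class:
  assumes f: "based_map X x0 Y y0 f" and a: "spheroid i X x0 a"
  shows "induced_map i Y y0 f (spheroid_class i X x0 a) = spheroid_class i Y y0 (f \<circ> a)"
proof -
  have "spheroid_class i Y y0 (f \<circ> b) = spheroid_class i Y y0 (f \<circ> a)" if "b \<in> spheroid_class i X x0 a" for b
    using that spheroid_class_eq_iff[OF spheroid_comp[OF f a]]
    by (metis f mem_Collect_eq spheroid_class_def spheroid_homotopic_comp spheroid_homotopic_sym)
  moreover have "a \<in> spheroid_class i X x0 a"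
    using a by (simp add: spheroid_class_def)
  ultimately show ?thesis
    unfolding induced_map_def by blast
qed

lemma spheroid_homotopic_based_homotopic:
  assumes fg: "based_homotopic X x0 Y y0 f g" and a: "spheroid i X x0 a"
  shows "spheroid_homotopic i Y y0 (f \<circ> a) (g \<circ> a)"
  using fg unfolding based_homotopic_def spheroid_homotopic_def
  by (rule homotopic_with_compose_continuous_map_right) (use a in \<open>auto simp: spheroid_def\<close>)

lemma spheroid_homotopic_concat:
  assumes i: "i \<ge> 1" and a: "spheroid_homotopic i X x0 a a'" and b: "spheroid_homotopic i X x0 b b'"
  shows "spheroid_homotopic i X x0 (spheroid_concat a b) (spheroid_concat a' b')"
proof -
  let ?I = "prod_topology (top_of_set {0..1::real}) (cube i)"
  obtain h where h: "continuous_map ?I X h" "\<And>s. s \<in> topspace (cube i) \<Longrightarrow> h (0, s) = a s"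
     "\<And>s. s \<in> topspace (cube i) \<Longrightarrow> h (1, s) = a' s" "\<And>t s. t \<in> {0..1} \<Longrightarrow> s \<in> cube_boundary i \<Longrightarrow> h (t, s) = x0"
    using a unfolding spheroid_homotopic_alt by blast
  obtain k where k: "continuous_map ?I X k" "\<And>s. s \<in> topspace (cube i) \<Longrightarrow> k (0, s) = b s"
     "\<And>s. s \<in> topspace (cube i) \<Longrightarrow> k (1, s) = b' s" "\<And>t s. t \<in> {0..1} \<Longrightarrow> s \<in> cube_boundary i \<Longrightarrow> k (t, s) = x0"
    using b unfolding spheroid_homotopic_alt by blast
  define l where "l \<equiv> \<lambda>p. if snd p 0 \<le> (1/2::real) then h (fst p, (snd p)(0 := 2 * snd p 0))
                             else k (fst p, (snd p)(0 := 2 * snd p 0 - 1))"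
  have pr: "continuous_map ?I euclideanreal (\<lambda>p. snd p j)" for j
    using continuous_map_compose[OF continuous_map_snd continuous_map_cube_projection] by (simp add: o_def)
  have bd: "s(0 := 1) \<in> cube_boundary i" "s(0 := 0) \<in> cube_boundary i" if "s \<in> topspace (cube i)" for s
    using that i unfolding cube_boundary_def topspace_cube by (auto intro!: exI[of _ 0])
  \<comment> \<open>The coordinate witnessing that \<open>s\<close> is on the boundary may be the
    rescaled one, hence the last premise. It holds for both halves: 0 goes to 0 under doubling, and
    1 goes to 1 under \<open>2 * s 0 - 1\<close>.\<close>
  have bd2: "s(0 := c) \<in> cube_boundary i" if "s \<in> cube_boundary i" "0 \<le> c" "c \<le> 1" "s 0 \<in> {0,1} \<Longrightarrow> c \<in> {0, 1}" for s c
  proof -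
    have c: "s 0 \<in> {0,1} \<Longrightarrow> c \<in> {0, 1}" by (fact that(4))
    obtain j where j: "j < i" "s j = 0 \<or> s j = 1" and s: "s \<in> topspace (cube i)"
      using \<open>s \<in> cube_boundary i\<close> unfolding cube_boundary_def by blast
    have "(s(0 := c)) j = 0 \<or> (s(0 := c)) j = 1"
      using j(2) c by (cases "j = 0") auto
    moreover have "s(0 := c) \<in> topspace (cube i)"
      using s \<open>0 \<le> c\<close> \<open>c \<le> 1\<close> i unfolding topspace_cube by simp
    ultimately show ?thesis
      using j(1) unfolding cube_boundary_def by blast
  qed
  have "continuous_map ?I X l"
    unfolding l_def
  proof (rule continuous_map_cases_le)
    let ?T = "subtopology ?I {x \<in> topspace ?I. snd x 0 \<le> 1/2}"
    show "continuous_map ?I euclideanreal (\<lambda>x. snd x 0)" by (rule pr)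
    have "continuous_map ?T ?I (\<lambda>p. (fst p, (snd p)(0 := 2 * snd p 0)))"
      unfolding continuous_map_pairwise o_def continuous_map_into_cube fst_conv snd_conv
    proof (intro conjI allI ballI)
      show "continuous_map ?T (top_of_set {0..1::real}) fst"
        by (intro continuous_map_from_subtopology continuous_map_fst)
      show "continuous_map ?T euclideanreal (\<lambda>x. ((snd x)(0 := 2 * snd x 0)) j)" for j
        by (cases "j = 0") (auto intro!: continuous_intros continuous_map_from_subtopology pr)
    qed (use i in \<open>auto simp: topspace_cube\<close>)
    then show "continuous_map ?T X (\<lambda>p. h (fst p, (snd p)(0 := 2 * snd p 0)))"
      using continuous_map_compose[OF _ h(1)] by (simp add: o_def)
  next
    let ?T = "subtopology ?I {x \<in> topspace ?I. 1/2 \<le> snd x 0}"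
    have "continuous_map ?T ?I (\<lambda>p. (fst p, (snd p)(0 := 2 * snd p 0 - 1)))"
      unfolding continuous_map_pairwise o_def continuous_map_into_cube fst_conv snd_conv
    proof (intro conjI allI ballI)
      show "continuous_map ?T (top_of_set {0..1::real}) fst"
        by (intro continuous_map_from_subtopology continuous_map_fst)
      show "continuous_map ?T euclideanreal (\<lambda>x. ((snd x)(0 := 2 * snd x 0 - 1)) j)" for j
        by (cases "j = 0") (auto intro!: continuous_intros continuous_map_from_subtopology pr)
    qed (use i in \<open>auto simp: topspace_cube\<close>)
    then show "continuous_map ?T X (\<lambda>p. k (fst p, (snd p)(0 := 2 * snd p 0 - 1)))"
      using continuous_map_compose[OF _ k(1)] by (simp add: o_def)
  next
    fix p assume "p \<in> topspace ?I" "snd p 0 = 1/2"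
    then show "h (fst p, (snd p)(0 := 2 * snd p 0)) = k (fst p, (snd p)(0 := 2 * snd p 0 - 1))"
    proof -
      have "2 * snd p 0 = 1" using \<open>snd p 0 = 1/2\<close> by simp
      then show ?thesis
        using \<open>p \<in> topspace ?I\<close> bd h(4) k(4) by (cases p) simp
    qed
  qed auto
  moreover have "s(0 := 2 * s 0) \<in> topspace (cube i)" if "s \<in> topspace (cube i)" "s 0 \<le> 1/2" for s
    using that i by (auto simp: topspace_cube)
  moreover have "s(0 := 2 * s 0 - 1) \<in> topspace (cube i)" if "s \<in> topspace (cube i)" "\<not> s 0 \<le> 1/2" for s
    using that i by (auto simp: topspace_cube)
  moreover have "l (t, s) = x0" if "t \<in> {0..1}" "s \<in> cube_boundary i" for t s
  proof -
    have "0 \<le> s 0" "s 0 \<le> 1" using that(2) i by (auto simp: cube_boundary_def topspace_cube)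
    then show ?thesis
      unfolding l_def using that
      by (auto intro!: h(4) k(4) bd2)
  qed
  ultimately show ?thesis
    unfolding spheroid_homotopic_alt
    by (intro exI[of _ l]) (auto simp: l_def spheroid_concat_def h k)
qed

lemma spheroid_concat:
  assumes "i \<ge> 1" "spheroid i X x0 a" "spheroid i X x0 b"
  shows "spheroid i X x0 (spheroid_concat a b)"
  using spheroid_homotopic_concat[OF assms(1), of X x0 a a b b] assms by simp

lemma comp_spheroid_concat: "f \<circ> spheroid_concat a b = spheroid_concat (f \<circ> a) (f \<circ> b)"
  by (auto simp: spheroid_concat_def)

lemma mult_homotopy_group_class:
  assumes i: "i \<ge> 1" and a: "spheroid i X x0 a" and b: "spheroid i X x0 b"
  shows "spheroid_class i X x0 a \<otimes>\<^bsub>homotopy_group i X x0\<^esub> spheroid_class i X x0 b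
           = spheroid_class i X x0 (spheroid_concat a b)"
proof -
  have "spheroid_class i X x0 (spheroid_concat a' b') = spheroid_class i X x0 (spheroid_concat a b)"
    if "a' \<in> spheroid_class i X x0 a" "b' \<in> spheroid_class i X x0 b" for a' b'
    using that unfolding spheroid_class_eq_iff[OF spheroid_concat[OF i a b]]
    by (auto simp: spheroid_class_def intro!: spheroid_homotopic_sym[OF spheroid_homotopic_concat[OF i]])
  moreover have "a \<in> spheroid_class i X x0 a" "b \<in> spheroid_class i X x0 b"
    using a b by (auto simp: spheroid_class_def)
  ultimately show ?thesis
    unfolding homotopy_group_def monoid.simps by blast
qed

text \<open>In positive degree the induced map is automatically a homomorphism, since composition
  commutes with concatenation. So every degree, 0 included, reduces to bijectivity, expressed here
  by spheroids instead of classes; the group structure does not occur again.\<close>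

lemma induces_iso_iff:
  assumes f: "based_map X x0 Y y0 f"
  shows "induces_iso i X x0 Y y0 f \<longleftrightarrow>
     (\<forall>b. spheroid i Y y0 b \<longrightarrow> (\<exists>a. spheroid i X x0 a \<and> spheroid_homotopic i Y y0 (f \<circ> a) b)) \<and>
     (\<forall>a a'. spheroid i X x0 a \<longrightarrow> spheroid i X x0 a' \<longrightarrow>
        spheroid_homotopic i Y y0 (f \<circ> a) (f \<circ> a') \<longrightarrow> spheroid_homotopic i X x0 a a')"
    (is "_ \<longleftrightarrow> ?surj \<and> ?inj")
proof -
  let ?G = "homotopy_group i X x0" and ?H = "homotopy_group i Y y0" and ?f = "induced_map i Y y0 f"
  have G: "carrier ?G = {spheroid_class i X x0 a | a. spheroid i X x0 a}"
    and H: "carrier ?H = {spheroid_class i Y y0 a | a. spheroid i Y y0 a}"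
    by (auto simp: homotopy_group_def)
  have hom: "?f \<in> hom ?G ?H" if "i \<ge> 1"
  proof (rule homI)
    fix A assume "A \<in> carrier ?G"
    then show "?f A \<in> carrier ?H"
      unfolding G H using induced_map_class[OF f] spheroid_comp[OF f] by auto
  next
    fix A B assume "A \<in> carrier ?G" "B \<in> carrier ?G"
    then obtain a b where "A = spheroid_class i X x0 a" "spheroid i X x0 a" "B = spheroid_class i X x0 b" "spheroid i X x0 b"
      unfolding G by auto
    then show "?f (A \<otimes>\<^bsub>?G\<^esub> B) = ?f A \<otimes>\<^bsub>?H\<^esub> ?f B"
      using that f
      by (simp add: mult_homotopy_group_class induced_map_class spheroid_comp[OF f] spheroid_concat comp_spheroid_concat)
  qed
  have bij: "bij_betw ?f (carrier ?G) (carrier ?H) \<longleftrightarrow> ?surj \<and> ?inj"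
  proof -
    have "inj_on ?f (carrier ?G) \<longleftrightarrow>
        (\<forall>a a'. spheroid i X x0 a \<longrightarrow> spheroid i X x0 a' \<longrightarrow>
          ?f (spheroid_class i X x0 a) = ?f (spheroid_class i X x0 a') \<longrightarrow> spheroid_class i X x0 a = spheroid_class i X x0 a')"
      unfolding inj_on_def G by blast
    also have "\<dots> \<longleftrightarrow> ?inj"
      by (intro all_cong1 imp_cong refl)
         (simp_all only: induced_map_class[OF f] spheroid_class_eq_iff spheroid_comp[OF f])
    finally have "inj_on ?f (carrier ?G) \<longleftrightarrow> ?inj" .
    moreover have "?f ` carrier ?G = carrier ?H \<longleftrightarrow> ?surj"
    proof -
      have img: "h ` A = B \<longleftrightarrow> (\<forall>y\<in>B. \<exists>x\<in>A. h x = y)" if "\<And>x. x \<in> A \<Longrightarrow> h x \<in> B" for h :: "'c \<Rightarrow> 'd" and A B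
        using that by (fastforce simp: image_iff set_eq_iff)
      have im: "?f A \<in> carrier ?H" if "A \<in> carrier ?G" for A
        using that unfolding G H by (auto simp: induced_map_class[OF f] intro: spheroid_comp[OF f])
      have "?f ` carrier ?G = carrier ?H \<longleftrightarrow> (\<forall>B\<in>carrier ?H. \<exists>A\<in>carrier ?G. ?f A = B)"
        by (rule img) (rule im)
      also have "\<dots> \<longleftrightarrow> (\<forall>b. spheroid i Y y0 b \<longrightarrow>
          (\<exists>a. spheroid i X x0 a \<and> ?f (spheroid_class i X x0 a) = spheroid_class i Y y0 b))"
        unfolding G H by blast
      also have "\<dots> \<longleftrightarrow> ?surj"
        by (intro all_cong1 imp_cong ex_cong1 conj_cong refl)
           (simp only: induced_map_class[OF f] spheroid_class_eq_iff)
      finally show ?thesis .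
    qed
    ultimately show ?thesis by (auto simp: bij_betw_def)
  qed
  show ?thesis
    using hom bij by (auto simp: induces_iso_def iso_def)
qed

lemma based_homotopy_equivalence_imp_induces_iso:
  assumes "based_homotopy_equivalence X x0 Y y0 f"
  shows "induces_iso i X x0 Y y0 f"
proof -
  obtain g where f: "based_map X x0 Y y0 f" and g: "based_map Y y0 X x0 g"
    and gf: "based_homotopic X x0 X x0 (g \<circ> f) id" and fg: "based_homotopic Y y0 Y y0 (f \<circ> g) id"
    using assms by (auto simp: based_homotopy_equivalence_def)
  show ?thesis
    unfolding induces_iso_iff[OF f]
  proof (intro conjI allI impI)
    fix b assume "spheroid i Y y0 b"
    then show "\<exists>a. spheroid i X x0 a \<and> spheroid_homotopic i Y y0 (f \<circ> a) b"
      using spheroid_homotopic_based_homotopic[OF fg, of i b] spheroid_comp[OF g, of i b]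
      by (auto simp: comp_assoc)
  next
    fix a a' assume a: "spheroid i X x0 a" "spheroid i X x0 a'" and "spheroid_homotopic i Y y0 (f \<circ> a) (f \<circ> a')"
    then have "spheroid_homotopic i X x0 (g \<circ> f \<circ> a) (g \<circ> f \<circ> a')"
      using spheroid_homotopic_comp[OF g] by (simp add: comp_assoc)
    then show "spheroid_homotopic i X x0 a a'"
      using spheroid_homotopic_based_homotopic[OF gf a(1)] spheroid_homotopic_based_homotopic[OF gf a(2)]
      by (metis id_comp spheroid_homotopic_sym spheroid_homotopic_trans)
  qed
qed

section \<open>Calculus of based homotopies\<close>

lemma based_homotopic_sym: "based_homotopic X x0 Y y0 f g \<Longrightarrow> based_homotopic X x0 Y y0 g f"
  by (simp add: based_homotopic_def homotopic_with_symD)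

lemma based_homotopic_trans:
  "based_homotopic X x0 Y y0 f g \<Longrightarrow> based_homotopic X x0 Y y0 g h \<Longrightarrow> based_homotopic X x0 Y y0 f h"
  unfolding based_homotopic_def by (rule homotopic_with_trans)

lemma based_homotopic_refl [simp]: "based_homotopic X x0 Y y0 f f \<longleftrightarrow> based_map X x0 Y y0 f"
  by (simp add: based_homotopic_def based_map_def)

lemma based_homotopic_imp_based_map:
  assumes "based_homotopic X x0 Y y0 f g"
  shows "based_map X x0 Y y0 f" "based_map X x0 Y y0 g"
  using homotopic_with_imp_continuous_maps homotopic_with_imp_property assms
  unfolding based_homotopic_def based_map_def by blast+

lemma based_homotopic_comp_left:
  "based_homotopic X x0 Y y0 f g \<Longrightarrow> based_map Y y0 Z z0 h \<Longrightarrow> based_homotopic X x0 Z z0 (h \<circ> f) (h \<circ> g)"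
  unfolding based_homotopic_def based_map_def
  by (erule homotopic_with_compose_continuous_map_left) auto

lemma based_homotopic_comp_right:
  "based_homotopic Y y0 Z z0 f g \<Longrightarrow> based_map X x0 Y y0 h \<Longrightarrow> based_homotopic X x0 Z z0 (f \<circ> h) (g \<circ> h)"
  unfolding based_homotopic_def based_map_def
  by (erule homotopic_with_compose_continuous_map_right) auto

lemma based_map_comp:
  "based_map X x0 Y y0 f \<Longrightarrow> based_map Y y0 Z z0 g \<Longrightarrow> based_map X x0 Z z0 (g \<circ> f)"
  unfolding based_map_def by (auto intro: continuous_map_compose)

lemma based_homotopic_alt:
  assumes "x0 \<in> topspace X"
  shows "based_homotopic X x0 Y y0 f g \<longleftrightarrow>
     (\<exists>h. continuous_map (prod_topology (top_of_set {0..1::real}) X) Y h \<and>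
          (\<forall>x\<in>topspace X. h (0, x) = f x) \<and> (\<forall>x\<in>topspace X. h (1, x) = g x) \<and>
          (\<forall>t\<in>{0..1}. h (t, x0) = y0))"
  unfolding based_homotopic_def by (subst homotopic_with) (simp_all add: assms)

lemma based_homotopy_equivalence_homotopic:
  assumes "based_homotopic X x0 Y y0 f f'" "based_homotopy_equivalence X x0 Y y0 f'"
  shows "based_homotopy_equivalence X x0 Y y0 f"
proof -
  obtain g where g: "based_map Y y0 X x0 g" "based_homotopic X x0 X x0 (g \<circ> f') id"
      "based_homotopic Y y0 Y y0 (f' \<circ> g) id"
    using assms(2) unfolding based_homotopy_equivalence_def by blast
  show ?thesis
    unfolding based_homotopy_equivalence_def
    using g based_homotopic_imp_based_map(1)[OF assms(1)]
      based_homotopic_trans[OF based_homotopic_comp_left[OF assms(1) g(1)] g(2)]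
      based_homotopic_trans[OF based_homotopic_comp_right[OF assms(1) g(1)] g(3)] by blast
qed

text \<open>An equivalence induces isomorphisms in all degrees, so only the converse implication has
  to be supplied, one representative at a time.\<close>

lemma A_sharp_eq_self_equivalencesI:
  assumes "\<And>f. based_map X x0 X x0 f \<Longrightarrow> (\<And>i. enat i \<le> k \<Longrightarrow> induces_iso i X x0 X x0 f)
             \<Longrightarrow> based_homotopy_equivalence X x0 X x0 f"
  shows "A_sharp k X x0 = self_equivalences X x0"
proof -
  have "based_map X x0 X x0 f \<and> (\<forall>i. enat i \<le> k \<longrightarrow> induces_iso i X x0 X x0 f)
          \<longleftrightarrow> based_homotopy_equivalence X x0 X x0 f" for f
    using assms[of f] based_homotopy_equivalence_imp_induces_iso[of X x0 X x0 f]
    by (auto simp: based_homotopy_equivalence_def)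
  then show ?thesis
    unfolding A_sharp_def self_equivalences_def by simp
qed

lemma A_sharp_neq_self_equivalencesI:
  assumes f: "based_map X x0 X x0 f" and iso: "\<And>i. enat i \<le> k \<Longrightarrow> induces_iso i X x0 X x0 f"
    and not: "\<not> based_homotopy_equivalence X x0 X x0 f"
  shows "A_sharp k X x0 \<noteq> self_equivalences X x0"
proof
  assume "A_sharp k X x0 = self_equivalences X x0"
  moreover have "based_class X x0 X x0 f \<in> A_sharp k X x0"
    using f iso unfolding A_sharp_def by blast
  \<comment> \<open>Membership of the class of \<open>f\<close> only provides some equivalence
    \<open>g\<close> in the same class; invariance under homotopy carries the property back to
    \<open>f\<close>.\<close>
  ultimately obtain g where g: "based_class X x0 X x0 f = based_class X x0 X x0 g"
      "based_homotopy_equivalence X x0 X x0 g"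
    unfolding self_equivalences_def by auto
  have "based_homotopic X x0 X x0 g f"
    using g(1) f unfolding based_class_def set_eq_iff mem_Collect_eq by (metis based_homotopic_refl)
  then show False
    using g(2) not based_homotopy_equivalence_homotopic based_homotopic_sym by metis
qed

section \<open>Spheres\<close>

abbreviation unit_interval :: "real topology" where
  "unit_interval \<equiv> top_of_set {0..1}"

text \<open>The bound is inclusive because \<open>nsphere n\<close> lives in the coordinates 0 to
  \<open>n\<close>.\<close>

definition dot :: "nat \<Rightarrow> (nat \<Rightarrow> real) \<Rightarrow> (nat \<Rightarrow> real) \<Rightarrow> real" where
  "dot n x y = (\<Sum>i\<le>n. x i * y i)"

definition antipode :: "(nat \<Rightarrow> real) \<Rightarrow> nat \<Rightarrow> real" where
  "antipode x = (\<lambda>i. - x i)"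

lemma antipode_apply [simp]: "antipode x i = - x i"
  by (simp add: antipode_def)

lemma antipode_antipode [simp]: "antipode (antipode x) = x"
  by (simp add: antipode_def)

lemma topspace_nsphere: "topspace (nsphere n) = {x. dot n x x = 1 \<and> (\<forall>i>n. x i = 0)}"
  by (simp add: nsphere dot_def power2_eq_square)

lemma continuous_map_into_nsphere:
  "continuous_map X (nsphere n) f \<longleftrightarrow>
     (\<forall>k. continuous_map X euclideanreal (\<lambda>x. f x k)) \<and> (\<forall>x\<in>topspace X. f x \<in> topspace (nsphere n))"
proof -
  have "nsphere n = subtopology (powertop_real UNIV) (topspace (nsphere n))"
    by (simp add: nsphere)
  then have "continuous_map X (nsphere n) f \<longleftrightarrow>
      continuous_map X (subtopology (powertop_real UNIV) (topspace (nsphere n))) f"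
    by (rule arg_cong)
  then show ?thesis
    by (auto simp: continuous_map_in_subtopology continuous_map_componentwise_UNIV)
qed

lemma continuous_map_nsphere_component:
  "continuous_map X (nsphere n) f \<Longrightarrow> continuous_map X euclideanreal (\<lambda>x. f x k)"
  by (simp add: continuous_map_into_nsphere)

lemma continuous_map_nsphere_in:
  "continuous_map X (nsphere n) f \<Longrightarrow> x \<in> topspace X \<Longrightarrow> f x \<in> topspace (nsphere n)"
  by (simp add: continuous_map_into_nsphere)

lemma dot_commute: "dot n x y = dot n y x"
  by (simp add: dot_def mult.commute)

lemma dot_linear:
  "dot n (\<lambda>i. a * x i + b * y i) z = a * dot n x z + b * dot n y z"
  by (simp add: dot_def sum.distrib sum_distrib_left algebra_simps)

lemma dot_scale: "dot n (\<lambda>i. c * x i) (\<lambda>i. c * x i) = c\<^sup>2 * dot n x x"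
  by (simp add: dot_def power2_eq_square sum_distrib_left algebra_simps)

lemma dot_antipode [simp]: "dot n (antipode x) y = - dot n x y" "dot n x (antipode y) = - dot n x y"
  by (simp_all add: dot_def sum_negf)

lemma dot_nonneg: "dot n x x \<ge> 0"
  by (simp add: dot_def sum_nonneg)

lemma dot_eq_0: "dot n x x = 0 \<longleftrightarrow> (\<forall>i\<le>n. x i = 0)"
  by (auto simp: dot_def sum_nonneg_eq_0_iff)

lemma continuous_map_dot:
  assumes "\<And>k. k \<le> n \<Longrightarrow> continuous_map X euclideanreal (\<lambda>x. f x k)"
    and "\<And>k. k \<le> n \<Longrightarrow> continuous_map X euclideanreal (\<lambda>x. g x k)"
  shows "continuous_map X euclideanreal (\<lambda>x. dot n (f x) (g x))"
  unfolding dot_def by (intro continuous_map_sum continuous_map_real_mult assms) auto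

lemma antipode_in_nsphere [simp]: "antipode x \<in> topspace (nsphere n) \<longleftrightarrow> x \<in> topspace (nsphere n)"
  by (simp add: topspace_nsphere)

lemma continuous_map_antipode:
  "continuous_map X (nsphere n) f \<Longrightarrow> continuous_map X (nsphere n) (\<lambda>x. antipode (f x))"
  by (auto simp: continuous_map_into_nsphere intro: continuous_map_minus)

text \<open>The squared length of the vector sum of \<open>x\<close> and \<open>y\<close> is 2 + 2
  \<open>dot n x y\<close>; it is nonnegative, and zero exactly for antipodal points.\<close>

lemma nsphere_dot_ge:
  assumes "x \<in> topspace (nsphere n)" "y \<in> topspace (nsphere n)"
  shows "dot n x y \<ge> -1" "dot n x y = -1 \<longleftrightarrow> x = antipode y"
proof -
  have *: "dot n (\<lambda>i. 1 * x i + 1 * y i) (\<lambda>i. 1 * x i + 1 * y i) = 2 + 2 * dot n x y"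
    unfolding dot_linear using assms
    by (subst (1 2) dot_commute, unfold dot_linear) (auto simp: topspace_nsphere dot_commute[of n y x])
  then show "dot n x y \<ge> -1"
    using dot_nonneg[of n "\<lambda>i. 1 * x i + 1 * y i"] by simp
  have "dot n x y = -1 \<longleftrightarrow> (\<forall>i\<le>n. x i + y i = 0)"
    using * dot_eq_0[of n "\<lambda>i. 1 * x i + 1 * y i"] by auto
  also have "\<dots> \<longleftrightarrow> x = antipode y"
    using assms by (auto simp: topspace_nsphere fun_eq_iff eq_neg_iff_add_eq_0) (metis add_0 linorder_not_less)
  finally show "dot n x y = -1 \<longleftrightarrow> x = antipode y" .
qed

lemma nsphere_dot_le:
  assumes "x \<in> topspace (nsphere n)" "y \<in> topspace (nsphere n)"
  shows "dot n x y = 1 \<longleftrightarrow> x = y"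
  using nsphere_dot_ge(2)[of x n "antipode y"] assms by auto

section \<open>Radial projection to the sphere\<close>

definition normalise :: "nat \<Rightarrow> (nat \<Rightarrow> real) \<Rightarrow> nat \<Rightarrow> real" where
  "normalise n x = (\<lambda>i. x i / sqrt (dot n x x))"

lemma normalise_in_nsphere:
  assumes "dot n x x \<noteq> 0" "\<And>i. i > n \<Longrightarrow> x i = 0"
  shows "normalise n x \<in> topspace (nsphere n)"
proof -
  have "dot n x x > 0" using assms(1) dot_nonneg[of n x] by linarith
  then have "dot n (normalise n x) (normalise n x) = 1"
    by (simp add: dot_def normalise_def flip: sum_divide_distrib)
  then show ?thesis
    using assms by (simp add: topspace_nsphere) (simp add: normalise_def)
qed

lemma normalise_eq [simp]: "x \<in> topspace (nsphere n) \<Longrightarrow> normalise n x = x"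
  by (simp add: normalise_def topspace_nsphere)

lemma normalise_scale:
  assumes "x \<in> topspace (nsphere n)" "c \<noteq> 0"
  shows "normalise n (\<lambda>i. c * x i) = (if c > 0 then x else antipode x)"
proof -
  have "sqrt (dot n (\<lambda>i. c * x i) (\<lambda>i. c * x i)) = \<bar>c\<bar>"
    using assms by (simp add: dot_scale topspace_nsphere)
  then show ?thesis
    using assms(2) by (auto simp: normalise_def fun_eq_iff)
qed

lemma continuous_map_normalise:
  assumes "\<And>k. continuous_map X euclideanreal (\<lambda>x. f x k)"
    and "\<And>x. x \<in> topspace X \<Longrightarrow> dot n (f x) (f x) \<noteq> 0"
    and "\<And>x i. x \<in> topspace X \<Longrightarrow> i > n \<Longrightarrow> f x i = 0"
  shows "continuous_map X (nsphere n) (\<lambda>x. normalise n (f x))"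
  unfolding continuous_map_into_nsphere
proof (intro conjI allI ballI)
  fix k
  show "continuous_map X euclideanreal (\<lambda>x. normalise n (f x) k)"
    unfolding normalise_def
    by (intro continuous_map_real_divide continuous_map_sqrt continuous_map_dot assms(1))
       (use assms(2) in auto)
qed (use assms normalise_in_nsphere in auto)

text \<open>The segment from \<open>f x\<close> to \<open>g x\<close> avoids the origin unless the
  two points are antipodal, so it can be projected radially to the sphere.\<close>

lemma homotopic_non_antipodal:
  assumes f: "continuous_map X (nsphere n) f" and g: "continuous_map X (nsphere n) g"
    and ne: "\<And>x. x \<in> topspace X \<Longrightarrow> f x \<noteq> antipode (g x)"
  obtains h where "continuous_map (prod_topology unit_interval X) (nsphere n) h"
    "\<And>x. x \<in> topspace X \<Longrightarrow> h (0, x) = f x" "\<And>x. x \<in> topspace X \<Longrightarrow> h (1, x) = g x"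
proof -
  define k where "k \<equiv> \<lambda>p i. (1 - fst p) * f (snd p) i + fst p * g (snd p) i"
  have fi: "f x \<in> topspace (nsphere n)" and gi: "g x \<in> topspace (nsphere n)" if "x \<in> topspace X" for x
    using continuous_map_nsphere_in[OF f that] continuous_map_nsphere_in[OF g that] by auto
  have nz: "dot n (k (t, x)) (k (t, x)) \<noteq> 0" if x: "x \<in> topspace X" and t: "0 \<le> t" "t \<le> 1" for t x
  proof
    let ?d = "dot n (f x) (g x)"
    assume "dot n (k (t, x)) (k (t, x)) = 0"
    moreover have "dot n (k (t, x)) (k (t, x)) = (1 - t)\<^sup>2 + t\<^sup>2 + 2 * t * (1 - t) * ?d"
      unfolding k_def fst_conv snd_conv dot_linear
      apply (subst (1 2) dot_commute, unfold dot_linear)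
      using fi[OF x] gi[OF x] dot_commute[of n "g x" "f x"]
      by (simp add: topspace_nsphere power2_eq_square algebra_simps)
    \<comment> \<open>For 0 < \<open>t\<close> < 1 and \<open>?d\<close> > -1 this expression is
      strictly larger than \<open>(1 - 2 * t)\<^sup>2\<close>, so it cannot vanish.\<close>
    ultimately have e: "(1 - t)\<^sup>2 + t\<^sup>2 + 2 * t * (1 - t) * ?d = 0" by simp
    have d: "?d > -1"
      using nsphere_dot_ge[OF fi[OF x] gi[OF x]] ne[OF x] by linarith
    show False
    proof (cases "t = 0 \<or> t = 1")
      case False
      then have "t * (1 - t) > 0" using t by simp
      then have "2 * (t * (1 - t)) * ?d > 2 * (t * (1 - t)) * (-1)"
        using d by (intro mult_strict_left_mono) auto
      moreover have "(1 - t)\<^sup>2 + t\<^sup>2 - 2 * (t * (1 - t)) = (1 - 2 * t)\<^sup>2"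
        by (simp add: power2_eq_square algebra_simps)
      ultimately show False using e zero_le_power2[of "1 - 2 * t"] by (simp add: mult.assoc)
    qed (use e in auto)
  qed
  have comp: "continuous_map (prod_topology unit_interval X) euclideanreal (\<lambda>p. f (snd p) j)"
     "continuous_map (prod_topology unit_interval X) euclideanreal (\<lambda>p. g (snd p) j)" for j
    using continuous_map_compose[OF continuous_map_snd continuous_map_nsphere_component[OF f]]
      continuous_map_compose[OF continuous_map_snd continuous_map_nsphere_component[OF g]] by (simp_all add: o_def)
  have fst: "continuous_map (prod_topology unit_interval X) euclideanreal fst"
    using continuous_map_fst continuous_map_in_subtopology by blast
  show thesis
  proof
    show "continuous_map (prod_topology unit_interval X) (nsphere n) (\<lambda>p. normalise n (k p))"
    proof (rule continuous_map_normalise)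
      show "continuous_map (prod_topology unit_interval X) euclideanreal (\<lambda>p. k p j)" for j
        unfolding k_def
        by (intro continuous_map_add continuous_map_real_mult continuous_map_diff comp fst) auto
      show "dot n (k p) (k p) \<noteq> 0" if "p \<in> topspace (prod_topology unit_interval X)" for p
        using that nz by (cases p) auto
      show "k p i = 0" if "p \<in> topspace (prod_topology unit_interval X)" "i > n" for p i
        using that fi gi by (cases p) (auto simp: k_def topspace_nsphere)
    qed
  qed (use fi gi in \<open>simp_all add: k_def\<close>)
qed

text \<open>The sphere is cut out by one closed condition from a product of compact intervals, with
  factor {0} in each coordinate beyond \<open>n\<close>; compactness of the product is Tychonoff's
  theorem.\<close>

lemma compact_space_nsphere: "compact_space (nsphere n)"
proof -
  let ?B = "\<lambda>i. if i \<le> n then {-1..1::real} else {0}"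
  have c: "compactin (powertop_real UNIV) (PiE UNIV ?B)"
    by (auto simp: compactin_PiE)
  have bd: "- 1 \<le> x i \<and> x i \<le> 1" if x: "dot n x x = 1" and i: "i \<le> n" for x i
  proof -
    have "(x i)\<^sup>2 \<le> (\<Sum>i\<le>n. (x i)\<^sup>2)"
      using i by (intro member_le_sum) auto
    then have "(x i)\<^sup>2 \<le> 1" using x by (simp add: dot_def power2_eq_square)
    then show ?thesis by (simp add: abs_square_le_1 abs_le_iff)
  qed
  have "topspace (nsphere n) = PiE UNIV ?B \<inter> {x \<in> topspace (powertop_real UNIV). dot n x x \<in> {1}}"
  proof (intro Set.set_eqI iffI)
    fix x assume "x \<in> topspace (nsphere n)"
    then have x: "dot n x x = 1" "\<And>i. i > n \<Longrightarrow> x i = 0" by (auto simp: topspace_nsphere)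
    have "x i \<in> ?B i" for i
      using bd[OF x(1), of i] x(2)[of i] by (cases "i \<le> n") auto
    then show "x \<in> PiE UNIV ?B \<inter> {x \<in> topspace (powertop_real UNIV). dot n x x \<in> {1}}"
      using x(1) by (simp add: PiE_iff)
  next
    fix x assume "x \<in> PiE UNIV ?B \<inter> {x \<in> topspace (powertop_real UNIV). dot n x x \<in> {1}}"
    then have x: "dot n x x = 1" "\<And>i. x i \<in> ?B i" by (auto simp only: PiE_iff Int_iff mem_Collect_eq UNIV_I)
    have "x i = 0" if "i > n" for i
      using x(2)[of i] that by simp
    then show "x \<in> topspace (nsphere n)"
      using x(1) by (simp add: topspace_nsphere)
  qed
  moreover have "closedin (powertop_real UNIV) {x \<in> topspace (powertop_real UNIV). dot n x x \<in> {1}}"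
  proof (rule closedin_continuous_map_preimage)
    show "continuous_map (powertop_real UNIV) euclideanreal (\<lambda>x. dot n x x)"
      by (intro continuous_map_dot continuous_map_product_projection) auto
  qed auto
  ultimately have "compactin (powertop_real UNIV) (topspace (nsphere n))"
    using compact_Int_closedin[OF c] by simp
  moreover have "nsphere n = subtopology (powertop_real UNIV) (topspace (nsphere n))"
    by (simp add: nsphere)
  ultimately show ?thesis
    using compact_space_subtopology by metis
qed

lemma compact_space_cube: "compact_space (cube i)"
proof -
  let ?B = "\<lambda>j. if j < i then {0..1::real} else {0}"
  have "compactin (powertop_real UNIV) (PiE UNIV ?B)"
    by (auto simp: compactin_PiE)
  moreover have "{x. \<forall>j\<ge>i. x j = 0} \<inter> {s. \<forall>j<i. 0 \<le> s j \<and> s j \<le> 1} = PiE UNIV ?B"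
  proof -
    have *: "(\<forall>j. x j \<in> ?B j) \<longleftrightarrow> (\<forall>j\<ge>i. x j = 0) \<and> (\<forall>j<i. 0 \<le> x j \<and> x j \<le> 1)" for x
    proof
      assume l: "\<forall>j. x j \<in> ?B j"
      have "x j \<in> (if j < i then {0..1} else {0})" for j using l by blast
      then show "(\<forall>j\<ge>i. x j = 0) \<and> (\<forall>j<i. 0 \<le> x j \<and> x j \<le> 1)"
        by (metis atLeastAtMost_iff linorder_not_less singletonD)
    qed auto
    show ?thesis
      by (intro Set.set_eqI) (simp only: PiE_iff Int_iff mem_Collect_eq UNIV_I * extensional_UNIV ball_UNIV simp_thms)
  qed
  then have "cube i = subtopology (powertop_real UNIV) (PiE UNIV ?B)"
    unfolding cube_def Euclidean_space_def subtopology_subtopology by (rule arg_cong)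
  ultimately show ?thesis
    by (simp add: compact_space_subtopology)
qed

lemma contractible_space_cube: "contractible_space (cube i)"
proof -
  have "homotopic_with (\<lambda>x. True) (cube i) (cube i) id (\<lambda>x. (\<lambda>j. 0))"
    unfolding homotopic_with_def
  proof (intro exI[of _ "\<lambda>p j. (1 - fst p) * snd p j"] conjI)
    have "continuous_map (prod_topology unit_interval (cube i)) euclideanreal (\<lambda>p. snd p k)" for k
      using continuous_map_compose[OF continuous_map_snd continuous_map_cube_projection] by (simp add: o_def)
    moreover have "continuous_map (prod_topology unit_interval (cube i)) euclideanreal fst"
      using continuous_map_fst continuous_map_in_subtopology by blast
    ultimately show "continuous_map (prod_topology unit_interval (cube i)) (cube i) (\<lambda>p j. (1 - fst p) * snd p j)"
      unfolding continuous_map_into_cube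
      by (auto simp: topspace_cube mult_le_one intro!: continuous_map_real_mult continuous_map_diff)
  qed auto
  then show ?thesis
    unfolding contractible_space_def by blast
qed

lemma connected_space_cube: "connected_space (cube i)"
  by (simp add: contractible_imp_connected_space contractible_space_cube)

section \<open>Maps into projective space\<close>

lemma antipodal_pair_eq_iff: "antipodal_pair x = antipodal_pair y \<longleftrightarrow> x = y \<or> x = antipode y"
  unfolding antipodal_pair_def antipode_def[symmetric]
  by (metis antipode_antipode doubleton_eq_iff insert_absorb2)

lemma antipodal_pair_antipode [simp]: "antipodal_pair (antipode x) = antipodal_pair x"
  by (simp add: antipodal_pair_eq_iff)

lemma topspace_RP: "topspace (real_projective_space n) = antipodal_pair ` topspace (nsphere n)"
  by (simp add: real_projective_space_def)

lemma quotient_map_RP: "quotient_map (nsphere n) (real_projective_space n) antipodal_pair"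
  by (simp add: real_projective_space_def quotient_map_quotient_topology)

lemma continuous_map_RP: "continuous_map (nsphere n) (real_projective_space n) antipodal_pair"
  using quotient_map_RP quotient_imp_continuous_map by blast

lemma continuous_map_antipodal_pair:
  "continuous_map X (nsphere n) f \<Longrightarrow> continuous_map X (real_projective_space n) (\<lambda>x. antipodal_pair (f x))"
  using continuous_map_compose[OF _ continuous_map_RP] by (simp add: o_def)

section \<open>Maps and homotopies that descend to projective space\<close>

lemma RP_map_from_odd:
  assumes F: "continuous_map (nsphere n) (nsphere m) F"
    and odd: "\<And>x. x \<in> topspace (nsphere n) \<Longrightarrow> F (antipode x) = antipode (F x)"
  obtains f where "continuous_map (real_projective_space n) (real_projective_space m) f"
    "\<And>x. x \<in> topspace (nsphere n) \<Longrightarrow> f (antipodal_pair x) = antipodal_pair (F x)"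
proof (rule quotient_map_lift_exists[OF quotient_map_RP continuous_map_antipodal_pair[OF F]])
  show "antipodal_pair (F x) = antipodal_pair (F y)"
    if "x \<in> topspace (nsphere n)" "y \<in> topspace (nsphere n)" "antipodal_pair x = antipodal_pair y" for x y
    using that odd by (auto simp: antipodal_pair_eq_iff)
qed (use that in blast)

text \<open>Continuity of the descended homotopy rests on the fact that the product of a quotient
  map with the identity of a locally compact Hausdorff space, here the interval, is again a quotient
  map.\<close>

lemma RP_homotopy_from_odd:
  assumes F: "continuous_map (prod_topology unit_interval (nsphere n)) (nsphere m) F"
    and odd: "\<And>t x. t \<in> {0..1} \<Longrightarrow> x \<in> topspace (nsphere n) \<Longrightarrow> F (t, antipode x) = antipode (F (t, x))"
  obtains f where "continuous_map (prod_topology unit_interval (real_projective_space n)) (real_projective_space m) f"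
    "\<And>t x. t \<in> {0..1} \<Longrightarrow> x \<in> topspace (nsphere n) \<Longrightarrow> f (t, antipodal_pair x) = antipodal_pair (F (t, x))"
proof -
  have q: "quotient_map (prod_topology unit_interval (nsphere n)) (prod_topology unit_interval (real_projective_space n))
          (\<lambda>(t, x). (t, antipodal_pair x))"
    by (rule quotient_map_prod_right)
       (auto simp: quotient_map_RP Hausdorff_space_subtopology intro!: compact_imp_locally_compact_space compact_space_subtopology)
  show thesis
  proof (rule quotient_map_lift_exists[OF q continuous_map_antipodal_pair[OF F]])
    show "antipodal_pair (F x) = antipodal_pair (F y)"
      if "x \<in> topspace (prod_topology unit_interval (nsphere n))" "y \<in> topspace (prod_topology unit_interval (nsphere n))"
        "(\<lambda>(t, x). (t, antipodal_pair x)) x = (\<lambda>(t, x). (t, antipodal_pair x)) y" for x y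
      using that odd by (auto simp: antipodal_pair_eq_iff)
  next
    fix g
    assume g: "continuous_map (prod_topology unit_interval (real_projective_space n)) (real_projective_space m) g"
      and *: "\<And>x. x \<in> topspace (prod_topology unit_interval (nsphere n)) \<Longrightarrow>
                g ((\<lambda>(t, x). (t, antipodal_pair x)) x) = antipodal_pair (F x)"
    show thesis
      by (rule that[OF g]) (use * in force)
  qed
qed

text \<open>A line is recorded by the matrix of the orthogonal projection onto it.\<close>

definition line_matrix :: "(nat \<Rightarrow> real) set \<Rightarrow> nat \<Rightarrow> nat \<Rightarrow> real" where
  "line_matrix L i j = (let x = (SOME x. x \<in> L) in x i * x j)"

text \<open>Products of two coordinates do not see the sign of the representative, so the choice
  made by \<open>SOME\<close> is harmless.\<close>

lemma line_matrix [simp]: "line_matrix (antipodal_pair x) i j = x i * x j"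
proof -
  have "(SOME y. y \<in> antipodal_pair x) \<in> antipodal_pair x"
    by (rule someI[of _ x]) (simp add: antipodal_pair_def)
  then show ?thesis
    by (auto simp: line_matrix_def antipodal_pair_def Let_def)
qed

lemma continuous_map_line_matrix:
  "continuous_map (real_projective_space n) euclideanreal (\<lambda>L. line_matrix L i j)"
  by (rule continuous_compose_quotient_map[OF quotient_map_RP])
     (simp add: o_def continuous_map_real_mult continuous_map_nsphere_projection)

lemma continuous_map_line_matrix_comp:
  "continuous_map X (real_projective_space n) f \<Longrightarrow> continuous_map X euclideanreal (\<lambda>x. line_matrix (f x) i j)"
  using continuous_map_compose[OF _ continuous_map_line_matrix] by (simp add: o_def)

text \<open>Projecting \<open>g z\<close> to the line \<open>\<phi> z\<close> selects the representative on the side of \<open>g z\<close>.\<close>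

lemma RP_lift_step:
  assumes \<phi>: "continuous_map Z (real_projective_space n) \<phi>" and g: "continuous_map Z (nsphere n) g"
    and ne: "\<And>z x. z \<in> topspace Z \<Longrightarrow> x \<in> topspace (nsphere n) \<Longrightarrow> \<phi> z = antipodal_pair x \<Longrightarrow> dot n x (g z) \<noteq> 0"
  obtains \<psi> where "continuous_map Z (nsphere n) \<psi>"
    "\<And>z. z \<in> topspace Z \<Longrightarrow> antipodal_pair (\<psi> z) = \<phi> z"
    "\<And>z. z \<in> topspace Z \<Longrightarrow> antipodal_pair (g z) = \<phi> z \<Longrightarrow> \<psi> z = g z"
proof -
  define k where "k \<equiv> \<lambda>z i. if i \<le> n then (\<Sum>j\<le>n. line_matrix (\<phi> z) i j * g z j) else 0"
  have *: "\<exists>x\<in>topspace (nsphere n). \<phi> z = antipodal_pair x \<and> k z = (\<lambda>i. dot n x (g z) * x i) \<and> dot n x (g z) \<noteq> 0"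
    if z: "z \<in> topspace Z" for z
  proof -
    obtain x where x: "x \<in> topspace (nsphere n)" "\<phi> z = antipodal_pair x"
      using continuous_map_image_subset_topspace[OF \<phi>] z unfolding topspace_RP by blast
    have "k z i = dot n x (g z) * x i" for i
      using x(1) by (auto simp: k_def x(2) dot_def sum_distrib_left sum_distrib_right algebra_simps topspace_nsphere)
    then show ?thesis using x ne[OF z x] by blast
  qed
  have nz: "dot n (k z) (k z) \<noteq> 0 \<and> (\<forall>i>n. k z i = 0)" if z: "z \<in> topspace Z" for z
  proof -
    obtain x where x: "x \<in> topspace (nsphere n)" "k z = (\<lambda>i. dot n x (g z) * x i)" "dot n x (g z) \<noteq> 0"
      using *[OF z] by blast
    have "dot n (k z) (k z) = (dot n x (g z))\<^sup>2 * dot n x x"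
      unfolding x(2) by (rule dot_scale)
    then show ?thesis using x by (simp add: topspace_nsphere)
  qed
  show thesis
  proof
    show "continuous_map Z (nsphere n) (\<lambda>z. normalise n (k z))"
    proof (rule continuous_map_normalise)
      show "continuous_map Z euclideanreal (\<lambda>z. k z i)" for i
        unfolding k_def
        by (cases "i \<le> n") (auto intro!: continuous_map_sum continuous_map_real_mult
            continuous_map_line_matrix_comp[OF \<phi>] continuous_map_nsphere_component[OF g])
    qed (use nz in auto)
    fix z assume z: "z \<in> topspace Z"
    obtain x where x: "x \<in> topspace (nsphere n)" "\<phi> z = antipodal_pair x"
       "k z = (\<lambda>i. dot n x (g z) * x i)" "dot n x (g z) \<noteq> 0"
      using *[OF z] by blast
    show "antipodal_pair (normalise n (k z)) = \<phi> z"
      unfolding x(3) normalise_scale[OF x(1,4)] by (simp add: x(2))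
    show "normalise n (k z) = g z" if "antipodal_pair (g z) = \<phi> z"
      using that x(1) unfolding x(3) normalise_scale[OF x(1,4)] x(2)
      by (auto simp: antipodal_pair_eq_iff topspace_nsphere)
  qed
qed

text \<open>\<open>RP_lift_step\<close> can follow a moving line as long as it does not become
  orthogonal to the last representative. Compactness of \<open>Z\<close> gives a uniform time span
  in which this cannot happen, and the interval is divided into steps shorter than that.\<close>

lemma RP_homotopy_lift:
  assumes h: "continuous_map (prod_topology unit_interval Z) (real_projective_space n) h"
    and Z: "compact_space Z" and g0: "continuous_map Z (nsphere n) g0"
    and hg: "\<And>z. z \<in> topspace Z \<Longrightarrow> h (0, z) = antipodal_pair (g0 z)"
  obtains g where "continuous_map (prod_topology unit_interval Z) (nsphere n) g"
    "\<And>t z. t \<in> {0..1} \<Longrightarrow> z \<in> topspace Z \<Longrightarrow> antipodal_pair (g (t, z)) = h (t, z)"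
    "\<And>z. z \<in> topspace Z \<Longrightarrow> g (0, z) = g0 z"
proof -
  let ?I = "prod_topology unit_interval Z"
  let ?W = "prod_topology unit_interval ?I"
  \<comment> \<open>The trace of the product of two projection matrices: the squared cosine of the
    angle between the lines at two times. Being written in \<open>line_matrix\<close>, it is
    continuous without any choice of representatives.\<close>
  define E where "E \<equiv> \<lambda>w. \<Sum>i\<le>n. \<Sum>j\<le>n. line_matrix (h (fst w, snd (snd w))) i j * line_matrix (h (snd w)) i j"
  have E: "E (s, t, z) = (dot n x y)\<^sup>2" if "h (s, z) = antipodal_pair x" "h (t, z) = antipodal_pair y" for s t z x y
    by (simp add: E_def that dot_def power2_eq_square sum_product algebra_simps)
  have cE: "continuous_map ?W euclideanreal E"
    unfolding E_def
  proof (intro continuous_map_sum continuous_map_real_mult continuous_map_line_matrix_comp)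
    have "continuous_map ?W Z (\<lambda>w. snd (snd w))"
      using continuous_map_compose[OF continuous_map_snd continuous_map_snd] by (simp add: o_def)
    then have "continuous_map ?W ?I (\<lambda>w. (fst w, snd (snd w)))"
      by (simp add: continuous_map_pairwise o_def continuous_map_fst)
    from continuous_map_compose[OF this h]
    show "continuous_map ?W (real_projective_space n) (\<lambda>w. h (fst w, snd (snd w)))" by (simp add: o_def)
    show "continuous_map ?W (real_projective_space n) (\<lambda>w. h (snd w))"
      using continuous_map_compose[OF continuous_map_snd h] by (simp add: o_def)
  qed auto
  define K where "K = {w \<in> topspace ?W. E w \<in> {0}}"
  have "compact_space ?W"
    by (simp add: compact_space_prod_topology Z compact_space_subtopology)
  moreover have "closedin ?W K"
    unfolding K_def by (rule closedin_continuous_map_preimage[OF cE]) auto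
  ultimately have cK: "compactin ?W K"
    by (simp add: closedin_compact_space)
  have "continuous_map ?W euclideanreal (\<lambda>w. \<bar>fst w - fst (snd w)\<bar>)"
  proof (intro continuous_map_real_abs continuous_map_diff)
    show "continuous_map ?W euclideanreal fst"
      using continuous_map_fst continuous_map_in_subtopology by blast
    have "continuous_map ?W unit_interval (\<lambda>w. fst (snd w))"
      using continuous_map_compose[OF continuous_map_snd continuous_map_fst] by (simp add: o_def)
    then show "continuous_map ?W euclideanreal (\<lambda>w. fst (snd w))"
      using continuous_map_in_subtopology by blast
  qed
  from image_compactin[OF cK this] have cim: "compact ((\<lambda>w. \<bar>fst w - fst (snd w)\<bar>) ` K)" by simp
  have posK: "\<bar>fst w - fst (snd w)\<bar> > 0" if wK: "w \<in> K" for w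
  proof (rule ccontr)
    assume "\<not> ?thesis"
    then obtain t z where w: "w = (t, t, z)" "t \<in> {0..1}" "z \<in> topspace Z"
      using wK by (cases w) (auto simp: K_def)
    obtain x where x: "x \<in> topspace (nsphere n)" "h (t, z) = antipodal_pair x"
    proof -
      have "h (t, z) \<in> topspace (real_projective_space n)"
        by (rule continuous_map_image_subset_topspace[OF h, THEN subsetD], rule imageI) (use w in simp)
      then show thesis using that unfolding topspace_RP by blast
    qed
    show False
      using wK E[OF x(2) x(2)] x(1) by (simp add: K_def w topspace_nsphere)
  qed
  \<comment> \<open>The set \<open>K\<close> of orthogonal pairs of times is compact and misses the
    diagonal, where the cosine is 1, so the time difference has a positive minimum on it.\<close>
  obtain \<delta> where \<delta>: "\<delta> > 0" "\<And>w. w \<in> K \<Longrightarrow> \<bar>fst w - fst (snd w)\<bar> \<ge> \<delta>"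
  proof (cases "K = {}")
    case False
    then obtain w0 where "w0 \<in> K" "\<forall>w\<in>K. \<bar>fst w0 - fst (snd w0)\<bar> \<le> \<bar>fst w - fst (snd w)\<bar>"
      using compact_attains_inf[OF cim] by auto
    then show thesis using that posK by blast
  qed (use that[of 1] in auto)
  obtain N :: nat where N: "N > 0" "1 / real N < \<delta>"
    using \<delta>(1) nat_approx_posE zero_less_Suc by (metis inverse_eq_divide reals_Archimedean)
  \<comment> \<open>After \<open>j\<close> steps the lift follows \<open>h\<close> up to time
    \<open>j / N\<close> and then stands still; the minimum keeps the domain the full interval, so
    no partial lifts have to be glued.\<close>
  have "\<exists>g. continuous_map ?I (nsphere n) g \<and>
      (\<forall>t\<in>{0..1}. \<forall>z\<in>topspace Z. antipodal_pair (g (t, z)) = h (min t (real j / real N), z)) \<and>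
      (\<forall>z\<in>topspace Z. g (0, z) = g0 z)" for j
  proof (induction j)
    case 0
    have "continuous_map ?I (nsphere n) (\<lambda>p. g0 (snd p))"
      using continuous_map_compose[OF continuous_map_snd g0] by (simp add: o_def)
    then show ?case
      by (intro exI[of _ "\<lambda>p. g0 (snd p)"]) (auto simp: hg)
  next
    case (Suc j)
    then obtain g where g: "continuous_map ?I (nsphere n) g"
        "\<And>t z. t \<in> {0..1} \<Longrightarrow> z \<in> topspace Z \<Longrightarrow> antipodal_pair (g (t, z)) = h (min t (real j / real N), z)"
        "\<And>z. z \<in> topspace Z \<Longrightarrow> g (0, z) = g0 z"
      by blast
    let ?m = "\<lambda>t. min t (real (Suc j) / real N)"
    have m: "?m t \<in> {0..1}" "min t (real j / real N) \<in> {0..1}" "\<bar>?m t - min t (real j / real N)\<bar> \<le> 1 / real N"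
      if "t \<in> {0..1}" for t
    proof -
      have "real (Suc j) / real N = real j / real N + 1 / real N" "0 \<le> real j / real N" "0 \<le> 1 / real N"
        by (simp_all add: add_divide_distrib)
      then show "?m t \<in> {0..1}" "min t (real j / real N) \<in> {0..1}" "\<bar>?m t - min t (real j / real N)\<bar> \<le> 1 / real N"
        using that unfolding atLeastAtMost_iff by linarith+
    qed
    have \<phi>: "continuous_map ?I (real_projective_space n) (\<lambda>p. h (?m (fst p), snd p))"
    proof -
      have "continuous_map ?I euclideanreal fst"
        using continuous_map_fst continuous_map_in_subtopology by blast
      then have "continuous_map ?I unit_interval (\<lambda>p. ?m (fst p))"
        using m(1) by (auto simp: continuous_map_in_subtopology intro!: continuous_map_real_min)
      then have "continuous_map ?I ?I (\<lambda>p. (?m (fst p), snd p))"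
        by (simp add: continuous_map_pairwise o_def continuous_map_snd)
      from continuous_map_compose[OF this h] show ?thesis by (simp add: o_def)
    qed
    obtain \<psi> where \<psi>: "continuous_map ?I (nsphere n) \<psi>"
        "\<And>p. p \<in> topspace ?I \<Longrightarrow> antipodal_pair (\<psi> p) = h (?m (fst p), snd p)"
        "\<And>p. p \<in> topspace ?I \<Longrightarrow> antipodal_pair (g p) = h (?m (fst p), snd p) \<Longrightarrow> \<psi> p = g p"
    proof (rule RP_lift_step[OF \<phi> g(1)])
      fix p x assume p: "p \<in> topspace ?I" and x: "x \<in> topspace (nsphere n)" "h (?m (fst p), snd p) = antipodal_pair x"
      obtain t z where tz: "p = (t, z)" "t \<in> {0..1}" "z \<in> topspace Z" using p by (cases p) auto
      show "dot n x (g p) \<noteq> 0"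
      proof
        assume "dot n x (g p) = 0"
        then have "E (?m t, min t (real j / real N), z) = 0"
          using E[of "?m t" z x "min t (real j / real N)" "g (t, z)"] x(2) g(2)[OF tz(2,3)] tz(1) by simp
        then have "(?m t, min t (real j / real N), z) \<in> K"
          using m[OF tz(2)] tz by (simp add: K_def)
        from \<delta>(2)[OF this] m(3)[OF tz(2)] N(2) show False by simp
      qed
    qed blast
    show ?case
    proof (intro exI[of _ \<psi>] conjI ballI)
      \<comment> \<open>At time 0 the old lift already covers the right line, and in that case
        \<open>RP_lift_step\<close> leaves it unchanged.\<close>
      show "\<psi> (0, z) = g0 z" if "z \<in> topspace Z" for z
        using \<psi>(3)[of "(0, z)"] g(3)[of z] g(2)[of 0 z] that N by simp
    qed (use \<psi> in auto)
  qed
  from this[of N] obtain g where g: "continuous_map ?I (nsphere n) g"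
      "\<And>t z. t \<in> {0..1} \<Longrightarrow> z \<in> topspace Z \<Longrightarrow> antipodal_pair (g (t, z)) = h (min t (real N / real N), z)"
      "\<And>z. z \<in> topspace Z \<Longrightarrow> g (0, z) = g0 z"
    by blast
  show thesis
    by (rule that[OF g(1) _ g(3)]) (use g(2) N(1) in \<open>auto simp: min_def\<close>)
qed

text \<open>The inner product of two lifts is continuous and takes only the values 1 and -1, so it
  is constant on a connected space.\<close>

lemma RP_lift_unique:
  assumes Z: "connected_space Z" and f: "continuous_map Z (nsphere n) f" and g: "continuous_map Z (nsphere n) g"
    and eq: "\<And>z. z \<in> topspace Z \<Longrightarrow> antipodal_pair (f z) = antipodal_pair (g z)"
  shows "(\<forall>z\<in>topspace Z. f z = g z) \<or> (\<forall>z\<in>topspace Z. f z = antipode (g z))"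
proof -
  let ?d = "\<lambda>z. dot n (f z) (g z)"
  have "continuous_map Z euclideanreal ?d"
    by (intro continuous_map_dot continuous_map_nsphere_component[OF f] continuous_map_nsphere_component[OF g])
  then have con: "connected (?d ` topspace Z)"
    using connectedin_continuous_map_image[of Z euclideanreal ?d "topspace Z"] Z by (simp add: connectedin_topspace)
  have d: "?d z = 1 \<longleftrightarrow> f z = g z" "?d z = -1 \<longleftrightarrow> f z = antipode (g z)" if "z \<in> topspace Z" for z
    using nsphere_dot_le nsphere_dot_ge(2) continuous_map_nsphere_in[OF f that] continuous_map_nsphere_in[OF g that] by auto
  have pm: "?d z = 1 \<or> ?d z = -1" if "z \<in> topspace Z" for z
    using eq[OF that] d[OF that] by (auto simp: antipodal_pair_eq_iff)
  have "\<not> (\<exists>z\<in>topspace Z. \<exists>w\<in>topspace Z. ?d z = 1 \<and> ?d w = -1)"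
  proof
    assume "\<exists>z\<in>topspace Z. \<exists>w\<in>topspace Z. ?d z = 1 \<and> ?d w = -1"
    then obtain z w where zw: "z \<in> topspace Z" "w \<in> topspace Z" "?d z = 1" "?d w = -1" by blast
    have "1 \<in> ?d ` topspace Z" "-1 \<in> ?d ` topspace Z"
      using imageI[OF zw(1), of ?d] imageI[OF zw(2), of ?d] unfolding zw(3,4) by simp_all
    then have "0 \<in> ?d ` topspace Z"
      using connectedD_interval[OF con, of "-1" 1 0] by simp
    then obtain v where "v \<in> topspace Z" "0 = ?d v" by (rule imageE)
    then show False using pm[of v] by simp
  qed
  then have "(\<forall>z\<in>topspace Z. ?d z = 1) \<or> (\<forall>z\<in>topspace Z. ?d z = -1)"
    using pm by metis
  then show ?thesis by (simp add: d)
qed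

text \<open>Run backwards, a contraction is a homotopy from a constant map to the identity. Composed
  with \<open>\<phi>\<close> it starts at a map that lifts trivially, and the end of the lifted
  homotopy covers \<open>\<phi>\<close>. The prescribed value \<open>y\<close> is reached after at
  most one change of sign.\<close>

lemma RP_lift_contractible:
  assumes Z: "contractible_space Z" "compact_space Z" and \<phi>: "continuous_map Z (real_projective_space n) \<phi>"
    and z0: "z0 \<in> topspace Z" and y: "y \<in> topspace (nsphere n)" "\<phi> z0 = antipodal_pair y"
  obtains \<psi> where "continuous_map Z (nsphere n) \<psi>"
    "\<And>z. z \<in> topspace Z \<Longrightarrow> antipodal_pair (\<psi> z) = \<phi> z" "\<psi> z0 = y"
proof -
  obtain a where "homotopic_with (\<lambda>x. True) Z Z (\<lambda>x. a) id"
    using Z(1) unfolding contractible_space_def by (meson homotopic_with_symD)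
  then obtain k where k: "continuous_map (prod_topology unit_interval Z) Z k" "\<And>x. k (0, x) = a" "\<And>x. k (1, x) = x"
    unfolding homotopic_with_def by auto
  have a: "a \<in> topspace Z"
    using continuous_map_image_subset_topspace[OF k(1)] k(2)[of z0] z0 by force
  obtain b where b: "b \<in> topspace (nsphere n)" "\<phi> a = antipodal_pair b"
    using continuous_map_image_subset_topspace[OF \<phi>] a unfolding topspace_RP by blast
  obtain g where g: "continuous_map (prod_topology unit_interval Z) (nsphere n) g"
    "\<And>t z. t \<in> {0..1} \<Longrightarrow> z \<in> topspace Z \<Longrightarrow> antipodal_pair (g (t, z)) = (\<phi> \<circ> k) (t, z)"
  proof (rule RP_homotopy_lift[OF continuous_map_compose[OF k(1) \<phi>] Z(2)])
    show "continuous_map Z (nsphere n) (\<lambda>z. b)" using b by simp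
  qed (use k b in auto)
  have g1: "continuous_map Z (nsphere n) (\<lambda>z. g (1, z))"
    using continuous_map_o_Pair[OF g(1), of 1] by (simp add: o_def)
  have g1q: "antipodal_pair (g (1, z)) = \<phi> z" if "z \<in> topspace Z" for z
    using g(2)[of 1 z] that k by simp
  then have "g (1, z0) = y \<or> antipode (g (1, z0)) = y"
    using z0 y by (metis antipodal_pair_eq_iff antipode_antipode)
  then show thesis
  proof
    assume "g (1, z0) = y" then show thesis using that[OF g1 g1q] by blast
  next
    assume "antipode (g (1, z0)) = y" then show thesis using that[OF continuous_map_antipode[OF g1]] g1q by auto
  qed
qed

text \<open>The boundary stays fixed upstairs, because the track of a boundary point lifts a
  constant path. The map \<open>a\<close> is not assumed to be a spheroid: the lift of a
  noncontractible loop takes two antipodal values on the boundary.\<close>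

lemma RP_spheroid_homotopy_lift:
  assumes a: "continuous_map (cube i) (nsphere n) a"
    and hom: "spheroid_homotopic i (real_projective_space n) p (antipodal_pair \<circ> a) \<beta>"
  obtains K where "continuous_map (prod_topology unit_interval (cube i)) (nsphere n) K"
    "\<And>s. s \<in> topspace (cube i) \<Longrightarrow> K (0, s) = a s"
    "\<And>s. s \<in> topspace (cube i) \<Longrightarrow> antipodal_pair (K (1, s)) = \<beta> s"
    "\<And>t s. t \<in> {0..1} \<Longrightarrow> s \<in> cube_boundary i \<Longrightarrow> K (t, s) = a s"
proof -
  obtain h where h: "continuous_map (prod_topology unit_interval (cube i)) (real_projective_space n) h"
     "\<forall>s\<in>topspace (cube i). h (0, s) = (antipodal_pair \<circ> a) s" "\<forall>s\<in>topspace (cube i). h (1, s) = \<beta> s"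
     "\<forall>t\<in>{0..1}. \<forall>s\<in>cube_boundary i. h (t, s) = p"
    using hom unfolding spheroid_homotopic_alt by blast
  obtain K where K: "continuous_map (prod_topology unit_interval (cube i)) (nsphere n) K"
     "\<And>t z. t \<in> {0..1} \<Longrightarrow> z \<in> topspace (cube i) \<Longrightarrow> antipodal_pair (K (t, z)) = h (t, z)"
     "\<And>z. z \<in> topspace (cube i) \<Longrightarrow> K (0, z) = a z"
    by (rule RP_homotopy_lift[OF h(1) compact_space_cube a]) (use h(2) in auto)
  have "K (t, s) = a s" if t: "t \<in> {0..1}" and s: "s \<in> cube_boundary i" for t s
  proof -
    have s': "s \<in> topspace (cube i)" using s cube_boundary_subset by blast
    have c1: "continuous_map unit_interval (nsphere n) (\<lambda>t. K (t, s))"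
      using continuous_map_compose[OF _ K(1), of unit_interval "\<lambda>t. (t, s)"] s'
      by (simp add: continuous_map_pairwise o_def)
    have c2: "continuous_map unit_interval (nsphere n) (\<lambda>t. a s)"
      using continuous_map_nsphere_in[OF a s'] by simp
    have q: "antipodal_pair (K (u, s)) = antipodal_pair (a s)" if "u \<in> topspace unit_interval" for u
      using that K(2)[of u s] K(3)[OF s'] K(2)[of 0 s] h(4) s s' by simp
    have "connected_space unit_interval" 
      by (rule connected_space_subtopology) (simp only: connectedin_iff_connected connected_Icc)
    from RP_lift_unique[OF this c1 c2 q]
    have "K (t, s) = a s \<or> (a s = antipode (a s))"
      using t K(3)[OF s'] by auto
    moreover have "a s \<noteq> antipode (a s)"
      using nsphere_dot_ge(2)[of "a s" n "a s"] continuous_map_nsphere_in[OF a s'] by (auto simp: topspace_nsphere)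
    ultimately show ?thesis by blast
  qed
  then show thesis
    using that[OF K(1) K(3)] K(2)[of 1] h(3) by simp
qed

section \<open>Extending maps from the boundary of a cube\<close>

text \<open>Stone-Weierstrass for the algebra of Lipschitz functions. It is closed under products
  because its members are bounded on the compact set, and it separates points because these are
  determined by their first \<open>m\<close> coordinates.\<close>

lemma lipschitz_approximation:
  fixes f :: "(nat \<Rightarrow> real) \<Rightarrow> real"
  assumes S: "compact S" "\<And>x j. x \<in> S \<Longrightarrow> j \<ge> m \<Longrightarrow> x j = 0" and f: "continuous_on S f" and e: "e > 0"
  obtains g L where "\<And>x. x \<in> S \<Longrightarrow> \<bar>f x - g x\<bar> < e" "L \<ge> 0"
    "\<And>x y. x \<in> S \<Longrightarrow> y \<in> S \<Longrightarrow> \<bar>g x - g y\<bar> \<le> L * (\<Sum>j<m. \<bar>x j - y j\<bar>)"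
proof -
  define d where "d \<equiv> \<lambda>x y :: nat \<Rightarrow> real. \<Sum>j<m. \<bar>x j - y j\<bar>"
  have d0: "d x y \<ge> 0" for x y by (simp add: d_def sum_nonneg)
  define R where "R = {g :: (nat \<Rightarrow> real) \<Rightarrow> real. continuous_on S g \<and> (\<exists>L\<ge>0. \<forall>x\<in>S. \<forall>y\<in>S. \<bar>g x - g y\<bar> \<le> L * d x y)}"
  interpret function_ring_on R S
  proof
    show "compact S" by (rule S)
    show "continuous_on S g" if "g \<in> R" for g using that by (simp add: R_def)
    show "(\<lambda>x. g x + h x) \<in> R" if g: "g \<in> R" and h: "h \<in> R" for g h
    proof -
      obtain L where L: "L \<ge> 0" "\<forall>x\<in>S. \<forall>y\<in>S. \<bar>g x - g y\<bar> \<le> L * d x y" using g by (auto simp: R_def)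
      obtain M where M: "M \<ge> 0" "\<forall>x\<in>S. \<forall>y\<in>S. \<bar>h x - h y\<bar> \<le> M * d x y" using h by (auto simp: R_def)
      have "\<bar>g x + h x - (g y + h y)\<bar> \<le> (L + M) * d x y" if "x \<in> S" "y \<in> S" for x y
      proof -
        have "\<bar>g x - g y\<bar> \<le> L * d x y" "\<bar>h x - h y\<bar> \<le> M * d x y" using L(2) M(2) that by blast+
        then show ?thesis by (simp add: distrib_right)
      qed
      moreover have "continuous_on S (\<lambda>x. g x + h x)"
        using g h by (auto simp: R_def intro: continuous_on_add)
      ultimately show ?thesis
        using L(1) M(1) by (auto simp: R_def intro!: exI[of _ "L + M"])
    qed
    show "(\<lambda>x. g x * h x) \<in> R" if g: "g \<in> R" and h: "h \<in> R" for g h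
    proof -
      obtain L where L: "L \<ge> 0" "\<forall>x\<in>S. \<forall>y\<in>S. \<bar>g x - g y\<bar> \<le> L * d x y" using g by (auto simp: R_def)
      obtain M where M: "M \<ge> 0" "\<forall>x\<in>S. \<forall>y\<in>S. \<bar>h x - h y\<bar> \<le> M * d x y" using h by (auto simp: R_def)
      have "bounded (g ` S)" "bounded (h ` S)"
        using g h S(1) by (auto simp: R_def intro!: compact_imp_bounded compact_continuous_image)
      then obtain A B where A: "A > 0" "\<forall>y\<in>g ` S. norm y \<le> A" and B: "B > 0" "\<forall>y\<in>h ` S. norm y \<le> B"
        by (meson bounded_pos)
      have "\<bar>g x * h x - g y * h y\<bar> \<le> (A * M + B * L) * d x y" if xy: "x \<in> S" "y \<in> S" for x y
      proof -
        have "\<bar>g x - g y\<bar> \<le> L * d x y" "\<bar>h x - h y\<bar> \<le> M * d x y" "\<bar>g x\<bar> \<le> A" "\<bar>h y\<bar> \<le> B"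
          using L(2) M(2) A(2) B(2) xy by auto
        then have "\<bar>g x\<bar> * \<bar>h x - h y\<bar> \<le> A * (M * d x y)" "\<bar>h y\<bar> * \<bar>g x - g y\<bar> \<le> B * (L * d x y)"
          using A(1) B(1) by (auto intro!: mult_mono)
        moreover have "g x * h x - g y * h y = g x * (h x - h y) + h y * (g x - g y)"
          by (simp add: algebra_simps)
        ultimately show ?thesis
          by (simp add: abs_mult[symmetric] distrib_right mult.assoc)
      qed
      moreover have "continuous_on S (\<lambda>x. g x * h x)"
        using g h by (auto simp: R_def intro: continuous_on_mult)
      moreover have "A * M + B * L \<ge> 0" using A(1) B(1) L(1) M(1) by simp
      ultimately show ?thesis
        by (auto simp: R_def intro!: exI[of _ "A * M + B * L"])
    qed
    show "(\<lambda>_. c) \<in> R" for c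
      using d0 by (auto simp: R_def intro!: exI[of _ 0])
    show "\<exists>g\<in>R. g x \<noteq> g y" if xy: "x \<in> S" "y \<in> S" "x \<noteq> y" for x y
    proof -
      obtain j where j: "x j \<noteq> y j" using xy(3) by (auto simp: fun_eq_iff)
      then have jm: "j < m" using S(2)[OF xy(1), of j] S(2)[OF xy(2), of j] by (cases "j < m") auto
      have "\<bar>u j - v j\<bar> \<le> 1 * d u v" for u v
        unfolding d_def mult_1 using jm by (intro member_le_sum[where f = "\<lambda>j. \<bar>u j - v j\<bar>"]) auto
      moreover have "continuous_on S (\<lambda>u. u j)"
        by (rule continuous_on_subset[OF continuous_on_product_coordinates subset_UNIV])
      ultimately have "(\<lambda>u. u j) \<in> R"
        unfolding R_def mem_Collect_eq by (intro conjI exI[of _ 1]) simp_all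
      with j show ?thesis by (rule bexI[where P = "\<lambda>g. g x \<noteq> g y"])
    qed
  qed
  obtain g where g: "g \<in> R" "\<forall>x\<in>S. \<bar>f x - g x\<bar> < e"
    using Stone_Weierstrass_basic[OF f e] by blast
  obtain L where "L \<ge> 0" "\<forall>x\<in>S. \<forall>y\<in>S. \<bar>g x - g y\<bar> \<le> L * d x y"
    using g(1) by (auto simp: R_def)
  then show thesis
    using that[of g L] g(2) by (simp add: d_def)
qed

text \<open>The boundary of the \<open>m\<close>-cube is covered by \<open>O(N^(m-1))\<close> cells of side \<open>1/N\<close>, while the sphere
  contains order of \<open>M^n\<close> points \<open>1/M\<close> apart; a Lipschitz map with \<open>m \<le> n\<close> cannot hit them all.\<close>

lemma lipschitz_misses_point:
  assumes m: "1 \<le> m" "m \<le> n" and L: "L \<ge> 0"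
    and lip: "\<And>x y i. x \<in> cube_boundary m \<Longrightarrow> y \<in> cube_boundary m \<Longrightarrow> i \<le> n \<Longrightarrow>
                \<bar>G x i - G y i\<bar> \<le> L * (\<Sum>j<m. \<bar>x j - y j\<bar>)"
    and le2: "\<And>x i. x \<in> cube_boundary m \<Longrightarrow> i \<le> n \<Longrightarrow> \<bar>G x i\<bar> \<le> 2"
    and big: "\<And>x. x \<in> cube_boundary m \<Longrightarrow> dot n (G x) (G x) \<ge> 1/4"
  shows "\<exists>c\<in>topspace (nsphere n). \<forall>x\<in>cube_boundary m. normalise n (G x) \<noteq> c"
proof (rule ccontr)
  assume "\<not> ?thesis"
  then have all: "\<exists>x\<in>cube_boundary m. normalise n (G x) = c" if "c \<in> topspace (nsphere n)" for c
    using that by simp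
  \<comment> \<open>The factor 64 is 16 times 4: below, 1/16 bounds the product of two last
    coordinates from below, and \<open>4 * \<delta>\<close> bounds the numerator.\<close>
  obtain K :: nat where K: "64 * L * m * n + 1 < real K" using reals_Archimedean2 by blast
  have "0 \<le> 64 * L * m * n" using L by simp
  then have K1: "K \<ge> 1" using K by (cases K) auto
  \<comment> \<open>Just large enough that the at most
    \<open>(2 * m * (2 * K) ^ (m - 1)) * M ^ (m - 1)\<close> cells are fewer than
    \<open>M ^ m\<close>. As \<open>K\<close> depends on the Lipschitz constant alone, the mesh 1 /
    (\<open>K * M\<close>) can be tied to \<open>M\<close> without circularity.\<close>
  define M where "M = 2 * m * (2 * K) ^ (m - 1) + 1"
  define N where "N = K * M"
  have M1: "M \<ge> 1" and N1: "N \<ge> 1" using K1 by (auto simp: M_def N_def)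
  \<comment> \<open>Grid points in the hyperplane where the last coordinate is 1; projected radially
    they are the test points on the sphere. Dividing by \<open>n\<close> keeps the squared length at
    most 2.\<close>
  define y where "y \<equiv> \<lambda>a i. if i < n then real (a i) / (real M * real n) else if i = n then 1 else (0::real)"
  define A where "A = PiE {..<n} (\<lambda>_. {..<M})"
  \<comment> \<open>A cell is named by a facet, given by the fixed coordinate and which of its two
    values it takes, and by the integer parts of \<open>N\<close> times the other
    \<open>m - 1\<close> coordinates.\<close>
  define C where "C = Sigma ({..<m} \<times> (UNIV :: bool set)) (\<lambda>(j, b). PiE ({..<m} - {j}) (\<lambda>_. {..N}))"
  have cardA: "card A = M ^ n" by (simp add: A_def card_PiE)
  have cardC: "card C = 2 * m * (N + 1) ^ (m - 1)"
  proof -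
    have "card (PiE ({..<m} - {j}) (\<lambda>_. {..N})) = (N + 1) ^ (m - 1)" if "j < m" for j
      using that by (simp add: card_PiE card_Diff_singleton)
    then have "(\<Sum>p\<in>{..<m} \<times> (UNIV :: bool set). card (case p of (j, b) \<Rightarrow> PiE ({..<m} - {j}) (\<lambda>_. {..N})))
        = (\<Sum>p\<in>{..<m} \<times> (UNIV :: bool set). (N + 1) ^ (m - 1))"
      by (intro sum.cong refl) (clarsimp simp del: card_PiE)
    then have "card C = (\<Sum>p\<in>{..<m} \<times> (UNIV :: bool set). (N + 1) ^ (m - 1))"
      unfolding C_def by (subst card_SigmaI) (simp_all add: finite_PiE split: prod.split)
    then show ?thesis by (simp add: card_cartesian_product)
  qed
  have less: "card C < card A"
  proof -
    have "N + 1 \<le> 2 * K * M" using N1 by (simp add: N_def)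
    then have "(N + 1) ^ (m - 1) \<le> (2 * K * M) ^ (m - 1)" by (rule power_mono) simp
    then have "card C \<le> 2 * m * (2 * K * M) ^ (m - 1)" unfolding cardC by simp
    also have "\<dots> = (2 * m * (2 * K) ^ (m - 1)) * M ^ (m - 1)" by (simp add: power_mult_distrib)
    also have "\<dots> < M * M ^ (m - 1)" using M1 by (intro mult_strict_right_mono) (auto simp: M_def)
    also have "\<dots> = M ^ m" using m(1) by (simp add: power_eq_if)
    also have "\<dots> \<le> M ^ n" using m(2) M1 by (intro power_increasing) auto
    finally show ?thesis by (simp add: cardA)
  qed
  have n1: "n \<ge> 1" using m by simp
  have yy: "1 \<le> dot n (y a) (y a) \<and> dot n (y a) (y a) \<le> 2" if a: "a \<in> A" for a
  proof -
    have e: "dot n (y a) (y a) = (\<Sum>i<n. (y a i)\<^sup>2) + 1"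
    proof -
      have "{..n} = insert n {..<n}" by auto
      then show ?thesis by (simp add: dot_def y_def power2_eq_square)
    qed
    have "(y a i)\<^sup>2 \<le> 1 / real n" if i: "i < n" for i
    proof -
      have "a i < M" using a i by (auto simp: A_def PiE_iff)
      then have "real (a i) / (real M * real n) \<le> 1 / real n"
        using n1 M1 by (simp add: divide_simps)
      then have y1: "y a i \<le> 1 / real n" "0 \<le> y a i" using i by (auto simp: y_def)
      have "(1::real) / real n \<le> 1" using n1 by simp
      then have "y a i * y a i \<le> 1 / real n * 1" using y1 by (intro mult_mono) auto
      then show ?thesis by (simp add: power2_eq_square)
    qed
    then have "(\<Sum>i<n. (y a i)\<^sup>2) \<le> (\<Sum>i<n. 1 / real n)" by (intro sum_mono) auto
    then have "(\<Sum>i<n. (y a i)\<^sup>2) \<le> 1" using n1 by simp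
    moreover have "0 \<le> (\<Sum>i<n. (y a i)\<^sup>2)" by (simp add: sum_nonneg)
    ultimately show ?thesis using e by simp
  qed
  \<comment> \<open>\<open>G x\<close> is a positive multiple of \<open>y a\<close>. Its length is
    at least 1/2 and that of \<open>y a\<close> at most 2, so the multiple, which is
    \<open>G x n\<close>, is at least 1/4.\<close>
  have "\<exists>x\<in>cube_boundary m. G x n \<ge> 1/4 \<and> (\<forall>i<n. G x i = G x n * y a i)" if a: "a \<in> A" for a
  proof -
    have "normalise n (y a) \<in> topspace (nsphere n)"
      using yy[OF a] by (intro normalise_in_nsphere) (auto simp: y_def)
    then obtain x where x: "x \<in> cube_boundary m" "normalise n (G x) = normalise n (y a)" using all by blast
    let ?g = "sqrt (dot n (G x) (G x))" and ?y = "sqrt (dot n (y a) (y a))"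
    have g: "?g \<ge> 1/2"
      using real_sqrt_le_mono[OF big[OF x(1)]] by (simp add: real_sqrt_divide)
    have y: "1 \<le> ?y" "?y \<le> 2"
      using yy[OF a] real_sqrt_le_mono[of "dot n (y a) (y a)" 4] by auto
    have s: "G x i = ?g / ?y * y a i" for i
    proof -
      have "G x i / ?g = y a i / ?y" using x(2) unfolding normalise_def fun_eq_iff by blast
      moreover have g0: "?g \<noteq> 0" using g by auto
      ultimately have "G x i = y a i / ?y * ?g" by (simp only: nonzero_divide_eq_eq[OF g0])
      then show ?thesis by simp
    qed
    have "G x n = ?g / ?y" using s[of n] by (simp add: y_def)
    moreover have "?g / ?y \<ge> 1/4"
    proof -
      have "1/4 * ?y \<le> ?g" using g y by linarith
      then show ?thesis using y by (simp add: pos_le_divide_eq)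
    qed
    ultimately show ?thesis using s x(1) by metis
  qed
  then obtain X where X: "\<And>a. a \<in> A \<Longrightarrow> X a \<in> cube_boundary m" "\<And>a. a \<in> A \<Longrightarrow> G (X a) n \<ge> 1/4"
      "\<And>a i. a \<in> A \<Longrightarrow> i < n \<Longrightarrow> G (X a) i = G (X a) n * y a i"
    by metis
  define J where "J \<equiv> \<lambda>x :: nat \<Rightarrow> real. SOME j. j < m \<and> (x j = 0 \<or> x j = 1)"
  have J: "J x < m \<and> (x (J x) = 0 \<or> x (J x) = 1)" if "x \<in> cube_boundary m" for x
  proof -
    have "\<exists>j. j < m \<and> (x j = 0 \<or> x j = 1)" using that by (auto simp: cube_boundary_def)
    then show ?thesis unfolding J_def by (rule someI_ex)
  qed
  define \<kappa> where "\<kappa> \<equiv> \<lambda>x :: nat \<Rightarrow> real. ((J x, x (J x) = 1), restrict (\<lambda>i. nat \<lfloor>real N * x i\<rfloor>) ({..<m} - {J x}))"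
  have x01: "0 \<le> x i \<and> x i \<le> 1" if "x \<in> cube_boundary m" "i < m" for x i
    using that by (auto simp: cube_boundary_def topspace_cube)
  have "\<kappa> (X a) \<in> C" if a: "a \<in> A" for a
  proof -
    have "nat \<lfloor>real N * X a i\<rfloor> \<le> N" if "i < m" for i
    proof -
      have "real N * X a i \<le> real N" using x01[OF X(1)[OF a] that] by (simp add: mult_left_le)
      then show ?thesis by linarith
    qed
    then show ?thesis using J[OF X(1)[OF a]] by (auto simp: \<kappa>_def C_def)
  qed
  then have "(\<lambda>a. \<kappa> (X a)) ` A \<subseteq> C" by blast
  moreover have "finite C" unfolding C_def by (auto intro!: finite_PiE)
  \<comment> \<open>Pigeonhole: two test points have preimages in one cell. By the Lipschitz bound
    their images are too close for distinct grid points.\<close>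
  ultimately have "\<not> inj_on (\<lambda>a. \<kappa> (X a)) A"
    using less card_inj_on_le by (metis leD)
  then obtain a a' where aa: "a \<in> A" "a' \<in> A" "a \<noteq> a'" and eq: "\<kappa> (X a) = \<kappa> (X a')"
    by (auto simp: inj_on_def)
  let ?x = "X a" and ?x' = "X a'"
  have near: "\<bar>?x i - ?x' i\<bar> \<le> 1 / real N" if i: "i < m" for i
  proof (cases "i = J ?x")
    case True
    have "J ?x = J ?x'" "(?x (J ?x) = 1) = (?x' (J ?x') = 1)" using eq by (auto simp: \<kappa>_def)
    then show ?thesis using True J[OF X(1)[OF aa(1)]] J[OF X(1)[OF aa(2)]] by auto
  next
    case False
    have e: "J ?x = J ?x'"
        "restrict (\<lambda>i. nat \<lfloor>real N * ?x i\<rfloor>) ({..<m} - {J ?x}) = restrict (\<lambda>i. nat \<lfloor>real N * ?x' i\<rfloor>) ({..<m} - {J ?x'})"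
      using eq by (auto simp: \<kappa>_def)
    from fun_cong[OF e(2), of i] have "nat \<lfloor>real N * ?x i\<rfloor> = nat \<lfloor>real N * ?x' i\<rfloor>"
      using False i e(1) by simp
    moreover have "0 \<le> real N * ?x i" "0 \<le> real N * ?x' i" using x01[OF X(1)[OF aa(1)] i] x01[OF X(1)[OF aa(2)] i] by auto
    ultimately have "\<bar>real N * ?x i - real N * ?x' i\<bar> \<le> 1" by linarith
    then have "real N * \<bar>?x i - ?x' i\<bar> \<le> 1"
      by (metis abs_mult abs_of_nat right_diff_distrib)
    then show ?thesis using N1 by (simp add: field_simps)
  qed
  define \<delta> where "\<delta> = L * (real m / real N)"
  have Gd: "\<bar>G ?x i - G ?x' i\<bar> \<le> \<delta>" if "i \<le> n" for i
  proof -
    have "(\<Sum>j<m. \<bar>?x j - ?x' j\<bar>) \<le> (\<Sum>j<m. 1 / real N)" using near by (intro sum_mono) auto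
    then have "L * (\<Sum>j<m. \<bar>?x j - ?x' j\<bar>) \<le> \<delta>" unfolding \<delta>_def using L by (intro mult_left_mono) auto
    then show ?thesis using lip[OF X(1)[OF aa(1)] X(1)[OF aa(2)] that] by linarith
  qed
  have \<delta>0: "\<delta> \<ge> 0" using L by (simp add: \<delta>_def)
  obtain i where i: "i < n" "a i \<noteq> a' i"
    using aa unfolding A_def by (metis PiE_ext lessThan_iff)
  let ?s = "G ?x n" and ?s' = "G ?x' n"
  have s: "?s \<ge> 1/4" "?s' \<ge> 1/4" "?s' \<le> 2" using X(2) aa le2[OF X(1)[OF aa(2)], of n] by (auto simp: abs_le_iff)
  have "\<bar>y a i - y a' i\<bar> \<le> 64 * \<delta>"
  proof -
    \<comment> \<open>Slopes are compared after multiplication by both last coordinates, which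
      leaves only differences of values of \<open>G\<close>.\<close>
    have e: "?s * ?s' * (y a i - y a' i) = (G ?x i - G ?x' i) * ?s' + G ?x' i * (?s' - ?s)"
      unfolding X(3)[OF aa(1) i(1)] X(3)[OF aa(2) i(1)] by (simp add: algebra_simps)
    have "\<bar>?s * ?s' * (y a i - y a' i)\<bar> \<le> \<bar>G ?x i - G ?x' i\<bar> * \<bar>?s'\<bar> + \<bar>G ?x' i\<bar> * \<bar>?s' - ?s\<bar>"
      unfolding e by (rule order_trans[OF abs_triangle_ineq]) (simp add: abs_mult)
    also have "\<dots> \<le> \<delta> * 2 + 2 * \<delta>"
    proof (intro add_mono mult_mono)
      show "\<bar>G ?x i - G ?x' i\<bar> \<le> \<delta>" "\<bar>G ?x' i\<bar> \<le> 2"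
        using Gd[of i] le2[OF X(1)[OF aa(2)], of i] i(1) by simp_all
      show "\<bar>?s'\<bar> \<le> 2" using le2[OF X(1)[OF aa(2)], of n] by simp
      show "\<bar>?s' - ?s\<bar> \<le> \<delta>" using Gd[of n] by (simp add: abs_minus_commute)
    qed (use \<delta>0 in simp_all)
    finally have 1: "\<bar>?s * ?s'\<bar> * \<bar>y a i - y a' i\<bar> \<le> 4 * \<delta>" by (simp add: abs_mult)
    have "1/4 * (1/4) \<le> ?s * ?s'" using s by (intro mult_mono) auto
    then have "1/16 * \<bar>y a i - y a' i\<bar> \<le> \<bar>?s * ?s'\<bar> * \<bar>y a i - y a' i\<bar>"
      by (intro mult_right_mono) auto
    from order_trans[OF this 1] show ?thesis by simp
  qed
  moreover have "\<bar>y a i - y a' i\<bar> \<ge> 1 / (real M * real n)"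
  proof -
    have "\<bar>real (a i) - real (a' i)\<bar> \<ge> 1" using i(2) by linarith
    moreover have "y a i - y a' i = (real (a i) - real (a' i)) / (real M * real n)"
      using i(1) by (simp add: y_def diff_divide_distrib)
    ultimately show ?thesis by (simp add: abs_mult divide_right_mono)
  qed
  moreover have "64 * \<delta> < 1 / (real M * real n)"
  proof -
    have "64 * L * m * n < real K" using K by linarith
    then have "64 * L * m * n * real M < real K * real M" using M1 by (intro mult_strict_right_mono) auto
    then have "64 * (L * real m) * (real M * real n) < real N" by (simp add: N_def mult_ac)
    then have "64 * (L * real m) / real N < 1 / (real M * real n)"
      using N1 M1 n1 by (simp add: divide_simps)
    then show ?thesis by (simp add: \<delta>_def)
  qed
  ultimately show False by linarith
qed

section \<open>Null homotopies on the boundary of a cube\<close>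

abbreviation bcube :: "nat \<Rightarrow> (nat \<Rightarrow> real) topology" where
  "bcube m \<equiv> subtopology (cube m) (cube_boundary m)"

lemma topspace_bcube [simp]: "topspace (bcube m) = cube_boundary m"
  using cube_boundary_subset by auto

lemma continuous_map_into_unit_interval:
  "continuous_map X unit_interval f \<longleftrightarrow>
     continuous_map X euclideanreal f \<and> (\<forall>x\<in>topspace X. 0 \<le> f x \<and> f x \<le> 1)"
  by (auto simp: continuous_map_in_subtopology)

lemma cube_eq_top_of_set: "cube m = top_of_set (topspace (cube m))"
proof -
  have "cube m = subtopology (powertop_real UNIV) (topspace (cube m))"
    unfolding topspace_cube unfolding cube_def Euclidean_space_def subtopology_subtopology
    by (rule arg_cong[where f = "subtopology (powertop_real UNIV)"]) auto
  then show ?thesis by (simp add: euclidean_product_topology)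
qed

lemma bcube_eq_top_of_set: "bcube m = top_of_set (cube_boundary m)"
  by (subst cube_eq_top_of_set) (simp add: subtopology_subtopology Int_absorb1 cube_boundary_subset)

lemma compact_cube_boundary: "compact (cube_boundary m)"
proof -
  have "closedin (cube m) {s \<in> topspace (cube m). s j \<in> {0, 1}}" for j
    by (rule closedin_continuous_map_preimage[OF continuous_map_cube_projection]) (auto simp: closed_insert)
  then have "closedin (cube m) (\<Union>j\<in>{..<m}. {s \<in> topspace (cube m). s j \<in> {0, 1}})"
    by (intro closedin_Union) auto
  moreover have "(\<Union>j\<in>{..<m}. {s \<in> topspace (cube m). s j \<in> {0, 1}}) = cube_boundary m"
    by (auto simp: cube_boundary_def)
  ultimately have "closedin (cube m) (cube_boundary m)" by simp
  then have "compactin (cube m) (cube_boundary m)"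
    by (simp add: closedin_compact_space compact_space_cube)
  then show ?thesis
    by (metis compactin_subtopology compactin_euclidean_iff cube_eq_top_of_set)
qed

text \<open>Approximate \<open>\<phi>\<close> coordinatewise by a Lipschitz map \<open>G\<close>.
  After normalisation \<open>G\<close> is nowhere antipodal to \<open>\<phi>\<close>, hence
  homotopic to it, and it misses some point, hence is homotopic to the constant map at the antipode
  of that point.\<close>

lemma bcube_map_null_homotopic:
  assumes m: "1 \<le> m" "m \<le> n" and \<phi>: "continuous_map (bcube m) (nsphere n) \<phi>"
  obtains h c where "c \<in> topspace (nsphere n)" "continuous_map (prod_topology unit_interval (bcube m)) (nsphere n) h"
    "\<And>s. s \<in> cube_boundary m \<Longrightarrow> h (0, s) = c" "\<And>s. s \<in> cube_boundary m \<Longrightarrow> h (1, s) = \<phi> s"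
proof -
  \<comment> \<open>The \<open>n + 1\<close> coordinate errors add up to at most 1/2, which keeps
    the inner product of \<open>\<phi> x\<close> and \<open>G x\<close> at least 1/2.\<close>
  define e where "e = 1 / (2 * (real n + 1))"
  have e0: "e > 0" and e1: "e \<le> 1" by (simp_all add: e_def)
  have \<phi>c: "continuous_on (cube_boundary m) (\<lambda>x. \<phi> x i)" for i
    using continuous_map_nsphere_component[OF \<phi>, of i] unfolding bcube_eq_top_of_set by simp
  have \<phi>S: "\<phi> x \<in> topspace (nsphere n)" if "x \<in> cube_boundary m" for x
    by (rule continuous_map_nsphere_in[OF \<phi>]) (use that cube_boundary_subset in auto)
  have \<phi>1: "\<bar>\<phi> x i\<bar> \<le> 1" if x: "x \<in> cube_boundary m" and i: "i \<le> n" for x i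
  proof -
    have "(\<phi> x i)\<^sup>2 \<le> (\<Sum>i\<le>n. (\<phi> x i)\<^sup>2)" using i by (intro member_le_sum) auto
    then have "(\<phi> x i)\<^sup>2 \<le> 1" using \<phi>S[OF x] by (simp add: topspace_nsphere dot_def power2_eq_square)
    then show ?thesis by (simp add: abs_square_le_1)
  qed
  have "\<forall>i. \<exists>g L. L \<ge> 0 \<and> (\<forall>x\<in>cube_boundary m. \<bar>\<phi> x i - g x\<bar> < e) \<and>
      (\<forall>x\<in>cube_boundary m. \<forall>y\<in>cube_boundary m. \<bar>g x - g y\<bar> \<le> L * (\<Sum>j<m. \<bar>x j - y j\<bar>))"
  proof
    fix i
    have z: "x j = 0" if "x \<in> cube_boundary m" "m \<le> j" for x j
      using that by (auto simp: cube_boundary_def topspace_cube)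
    obtain g L where "\<And>x. x \<in> cube_boundary m \<Longrightarrow> \<bar>\<phi> x i - g x\<bar> < e" "L \<ge> 0"
      "\<And>x y. x \<in> cube_boundary m \<Longrightarrow> y \<in> cube_boundary m \<Longrightarrow> \<bar>g x - g y\<bar> \<le> L * (\<Sum>j<m. \<bar>x j - y j\<bar>)"
    proof (rule lipschitz_approximation[where S = "cube_boundary m" and f = "\<lambda>x. \<phi> x i" and m = m and e = e])
      show "compact (cube_boundary m)" by (rule compact_cube_boundary)
      show "continuous_on (cube_boundary m) (\<lambda>x. \<phi> x i)" by (rule \<phi>c)
    qed (use z e0 in auto)
    then show "\<exists>g L. L \<ge> 0 \<and> (\<forall>x\<in>cube_boundary m. \<bar>\<phi> x i - g x\<bar> < e) \<and>
      (\<forall>x\<in>cube_boundary m. \<forall>y\<in>cube_boundary m. \<bar>g x - g y\<bar> \<le> L * (\<Sum>j<m. \<bar>x j - y j\<bar>))" by blast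
  qed
  then obtain g L where L0: "\<And>i. L i \<ge> 0"
      and ga: "\<And>i x. x \<in> cube_boundary m \<Longrightarrow> \<bar>\<phi> x i - g i x\<bar> < e"
      and gl: "\<And>i x y. x \<in> cube_boundary m \<Longrightarrow> y \<in> cube_boundary m \<Longrightarrow> \<bar>g i x - g i y\<bar> \<le> L i * (\<Sum>j<m. \<bar>x j - y j\<bar>)"
    by metis
  define G where "G \<equiv> \<lambda>x i. if i \<le> n then g i x else 0"
  define L' where "L' = (\<Sum>i\<le>n. L i)"
  have L'0: "L' \<ge> 0" using L0 by (simp add: L'_def sum_nonneg)
  have lip: "\<bar>G x i - G y i\<bar> \<le> L' * (\<Sum>j<m. \<bar>x j - y j\<bar>)"
    if "x \<in> cube_boundary m" "y \<in> cube_boundary m" "i \<le> n" for x y i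
  proof -
    have "L i \<le> L'" unfolding L'_def using that(3) L0 by (intro member_le_sum) auto
    then have "L i * (\<Sum>j<m. \<bar>x j - y j\<bar>) \<le> L' * (\<Sum>j<m. \<bar>x j - y j\<bar>)" by (intro mult_right_mono) (auto simp: sum_nonneg)
    then show ?thesis using gl[OF that(1,2), of i] that(3) by (simp add: G_def)
  qed
  have le2: "\<bar>G x i\<bar> \<le> 2" if "x \<in> cube_boundary m" "i \<le> n" for x i
    using ga[OF that(1), of i] \<phi>1[OF that] e1 that(2) by (simp add: G_def)
  have dg: "dot n (\<phi> x) (G x) \<ge> 1/2" if x: "x \<in> cube_boundary m" for x
  proof -
    have "dot n (\<phi> x) (\<phi> x) - dot n (\<phi> x) (G x) = (\<Sum>i\<le>n. \<phi> x i * (\<phi> x i - G x i))"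
      by (simp add: dot_def sum_subtractf algebra_simps)
    also have "\<dots> \<le> (\<Sum>i\<le>n. 1 * e)"
    proof (rule sum_mono)
      fix i assume i: "i \<in> {..n}"
      have "\<phi> x i * (\<phi> x i - G x i) \<le> \<bar>\<phi> x i\<bar> * \<bar>\<phi> x i - G x i\<bar>" by (metis abs_ge_self abs_mult)
      also have "\<dots> \<le> 1 * e" using \<phi>1[OF x, of i] ga[OF x, of i] i by (intro mult_mono) (auto simp: G_def)
      finally show "\<phi> x i * (\<phi> x i - G x i) \<le> 1 * e" .
    qed
    also have "\<dots> = 1/2" by (simp add: e_def divide_simps)
    finally show ?thesis using \<phi>S[OF x] by (simp add: topspace_nsphere)
  qed
  have big: "dot n (G x) (G x) \<ge> 1/4" if x: "x \<in> cube_boundary m" for x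
  proof -
    \<comment> \<open>The squared length of \<open>2 * G x - \<phi> x\<close> is nonnegative; with
      the inner product at least 1/2 this bounds the squared length of \<open>G x\<close> below by
      1/4.\<close>
    let ?v = "\<lambda>i. 2 * G x i + (-1) * \<phi> x i"
    have "dot n ?v ?v = 4 * dot n (G x) (G x) - 4 * dot n (\<phi> x) (G x) + 1"
      unfolding dot_linear
      apply (subst (1 2) dot_commute, unfold dot_linear)
      using \<phi>S[OF x] dot_commute[of n "\<phi> x" "G x"] by (simp add: topspace_nsphere)
    then show ?thesis using dg[OF x] dot_nonneg[of n ?v] by linarith
  qed
  have "\<exists>c\<in>topspace (nsphere n). \<forall>x\<in>cube_boundary m. normalise n (G x) \<noteq> c"
    by (rule lipschitz_misses_point[OF m L'0]) (fact lip le2 big)+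
  then obtain c where c: "c \<in> topspace (nsphere n)" "\<forall>x\<in>cube_boundary m. normalise n (G x) \<noteq> c"
    by (rule bexE)
  have Gc: "continuous_map (bcube m) euclideanreal (\<lambda>x. G x k)" for k
  proof (cases "k \<le> n")
    case True
    have "continuous_on (cube_boundary m) (g k)"
      unfolding continuous_on_def
    proof
      fix x assume x: "x \<in> cube_boundary m"
      have "((\<lambda>y. L k * (\<Sum>j<m. \<bar>y j - x j\<bar>)) \<longlongrightarrow> L k * (\<Sum>j<m. \<bar>x j - x j\<bar>)) (at x within cube_boundary m)"
      proof (intro tendsto_mult tendsto_sum tendsto_const tendsto_rabs tendsto_diff)
        show "((\<lambda>y. y j) \<longlongrightarrow> x j) (at x within cube_boundary m)" for j
          by (rule bspec[OF continuous_on_subset[OF continuous_on_product_coordinates subset_UNIV, unfolded continuous_on_def] x])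
      qed
      then have "((\<lambda>y. L k * (\<Sum>j<m. \<bar>y j - x j\<bar>)) \<longlongrightarrow> 0) (at x within cube_boundary m)" by simp
      then have "((\<lambda>y. g k y - g k x) \<longlongrightarrow> 0) (at x within cube_boundary m)"
        by (rule Lim_null_comparison[rotated]) (use gl x in \<open>auto simp: eventually_at_filter\<close>)
      then show "(g k \<longlongrightarrow> g k x) (at x within cube_boundary m)"
        by (simp add: LIM_zero_iff)
    qed
    then show ?thesis unfolding bcube_eq_top_of_set by (simp add: G_def True)
  qed (simp add: G_def)
  have \<psi>: "continuous_map (bcube m) (nsphere n) (\<lambda>x. normalise n (G x))"
    by (rule continuous_map_normalise[OF Gc]) (use big in \<open>force simp: G_def\<close>)+
  have 1: "\<phi> x \<noteq> antipode (normalise n (G x))" if "x \<in> topspace (bcube m)" for x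
  proof
    assume *: "\<phi> x = antipode (normalise n (G x))"
    have x: "x \<in> cube_boundary m" using that by simp
    have "dot n (\<phi> x) (G x) = - (dot n (G x) (G x) / sqrt (dot n (G x) (G x)))"
      unfolding * by (simp add: dot_def normalise_def sum_negf flip: sum_divide_distrib)
    moreover have "dot n (G x) (G x) / sqrt (dot n (G x) (G x)) \<ge> 0" by (simp add: dot_nonneg)
    ultimately show False using dg[OF x] by linarith
  qed
  have 2: "normalise n (G x) \<noteq> antipode (antipode c)" if "x \<in> topspace (bcube m)" for x
    using c(2) that by simp
  have ac: "antipode c \<in> topspace (nsphere n)" using c(1) by simp
  obtain h1 where h1: "continuous_map (prod_topology unit_interval (bcube m)) (nsphere n) h1"
    "\<And>x. x \<in> topspace (bcube m) \<Longrightarrow> h1 (0, x) = \<phi> x" "\<And>x. x \<in> topspace (bcube m) \<Longrightarrow> h1 (1, x) = normalise n (G x)"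
    using homotopic_non_antipodal[OF \<phi> \<psi> 1] by metis
  have cc: "continuous_map (bcube m) (nsphere n) (\<lambda>x. antipode c)" using ac by simp
  obtain h2 where h2: "continuous_map (prod_topology unit_interval (bcube m)) (nsphere n) h2"
    "\<And>x. x \<in> topspace (bcube m) \<Longrightarrow> h2 (0, x) = normalise n (G x)" "\<And>x. x \<in> topspace (bcube m) \<Longrightarrow> h2 (1, x) = antipode c"
    using homotopic_non_antipodal[OF \<psi> cc 2] by metis
  have "homotopic_with (\<lambda>x. True) (bcube m) (nsphere n) \<phi> (\<lambda>x. normalise n (G x))"
    using h1 by (subst homotopic_with) auto
  moreover have "homotopic_with (\<lambda>x. True) (bcube m) (nsphere n) (\<lambda>x. normalise n (G x)) (\<lambda>x. antipode c)"
    using h2 by (subst homotopic_with) auto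
  ultimately have "homotopic_with (\<lambda>x. True) (bcube m) (nsphere n) (\<lambda>x. antipode c) \<phi>"
    by (meson homotopic_with_trans homotopic_with_symD)
  then obtain h where "continuous_map (prod_topology unit_interval (bcube m)) (nsphere n) h"
     "\<forall>x. h (0, x) = antipode c" "\<forall>x. h (1, x) = \<phi> x"
    unfolding homotopic_with_def by blast
  then show thesis using that[OF ac] by blast
qed

subsection \<open>Radial coordinates on the cube\<close>

text \<open>Twice the distance from the centre of the cube in the sup norm, scaled so that the
  boundary is the level set 1. The recursion gives the empty maximum the value 0.\<close>

fun radius :: "nat \<Rightarrow> (nat \<Rightarrow> real) \<Rightarrow> real" where
  "radius 0 s = 0"
| "radius (Suc m) s = max (radius m s) \<bar>2 * s m - 1\<bar>"

text \<open>The homothety about the centre of the cube; with factor 1 / \<open>radius m s\<close> it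
  is the radial projection to the boundary.\<close>

definition stretch :: "nat \<Rightarrow> real \<Rightarrow> (nat \<Rightarrow> real) \<Rightarrow> nat \<Rightarrow> real" where
  "stretch m c s = (\<lambda>j. if j < m then 1/2 + c * (s j - 1/2) else 0)"

lemma radius_nonneg: "radius m s \<ge> 0"
  by (induction m) auto

lemma radius_le_iff: "r \<ge> 0 \<Longrightarrow> radius m s \<le> r \<longleftrightarrow> (\<forall>j<m. \<bar>2 * s j - 1\<bar> \<le> r)"
  by (induction m) (auto simp: less_Suc_eq)

lemma radius_attained: "m \<ge> 1 \<Longrightarrow> \<exists>j<m. radius m s = \<bar>2 * s j - 1\<bar>"
proof (induction m)
  case (Suc m)
  show ?case
  proof (cases "m = 0")
    case False
    then obtain j where "j < m" "radius m s = \<bar>2 * s j - 1\<bar>" using Suc by auto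
    then show ?thesis by (cases "radius m s \<le> \<bar>2 * s m - 1\<bar>") (auto simp: max_def intro: less_SucI)
  qed (auto intro!: exI[of _ 0])
qed simp

lemma radius_cong: "(\<And>j. j < m \<Longrightarrow> s j = t j) \<Longrightarrow> radius m s = radius m t"
  by (induction m) auto

lemma radius_stretch: "c \<ge> 0 \<Longrightarrow> radius m (stretch m' c s) = c * radius m s" if "m \<le> m'"
  using that
proof (induction m)
  case (Suc m)
  have "2 * stretch m' c s m - 1 = c * (2 * s m - 1)"
    using Suc.prems by (simp add: stretch_def algebra_simps)
  then show ?case using Suc by (simp add: abs_mult max_mult_distrib_left)
qed simp

lemma in_cube_iff_radius:
  "s \<in> topspace (cube m) \<longleftrightarrow> radius m s \<le> 1 \<and> (\<forall>j\<ge>m. s j = 0)"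
proof -
  have "\<bar>2 * s j - 1\<bar> \<le> 1 \<longleftrightarrow> 0 \<le> s j \<and> s j \<le> 1" for j by linarith
  then show ?thesis by (auto simp: topspace_cube radius_le_iff)
qed

lemma in_cube_boundary_iff_radius:
  assumes "m \<ge> 1"
  shows "s \<in> cube_boundary m \<longleftrightarrow> radius m s = 1 \<and> (\<forall>j\<ge>m. s j = 0)"
proof
  assume s: "s \<in> cube_boundary m"
  then obtain j where j: "j < m" "s j = 0 \<or> s j = 1" and sc: "s \<in> topspace (cube m)"
    by (auto simp: cube_boundary_def)
  have "\<bar>2 * s j - 1\<bar> \<le> radius m s" using j(1) radius_le_iff[OF radius_nonneg, of m s m s] by simp
  then have "radius m s \<ge> 1" using j(2) by auto
  then show "radius m s = 1 \<and> (\<forall>j\<ge>m. s j = 0)" using sc by (auto simp: in_cube_iff_radius)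
next
  assume s: "radius m s = 1 \<and> (\<forall>j\<ge>m. s j = 0)"
  obtain j where j: "j < m" "radius m s = \<bar>2 * s j - 1\<bar>" using radius_attained[OF assms] by blast
  then have "s j = 0 \<or> s j = 1" using s by (auto simp: abs_if split: if_splits)
  moreover have "s \<in> topspace (cube m)" using s by (simp add: in_cube_iff_radius)
  ultimately show "s \<in> cube_boundary m" using j(1) by (auto simp: cube_boundary_def)
qed

lemma stretch_1: "(\<forall>j\<ge>m. s j = 0) \<Longrightarrow> stretch m 1 s = s"
  by (auto simp: stretch_def fun_eq_iff)

lemma continuous_map_radius:
  "(\<And>k. k < m \<Longrightarrow> continuous_map X euclideanreal (\<lambda>x. f x k)) \<Longrightarrow> continuous_map X euclideanreal (\<lambda>x. radius m (f x))"
  by (induction m) (auto intro!: continuous_map_real_max continuous_map_real_abs continuous_map_diff continuous_map_real_mult)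

lemma continuous_map_stretch:
  assumes "continuous_map X euclideanreal c" "\<And>k. k < m \<Longrightarrow> continuous_map X euclideanreal (\<lambda>x. f x k)"
  shows "continuous_map X euclideanreal (\<lambda>x. stretch m (c x) (f x) k)"
  using assms unfolding stretch_def
  by (cases "k < m") (auto intro!: continuous_map_add continuous_map_diff continuous_map_real_mult)

lemma continuous_map_cube_component:
  "continuous_map X (cube m) f \<Longrightarrow> continuous_map X euclideanreal (\<lambda>x. f x k)"
  by (simp add: continuous_map_into_cube)

lemma continuous_map_into_bcube:
  "continuous_map X (bcube m) f \<longleftrightarrow>
     (\<forall>k. continuous_map X euclideanreal (\<lambda>x. f x k)) \<and> (\<forall>x\<in>topspace X. f x \<in> cube_boundary m)"
  using cube_boundary_subset[of m] by (auto simp: continuous_map_in_subtopology continuous_map_into_cube)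

lemma continuous_map_radial_projection:
  assumes m: "m \<ge> 1" and f: "continuous_map X (cube m) f" and pos: "\<And>x. x \<in> topspace X \<Longrightarrow> radius m (f x) > 0"
  shows "continuous_map X (bcube m) (\<lambda>x. stretch m (1 / radius m (f x)) (f x))"
  unfolding continuous_map_into_bcube
proof (intro conjI allI ballI)
  show "continuous_map X euclideanreal (\<lambda>x. stretch m (1 / radius m (f x)) (f x) k)" for k
    by (intro continuous_map_stretch continuous_map_real_divide continuous_map_radius continuous_map_cube_component[OF f])
       (use pos in force)+
  fix x assume "x \<in> topspace X"
  then have "radius m (f x) > 0" by (rule pos)
  then show "stretch m (1 / radius m (f x)) (f x) \<in> cube_boundary m"
    unfolding in_cube_boundary_iff_radius[OF m] by (simp add: radius_stretch) (simp add: stretch_def)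
qed

text \<open>The cube is a cone on its boundary, so a null homotopy of \<open>\<phi>\<close> is an
  extension. Here the inner half is mapped to the constant \<open>c\<close> and the outer shell
  traverses the homotopy, which keeps the radial projection away from the centre.\<close>

lemma cube_extension:
  assumes m: "1 \<le> m" "m \<le> n" and \<phi>: "continuous_map (bcube m) (nsphere n) \<phi>"
  obtains \<Phi> where "continuous_map (cube m) (nsphere n) \<Phi>" "\<And>s. s \<in> cube_boundary m \<Longrightarrow> \<Phi> s = \<phi> s"
proof -
  obtain h c where c: "c \<in> topspace (nsphere n)" and h: "continuous_map (prod_topology unit_interval (bcube m)) (nsphere n) h"
    "\<And>s. s \<in> cube_boundary m \<Longrightarrow> h (0, s) = c" "\<And>s. s \<in> cube_boundary m \<Longrightarrow> h (1, s) = \<phi> s"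
    using bcube_map_null_homotopic[OF m \<phi>] by metis
  let ?\<Phi> = "\<lambda>s. if radius m s \<le> 1/2 then c else h (2 * radius m s - 1, stretch m (1 / radius m s) s)"
  have rc: "continuous_map (cube m) euclideanreal (radius m)"
    by (rule continuous_map_radius[of m "cube m" "\<lambda>x. x"]) (rule continuous_map_cube_projection)
  have bd: "stretch m (1 / radius m s) s \<in> cube_boundary m" if "radius m s > 0" for s
    unfolding in_cube_boundary_iff_radius[OF m(1)] using that by (simp add: radius_stretch) (simp add: stretch_def)
  show thesis
  proof
    show "continuous_map (cube m) (nsphere n) ?\<Phi>"
    proof (rule continuous_map_cases_le[OF rc])
      let ?T = "subtopology (cube m) {x \<in> topspace (cube m). 1/2 \<le> radius m x}"
      have id: "continuous_map ?T (cube m) (\<lambda>s. s)"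
        by (rule continuous_map_from_subtopology) simp
      have "continuous_map ?T (prod_topology unit_interval (bcube m)) (\<lambda>s. (2 * radius m s - 1, stretch m (1 / radius m s) s))"
      proof (rule continuous_map_pairedI)
        show "continuous_map ?T unit_interval (\<lambda>s. 2 * radius m s - 1)"
          unfolding continuous_map_into_unit_interval
          by (auto intro!: continuous_map_diff continuous_map_real_mult continuous_map_from_subtopology[OF rc]
              simp: in_cube_iff_radius)
        show "continuous_map ?T (bcube m) (\<lambda>s. stretch m (1 / radius m s) s)"
          by (rule continuous_map_radial_projection[OF m(1) id]) auto
      qed
      from continuous_map_compose[OF this h(1)]
      show "continuous_map ?T (nsphere n) (\<lambda>s. h (2 * radius m s - 1, stretch m (1 / radius m s) s))"
        by (simp add: o_def)
    next
      show "c = h (2 * radius m s - 1, stretch m (1 / radius m s) s)" if "radius m s = 1/2" for s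
      proof -
        have "2 * radius m s - 1 = 0" "radius m s > 0" using that by simp_all
        then show ?thesis using h(2)[OF bd[of s]] by simp
      qed
    qed (use c in auto)
    show "?\<Phi> s = \<phi> s" if s: "s \<in> cube_boundary m" for s
      using s h(3)[OF s] unfolding in_cube_boundary_iff_radius[OF m(1)] by (simp add: stretch_1)
  qed
qed

text \<open>At time \<open>t\<close> the map \<open>v\<close> is compressed by the factor
  \<open>1 + t\<close> towards the centre, and the collar that becomes free traverses
  \<open>h\<close> from time 0 to time \<open>t\<close>.\<close>

lemma cube_homotopy_extension:
  assumes m: "1 \<le> m" and v: "continuous_map (cube m) Y v"
    and h: "continuous_map (prod_topology unit_interval (bcube m)) Y h"
    and hv: "\<And>s. s \<in> cube_boundary m \<Longrightarrow> h (0, s) = v s"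
  obtains V where "continuous_map (prod_topology unit_interval (cube m)) Y V"
    "\<And>s. s \<in> topspace (cube m) \<Longrightarrow> V (0, s) = v s"
    "\<And>t s. t \<in> {0..1} \<Longrightarrow> s \<in> cube_boundary m \<Longrightarrow> V (t, s) = h (t, s)"
proof -
  let ?I = "prod_topology unit_interval (cube m)"
  let ?V = "\<lambda>p. if (1 + fst p) * radius m (snd p) \<le> 1 then v (stretch m (1 + fst p) (snd p))
                else h ((1 + fst p) * radius m (snd p) - 1, stretch m (1 / radius m (snd p)) (snd p))"
  have sn: "continuous_map ?I euclideanreal (\<lambda>p. snd p k)" for k
    using continuous_map_compose[OF continuous_map_snd continuous_map_cube_projection] by (simp add: o_def)
  have fs: "continuous_map ?I euclideanreal fst"
    using continuous_map_fst continuous_map_in_subtopology by blast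
  have rc: "continuous_map ?I euclideanreal (\<lambda>p. radius m (snd p))"
    by (rule continuous_map_radius) (rule sn)
  have pc: "continuous_map ?I euclideanreal (\<lambda>p. (1 + fst p) * radius m (snd p))"
    by (intro continuous_map_real_mult continuous_map_add rc fs) auto
  have bd: "stretch m (1 / radius m s) s \<in> cube_boundary m" if "radius m s > 0" for s
    unfolding in_cube_boundary_iff_radius[OF m(1)] using that by (simp add: radius_stretch) (simp add: stretch_def)
  show thesis
  proof
    show "continuous_map ?I Y ?V"
    proof (rule continuous_map_cases_le[OF pc])
      let ?T = "subtopology ?I {p \<in> topspace ?I. (1 + fst p) * radius m (snd p) \<le> 1}"
      have "continuous_map ?T (cube m) (\<lambda>p. stretch m (1 + fst p) (snd p))"
        unfolding continuous_map_into_cube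
      proof (intro conjI allI ballI)
        show "continuous_map ?T euclideanreal (\<lambda>p. stretch m (1 + fst p) (snd p) k)" for k
          by (intro continuous_map_stretch continuous_map_from_subtopology sn fs continuous_map_add) auto
      qed (auto simp: in_cube_iff_radius radius_stretch, simp add: stretch_def)
      from continuous_map_compose[OF this v]
      show "continuous_map ?T Y (\<lambda>p. v (stretch m (1 + fst p) (snd p)))" by (simp add: o_def)
    next
      let ?T = "subtopology ?I {p \<in> topspace ?I. 1 \<le> (1 + fst p) * radius m (snd p)}"
      have sc: "continuous_map ?T (cube m) snd"
        by (intro continuous_map_from_subtopology continuous_map_snd)
      have le: "(1 + t) * radius m s \<le> 2" if "t \<le> 1" "radius m s \<le> 1" for t s
        using mult_mono[of "1 + t" 2 "radius m s" 1] that radius_nonneg[of m s] by simp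
      have pos: "radius m s > 0" if "1 \<le> (1 + t) * radius m s" for t s
        using that radius_nonneg[of m s] by (cases "radius m s = 0") auto
      have "continuous_map ?T (prod_topology unit_interval (bcube m))
          (\<lambda>p. ((1 + fst p) * radius m (snd p) - 1, stretch m (1 / radius m (snd p)) (snd p)))"
      proof (rule continuous_map_pairedI)
        show "continuous_map ?T unit_interval (\<lambda>p. (1 + fst p) * radius m (snd p) - 1)"
          unfolding continuous_map_into_unit_interval
          by (auto intro!: continuous_map_diff continuous_map_from_subtopology[OF pc] le simp: in_cube_iff_radius)
        show "continuous_map ?T (bcube m) (\<lambda>p. stretch m (1 / radius m (snd p)) (snd p))"
          by (rule continuous_map_radial_projection[OF m(1) sc]) (auto dest: pos)
      qed
      from continuous_map_compose[OF this h]
      show "continuous_map ?T Y (\<lambda>p. h ((1 + fst p) * radius m (snd p) - 1, stretch m (1 / radius m (snd p)) (snd p)))"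
        by (simp add: o_def)
    next
      fix p assume p: "p \<in> topspace ?I" and e: "(1 + fst p) * radius m (snd p) = 1"
      then have "radius m (snd p) \<noteq> 0" by auto
      then have r: "radius m (snd p) > 0" "1 + fst p = 1 / radius m (snd p)"
        using radius_nonneg[of m "snd p"] e by (auto simp: field_simps)
      show "v (stretch m (1 + fst p) (snd p)) = h ((1 + fst p) * radius m (snd p) - 1, stretch m (1 / radius m (snd p)) (snd p))"
        using hv[OF bd[OF r(1)]] e r(2) by simp
    qed simp
    show "?V (0, s) = v s" if "s \<in> topspace (cube m)" for s
      using that by (simp add: in_cube_iff_radius stretch_1)
    show "?V (t, s) = h (t, s)" if t: "t \<in> {0..1}" and s: "s \<in> cube_boundary m" for t s
    proof -
      have s': "radius m s = 1" "\<forall>j\<ge>m. s j = 0" using s unfolding in_cube_boundary_iff_radius[OF m] by auto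
      show ?thesis
      proof (cases "t = 0")
        case True
        then show ?thesis using s' hv[OF s] by (simp add: stretch_1)
      next
        case False
        then show ?thesis using s' t by (simp add: stretch_1)
      qed
    qed
  qed
qed

text \<open>The boundary of the \<open>(i+1)\<close>-cube consists of the bottom and top (where \<open>radius i s \<le> \<bar>2 t - 1\<bar> = 1\<close>)
  and the sides (where \<open>\<bar>2 t - 1\<bar> \<le> radius i s = 1\<close>).\<close>

lemma sphere_homotopy_rel_boundary:
  assumes i: "i < n" and f0: "continuous_map (cube i) (nsphere n) f0" and f1: "continuous_map (cube i) (nsphere n) f1"
    and h: "continuous_map (prod_topology unit_interval (bcube i)) (nsphere n) h"
    and h0: "\<And>s. s \<in> cube_boundary i \<Longrightarrow> h (0, s) = f0 s" and h1: "\<And>s. s \<in> cube_boundary i \<Longrightarrow> h (1, s) = f1 s"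
  obtains K where "continuous_map (prod_topology unit_interval (cube i)) (nsphere n) K"
    "\<And>s. s \<in> topspace (cube i) \<Longrightarrow> K (0, s) = f0 s" "\<And>s. s \<in> topspace (cube i) \<Longrightarrow> K (1, s) = f1 s"
    "\<And>t s. t \<in> {0..1} \<Longrightarrow> s \<in> cube_boundary i \<Longrightarrow> K (t, s) = h (t, s)"
proof -
  let ?B = "bcube (Suc i)"
  let ?p = "\<lambda>u. u(i := (0::real))"
  have rp: "radius i (?p u) = radius i u" for u by (rule radius_cong) simp
  define \<phi> where "\<phi> \<equiv> \<lambda>u. if radius i u \<le> \<bar>2 * u i - 1\<bar> then (if u i \<le> 1/2 then f0 (?p u) else f1 (?p u)) else h (u i, ?p u)"
  have bd: "max (radius i u) \<bar>2 * u i - 1\<bar> = 1" "\<forall>j\<ge>Suc i. u j = 0" if "u \<in> cube_boundary (Suc i)" for u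
    using that in_cube_boundary_iff_radius[of "Suc i" u] by auto
  have id: "continuous_map ?B euclideanreal (\<lambda>u. u k)" for k
    by (rule continuous_map_from_subtopology[OF continuous_map_cube_projection])
  have pc: "continuous_map ?B euclideanreal (\<lambda>u. (?p u) k)" for k
    by (cases "k = i") (auto simp: id)
  have p_cube: "?p u \<in> topspace (cube i)" if u: "u \<in> cube_boundary (Suc i)" for u
    using bd[OF u] rp[of u] by (auto simp: in_cube_iff_radius Suc_le_eq)
  have "continuous_map ?B (nsphere n) \<phi>"
    unfolding \<phi>_def
  proof (rule continuous_map_cases_le)
    show "continuous_map ?B euclideanreal (\<lambda>u. radius i u)"
      by (rule continuous_map_radius) (rule id)
    show "continuous_map ?B euclideanreal (\<lambda>u. \<bar>2 * u i - 1\<bar>)"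
      by (intro continuous_map_real_abs continuous_map_diff continuous_map_real_mult id) auto
    let ?T = "subtopology ?B {u \<in> topspace ?B. radius i u \<le> \<bar>2 * u i - 1\<bar>}"
    show "continuous_map ?T (nsphere n) (\<lambda>u. if u i \<le> 1/2 then f0 (?p u) else f1 (?p u))"
    proof (rule continuous_map_cases_le)
      show "continuous_map ?T euclideanreal (\<lambda>u. u i)"
        by (rule continuous_map_from_subtopology[OF id])
      have "continuous_map ?B (cube i) ?p"
        unfolding continuous_map_into_cube using pc p_cube by simp
      from continuous_map_compose[OF this f0] continuous_map_compose[OF this f1]
      have "continuous_map ?B (nsphere n) (\<lambda>u. f0 (?p u))" "continuous_map ?B (nsphere n) (\<lambda>u. f1 (?p u))"
        by (simp_all add: o_def)
      then show "continuous_map (subtopology ?T {x \<in> topspace ?T. x i \<le> 1/2}) (nsphere n) (\<lambda>u. f0 (?p u))"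
        "continuous_map (subtopology ?T {x \<in> topspace ?T. 1/2 \<le> x i}) (nsphere n) (\<lambda>u. f1 (?p u))"
        by (simp_all add: continuous_map_from_subtopology)
      show "f0 (?p u) = f1 (?p u)" if "u \<in> topspace ?T" "u i = 1/2" for u
        using that bd(1)[of u] by auto
    qed auto
    let ?T = "subtopology ?B {u \<in> topspace ?B. \<bar>2 * u i - 1\<bar> \<le> radius i u}"
    show "continuous_map ?T (nsphere n) (\<lambda>u. h (u i, ?p u))"
    proof (cases "i = 0")
      \<comment> \<open>The boundary of the 1-cube has no sides: \<open>radius 0\<close> is 0 there,
        while \<open>\<bar>2 * u 0 - 1\<bar>\<close> is 1.\<close>
      case True
      have "topspace ?T = {}"
        using bd(1) True by force
      then have "?T = trivial_topology" by (simp only: null_topspace_iff_trivial)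
      then show ?thesis by (simp only: continuous_map_on_empty)
    next
      case False
      have "continuous_map ?T (prod_topology unit_interval (bcube i)) (\<lambda>u. (u i, ?p u))"
      proof (rule continuous_map_pairedI)
        show "continuous_map ?T unit_interval (\<lambda>u. u i)"
          unfolding continuous_map_into_unit_interval
          using cube_boundary_subset[of "Suc i"] 
          by (auto intro!: continuous_map_from_subtopology[OF id] simp: topspace_cube)
        show "continuous_map ?T (bcube i) ?p"
          unfolding continuous_map_into_bcube
        proof (intro conjI allI ballI)
          show "continuous_map ?T euclideanreal (\<lambda>u. ?p u k)" for k
            by (rule continuous_map_from_subtopology[OF pc])
          fix u assume "u \<in> topspace ?T"
          then have u: "u \<in> cube_boundary (Suc i)" "\<bar>2 * u i - 1\<bar> \<le> radius i u" by auto
          then show "?p u \<in> cube_boundary i"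
            using False bd[OF u(1)] p_cube[OF u(1)] rp[of u] by (auto simp: in_cube_boundary_iff_radius in_cube_iff_radius)
        qed
      qed
      from continuous_map_compose[OF this h] show ?thesis by (simp add: o_def)
    qed
    fix u assume u: "u \<in> topspace ?B" and e: "radius i u = \<bar>2 * u i - 1\<bar>"
    then have u': "u \<in> cube_boundary (Suc i)" by simp
    have r: "radius i u = 1" and ui: "u i = 0 \<or> u i = 1" using bd(1)[OF u'] e by (auto simp: abs_if split: if_splits)
    have "i \<noteq> 0" using r by (cases i) auto
    then have "?p u \<in> cube_boundary i"
      using r rp[of u] p_cube[OF u'] by (auto simp: in_cube_boundary_iff_radius in_cube_iff_radius)
    then show "(if u i \<le> 1/2 then f0 (?p u) else f1 (?p u)) = h (u i, ?p u)"
      using ui h0 h1 by auto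
  qed
  \<comment> \<open>The prescribed ends and boundary track form one map on the boundary of a cube of
    dimension \<open>Suc i\<close>, which is at most \<open>n\<close>. Its extension over the cube,
    with coordinate \<open>i\<close> read as time, is the homotopy.\<close>
  then obtain \<Phi> where \<Phi>: "continuous_map (cube (Suc i)) (nsphere n) \<Phi>" "\<And>s. s \<in> cube_boundary (Suc i) \<Longrightarrow> \<Phi> s = \<phi> s"
    using cube_extension[of "Suc i" n] i by (metis One_nat_def Suc_leI le_add1 plus_1_eq_Suc)
  let ?K = "\<lambda>p. \<Phi> ((snd p)(i := fst p))"
  have in_cube: "s(i := t) \<in> topspace (cube (Suc i))" if "t \<in> {0..1}" "s \<in> topspace (cube i)" for t s
    using that by (auto simp: topspace_cube less_Suc_eq)
  have in_bd: "s(i := t) \<in> cube_boundary (Suc i)" if "t = 0 \<or> t = 1" "s \<in> topspace (cube i)" for t s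
    using in_cube[of t s] that by (auto simp: cube_boundary_def intro!: exI[of _ i])
  have in_bd': "s(i := t) \<in> cube_boundary (Suc i)" if t: "t \<in> {0..1}" and s: "s \<in> cube_boundary i" for t s
  proof -
    obtain j where "j < i" "s j = 0 \<or> s j = 1" "s \<in> topspace (cube i)" using s by (auto simp: cube_boundary_def)
    then show ?thesis using in_cube[OF t] unfolding cube_boundary_def by (auto intro!: exI[of _ j])
  qed
  have pu: "?p (s(i := t)) = s" if "s \<in> topspace (cube i)" for s t
    using that by (auto simp: topspace_cube fun_eq_iff)
  have ri: "radius i (s(i := t)) = radius i s" for s t by (rule radius_cong) simp
  show thesis
  proof
    have "continuous_map (prod_topology unit_interval (cube i)) (cube (Suc i)) (\<lambda>p. (snd p)(i := fst p))"
      unfolding continuous_map_into_cube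
    proof (intro conjI allI ballI)
      have "continuous_map (prod_topology unit_interval (cube i)) euclideanreal (\<lambda>p. snd p k)" for k
        using continuous_map_compose[OF continuous_map_snd continuous_map_cube_projection] by (simp add: o_def)
      moreover have "continuous_map (prod_topology unit_interval (cube i)) euclideanreal fst"
        using continuous_map_fst continuous_map_in_subtopology by blast
      ultimately show "continuous_map (prod_topology unit_interval (cube i)) euclideanreal (\<lambda>p. ((snd p)(i := fst p)) k)" for k
        by (cases "k = i") auto
    qed (use in_cube in auto)
    from continuous_map_compose[OF this \<Phi>(1)]
    show "continuous_map (prod_topology unit_interval (cube i)) (nsphere n) ?K" by (simp add: o_def)
    show "?K (0, s) = f0 s" "?K (1, s) = f1 s" if s: "s \<in> topspace (cube i)" for s
      using \<Phi>(2)[OF in_bd[of 0 s]] \<Phi>(2)[OF in_bd[of 1 s]] s pu[OF s] ri[of s]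
      by (simp_all add: \<phi>_def in_cube_iff_radius)
    show "?K (t, s) = h (t, s)" if t: "t \<in> {0..1}" and s: "s \<in> cube_boundary i" for t s
    proof -
      have s': "s \<in> topspace (cube i)" using s cube_boundary_subset by blast
      have "i \<ge> 1" using s by (cases i) (auto simp: cube_boundary_def)
      then have r: "radius i s = 1" using s by (simp add: in_cube_boundary_iff_radius)
      have "\<Phi> (s(i := t)) = \<phi> (s(i := t))" by (rule \<Phi>(2)[OF in_bd'[OF t s]])
      also have "\<dots> = h (t, s)"
      proof (cases "1 \<le> \<bar>2 * t - 1\<bar>")
        case True
        then have "t = 0 \<or> t = 1" using t by (auto simp: abs_if split: if_splits)
        then show ?thesis using h0[OF s] h1[OF s] pu[OF s'] r ri by (auto simp: \<phi>_def)
      qed (use pu[OF s'] r ri in \<open>simp add: \<phi>_def\<close>)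
      finally show ?thesis by simp
    qed
  qed
qed

section \<open>Hemispheres\<close>

abbreviation upper_hemisphere :: "nat \<Rightarrow> (nat \<Rightarrow> real) topology" where
  "upper_hemisphere j \<equiv> subtopology (nsphere j) {x. 0 \<le> x j}"

lemma nsphere_eq_top_of_set: "nsphere n = top_of_set (topspace (nsphere n))"
  by (simp add: nsphere euclidean_product_topology)

lemma topspace_nsphere_Suc: "x \<in> topspace (nsphere n) \<longleftrightarrow> x \<in> topspace (nsphere (Suc n)) \<and> x (Suc n) = 0"
proof -
  have "topspace (nsphere n) = topspace (subtopology (nsphere (Suc n)) {x. x (Suc n) = 0})"
    by (simp only: subtopology_nsphere_equator)
  then show ?thesis by simp
qed

lemma nsphere_mono: "m \<le> n \<Longrightarrow> x \<in> topspace (nsphere m) \<Longrightarrow> x \<in> topspace (nsphere n)"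
  by (induction n rule: dec_induct) (auto dest: topspace_nsphere_Suc[THEN iffD1])

lemma continuous_map_nsphere_mono:
  "m \<le> n \<Longrightarrow> continuous_map X (nsphere m) f \<Longrightarrow> continuous_map X (nsphere n) f"
  using nsphere_mono by (auto simp: continuous_map_into_nsphere)

lemma compact_space_upper_hemisphere: "compact_space (upper_hemisphere j)"
proof -
  have "closedin (nsphere j) {x \<in> topspace (nsphere j). x j \<in> {0..}}"
    by (rule closedin_continuous_map_preimage[OF continuous_map_nsphere_projection]) auto
  then have "compactin (nsphere j) {x \<in> topspace (nsphere j). x j \<in> {0..}}"
    by (simp add: closedin_compact_space compact_space_nsphere)
  then have "compact_space (subtopology (nsphere j) {x \<in> topspace (nsphere j). x j \<in> {0..}})"
    by (rule compact_space_subtopology)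
  moreover have "subtopology (nsphere j) {x \<in> topspace (nsphere j). x j \<in> {0..}} = upper_hemisphere j"
    by (subst subtopology_restrict[symmetric]) (simp add: Collect_conj_eq atLeast_def)
  ultimately show ?thesis by simp
qed

text \<open>Where \<open>s\<close> vanishes the quotient is 0 by convention, and the product is
  bounded by \<open>r\<close>, which tends to 0 there. This covers all radial rescalings below,
  whose scale factor need not be continuous at the centre.\<close>

lemma continuous_on_mult_divide:
  fixes a r s :: "'a::topological_space \<Rightarrow> real"
  assumes a: "continuous_on S a" and r: "continuous_on S r" and s: "continuous_on S s"
    and le: "\<And>x. x \<in> S \<Longrightarrow> \<bar>a x\<bar> \<le> s x" and r0: "\<And>x. x \<in> S \<Longrightarrow> r x \<ge> 0"
    and z: "\<And>x. x \<in> S \<Longrightarrow> s x = 0 \<Longrightarrow> r x = 0"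
  shows "continuous_on S (\<lambda>x. a x * (r x / s x))"
  unfolding continuous_on_def
proof
  fix x assume x: "x \<in> S"
  have lims: "(a \<longlongrightarrow> a x) (at x within S)" "(r \<longlongrightarrow> r x) (at x within S)" "(s \<longlongrightarrow> s x) (at x within S)"
    using a r s x by (auto simp: continuous_on_def)
  show "((\<lambda>x. a x * (r x / s x)) \<longlongrightarrow> a x * (r x / s x)) (at x within S)"
  proof (cases "s x = 0")
    case True
    have "norm (a y * (r y / s y)) \<le> r y" if "y \<in> S" for y
    proof (cases "s y = 0")
      case False
      then have "s y > 0" using le[OF that] by linarith
      then have "\<bar>a y\<bar> * r y \<le> s y * r y" using le[OF that] r0[OF that] by (intro mult_right_mono) auto
      then have "\<bar>a y\<bar> * r y / s y \<le> r y" using \<open>s y > 0\<close> by (simp add: pos_divide_le_eq mult.commute)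
      then show ?thesis using \<open>s y > 0\<close> r0[OF that] by (simp add: abs_mult)
    qed (use r0[OF that] in auto)
    then have "\<forall>\<^sub>F y in at x within S. norm (a y * (r y / s y)) \<le> r y"
      by (auto simp: eventually_at_filter)
    moreover have "(r \<longlongrightarrow> 0) (at x within S)" using lims(2) z[OF x True] by simp
    ultimately have "((\<lambda>x. a x * (r x / s x)) \<longlongrightarrow> 0) (at x within S)"
      by (rule Lim_null_comparison)
    then show ?thesis using True by simp
  qed (intro tendsto_mult tendsto_divide lims)
qed

section \<open>Radial maps between the upper hemisphere and the cube\<close>

lemma double_half_simps [simp]: "(2 * a + 2) / 2 - 1 = (a::real)" "2 * ((a + 1) / 2) - 1 = a"
  by (simp_all add: field_simps)

text \<open>The affine change of coordinates from [-1,1] to [0,1] makes this an instance of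
  \<open>radius\<close>, whose properties it inherits.\<close>

definition sup_norm :: "nat \<Rightarrow> (nat \<Rightarrow> real) \<Rightarrow> real" where
  "sup_norm j x = radius j (\<lambda>i. (x i + 1) / 2)"

definition euclidean_norm :: "nat \<Rightarrow> (nat \<Rightarrow> real) \<Rightarrow> real" where
  "euclidean_norm j x = sqrt (\<Sum>i<j. (x i)\<^sup>2)"

lemma sup_norm_ge: "i < j \<Longrightarrow> \<bar>x i\<bar> \<le> sup_norm j x"
  using radius_le_iff[OF radius_nonneg, of j "\<lambda>i. (x i + 1) / 2" j "\<lambda>i. (x i + 1) / 2"]
  by (auto simp: sup_norm_def)

lemma euclidean_norm_ge: "i < j \<Longrightarrow> \<bar>x i\<bar> \<le> euclidean_norm j x"
proof -
  assume "i < j"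
  then have "(x i)\<^sup>2 \<le> (\<Sum>i<j. (x i)\<^sup>2)" by (intro member_le_sum) auto
  then show ?thesis
    unfolding euclidean_norm_def by (metis real_sqrt_abs real_sqrt_le_iff)
qed

lemma sup_norm_scale: "c \<ge> 0 \<Longrightarrow> sup_norm j (\<lambda>i. x i * c) = sup_norm j x * c"
  unfolding sup_norm_def by (induction j) (auto simp: abs_mult max_mult_distrib_right)

lemma euclidean_norm_scale: "c \<ge> 0 \<Longrightarrow> euclidean_norm j (\<lambda>i. x i * c) = euclidean_norm j x * c"
  by (simp add: euclidean_norm_def power_mult_distrib real_sqrt_mult flip: sum_distrib_right)

lemma norms_eq_0:
  "sup_norm j x = 0 \<longleftrightarrow> (\<forall>i<j. x i = 0)" "euclidean_norm j x = 0 \<longleftrightarrow> (\<forall>i<j. x i = 0)"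
proof -
  have "sup_norm j x = 0 \<longleftrightarrow> sup_norm j x \<le> 0" using radius_nonneg by (metis sup_norm_def antisym_conv)
  also have "\<dots> \<longleftrightarrow> (\<forall>i<j. x i = 0)" unfolding sup_norm_def by (subst radius_le_iff) auto
  finally show "sup_norm j x = 0 \<longleftrightarrow> (\<forall>i<j. x i = 0)" .
  show "euclidean_norm j x = 0 \<longleftrightarrow> (\<forall>i<j. x i = 0)"
    by (auto simp: euclidean_norm_def sum_nonneg_eq_0_iff)
qed

lemma norms_nonneg: "sup_norm j x \<ge> 0" "euclidean_norm j x \<ge> 0"
  by (simp_all add: sup_norm_def radius_nonneg euclidean_norm_def sum_nonneg)

lemma continuous_on_radius:
  "(\<And>k. k < m \<Longrightarrow> continuous_on S (\<lambda>x. f x k)) \<Longrightarrow> continuous_on S (\<lambda>x. radius m (f x))"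
  using continuous_map_radius[of m "top_of_set S" f] by simp

text \<open>Forget the last coordinate, rescale the round ball radially to the ball of the sup norm,
  then move [-1,1] to [0,1]. At the centre the quotient of norms is 0 / 0 = 0, times a zero
  coordinate.\<close>

definition hemisphere_to_cube :: "nat \<Rightarrow> (nat \<Rightarrow> real) \<Rightarrow> nat \<Rightarrow> real" where
  "hemisphere_to_cube j x = (\<lambda>i. if i < j then (x i * (euclidean_norm j x / sup_norm j x) + 1) / 2 else 0)"

text \<open>Undoes the radial rescaling and restores the height from the equation of the sphere; the
  root is the nonnegative one, so the image is in the upper hemisphere.\<close>

definition cube_to_hemisphere :: "nat \<Rightarrow> (nat \<Rightarrow> real) \<Rightarrow> nat \<Rightarrow> real" where
  "cube_to_hemisphere j s = (let u = (\<lambda>i. 2 * s i - 1) in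
     (\<lambda>i. if i < j then u i * (sup_norm j u / euclidean_norm j u)
          else if i = j then sqrt (1 - (sup_norm j u)\<^sup>2) else 0))"

lemma radius_hemisphere_to_cube: "radius j (hemisphere_to_cube j x) = euclidean_norm j x"
proof -
  have "radius j (hemisphere_to_cube j x) = radius j (\<lambda>i. (x i * (euclidean_norm j x / sup_norm j x) + 1) / 2)"
    by (rule radius_cong) (simp add: hemisphere_to_cube_def)
  also have "\<dots> = sup_norm j (\<lambda>i. x i * (euclidean_norm j x / sup_norm j x))"
    by (rule sup_norm_def[symmetric])
  also have "\<dots> = sup_norm j x * (euclidean_norm j x / sup_norm j x)"
    by (rule sup_norm_scale) (simp add: norms_nonneg)
  also have "\<dots> = euclidean_norm j x"
    using norms_eq_0 by (cases "sup_norm j x = 0") auto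
  finally show ?thesis .
qed

lemma nsphere_euclidean_norm:
  assumes "x \<in> topspace (nsphere j)"
  shows "(euclidean_norm j x)\<^sup>2 + (x j)\<^sup>2 = 1" "euclidean_norm j x \<le> 1"
proof -
  have "{..j} = insert j {..<j}" by auto
  then show 1: "(euclidean_norm j x)\<^sup>2 + (x j)\<^sup>2 = 1"
    using assms by (simp add: euclidean_norm_def sum_nonneg topspace_nsphere dot_def power2_eq_square)
  have "(euclidean_norm j x)\<^sup>2 \<le> 1" using 1 zero_le_power2[of "x j"] by linarith
  then have "\<bar>euclidean_norm j x\<bar> \<le> 1" by (simp only: abs_square_le_1)
  then show "euclidean_norm j x \<le> 1" by simp
qed

lemma hemisphere_to_cube_in:
  assumes "x \<in> topspace (nsphere j)"
  shows "hemisphere_to_cube j x \<in> topspace (cube j)"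
  using nsphere_euclidean_norm(2)[OF assms]
  by (simp add: in_cube_iff_radius radius_hemisphere_to_cube) (simp add: hemisphere_to_cube_def)

lemma hemisphere_to_cube_boundary:
  assumes "j \<ge> 1" "x \<in> topspace (nsphere j)" "x j = 0"
  shows "hemisphere_to_cube j x \<in> cube_boundary j"
proof -
  have "(euclidean_norm j x)\<^sup>2 = 1" using nsphere_euclidean_norm(1)[OF assms(2)] assms(3) by simp
  then have "euclidean_norm j x = 1"
    using norms_nonneg(2)[of j x] by (simp add: power2_eq_1_iff)
  then show ?thesis
    unfolding in_cube_boundary_iff_radius[OF assms(1)]
    by (simp add: radius_hemisphere_to_cube) (simp add: hemisphere_to_cube_def)
qed

lemma sup_norm_cube: "sup_norm j (\<lambda>i. 2 * s i - 1) = radius j s"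
  unfolding sup_norm_def by (rule radius_cong) simp

lemma cube_to_hemisphere_last: "cube_to_hemisphere j s j = sqrt (1 - (radius j s)\<^sup>2)"
  by (simp add: cube_to_hemisphere_def Let_def sup_norm_cube)

lemma cube_to_hemisphere_in:
  assumes s: "s \<in> topspace (cube j)"
  shows "cube_to_hemisphere j s \<in> topspace (nsphere j)" "cube_to_hemisphere j s j \<ge> 0"
proof -
  let ?u = "\<lambda>i. 2 * s i - 1"
  let ?r = "radius j s"
  have r: "0 \<le> ?r" "?r \<le> 1" using s radius_nonneg by (auto simp: in_cube_iff_radius)
  then have r2: "?r\<^sup>2 \<le> 1" by (simp add: power_le_one)
  then show 1: "cube_to_hemisphere j s j \<ge> 0" by (simp add: cube_to_hemisphere_last)
  have "(\<Sum>i<j. (cube_to_hemisphere j s i)\<^sup>2) = (euclidean_norm j (\<lambda>i. ?u i * (?r / euclidean_norm j ?u)))\<^sup>2"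
  proof -
    have "(euclidean_norm j v)\<^sup>2 = (\<Sum>i<j. (v i)\<^sup>2)" for v by (simp add: euclidean_norm_def sum_nonneg)
    then show ?thesis by (simp add: cube_to_hemisphere_def Let_def sup_norm_cube)
  qed
  also have "\<dots> = (euclidean_norm j ?u * (?r / euclidean_norm j ?u))\<^sup>2"
    by (subst euclidean_norm_scale) (simp_all add: r norms_nonneg)
  also have "\<dots> = ?r\<^sup>2"
  proof (cases "euclidean_norm j ?u = 0")
    case True
    then have "sup_norm j ?u = 0" unfolding norms_eq_0 .
    then have "?r = 0" by (simp only: sup_norm_cube)
    then show ?thesis by simp
  qed simp
  finally have "(\<Sum>i<j. (cube_to_hemisphere j s i)\<^sup>2) = ?r\<^sup>2" .
  moreover have "(cube_to_hemisphere j s j)\<^sup>2 = 1 - ?r\<^sup>2" using r2 by (simp add: cube_to_hemisphere_last)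
  moreover have "{..j} = insert j {..<j}" by auto
  ultimately have "dot j (cube_to_hemisphere j s) (cube_to_hemisphere j s) = 1"
    by (simp add: dot_def power2_eq_square)
  then show "cube_to_hemisphere j s \<in> topspace (nsphere j)"
    by (simp add: topspace_nsphere) (simp add: cube_to_hemisphere_def Let_def)
qed

lemma cube_to_hemisphere_boundary:
  assumes "s \<in> cube_boundary j" shows "cube_to_hemisphere j s j = 0"
proof -
  have "j \<ge> 1" using assms by (cases j) (auto simp: cube_boundary_def)
  then have "radius j s = 1" using assms in_cube_boundary_iff_radius by simp
  then show ?thesis by (simp add: cube_to_hemisphere_last)
qed

lemma cube_to_hemisphere_inverse:
  assumes x: "x \<in> topspace (nsphere j)" "x j \<ge> 0"
  shows "cube_to_hemisphere j (hemisphere_to_cube j x) = x"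
proof
  fix i
  let ?s = "hemisphere_to_cube j x" and ?e = "euclidean_norm j x" and ?m = "sup_norm j x"
  show "cube_to_hemisphere j ?s i = x i"
  proof (cases i j rule: linorder_cases)
    case less
    have u: "2 * ?s k - 1 = x k * (?e / ?m)" if "k < j" for k
      by (simp only: hemisphere_to_cube_def that if_True double_half_simps)
    have "euclidean_norm j (\<lambda>k. 2 * ?s k - 1) = euclidean_norm j (\<lambda>k. x k * (?e / ?m))"
      unfolding euclidean_norm_def by (intro arg_cong[where f = sqrt] sum.cong) (auto simp: u euclidean_norm_def)
    also have "\<dots> = ?e * (?e / ?m)" by (rule euclidean_norm_scale) (simp add: norms_nonneg)
    finally have e: "euclidean_norm j (\<lambda>k. 2 * ?s k - 1) = ?e * (?e / ?m)" .
    have "cube_to_hemisphere j ?s i = x i * (?e / ?m) * (?e / (?e * (?e / ?m)))"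
      using less by (simp add: cube_to_hemisphere_def Let_def sup_norm_cube radius_hemisphere_to_cube e u)
    \<comment> \<open>The two scale factors are reciprocal unless the Euclidean norm is 0, in which
      case \<open>x i\<close> itself is 0.\<close>
    also have "\<dots> = x i"
    proof (cases "?e = 0")
      case True
      then have "x i = 0" using norms_eq_0(2)[of j x] less by blast
      then show ?thesis by simp
    next
      case False
      then have "?m \<noteq> 0" using norms_eq_0[of j x] by blast
      then show ?thesis using False by simp
    qed
    finally show ?thesis .
  next
    case equal
    have "1 - ?e\<^sup>2 = (x j)\<^sup>2" using nsphere_euclidean_norm(1)[OF x(1)] by simp
    then show ?thesis using x(2) equal by (simp add: cube_to_hemisphere_last radius_hemisphere_to_cube)
  next
    case greater
    then show ?thesis using x(1) by (simp add: cube_to_hemisphere_def Let_def topspace_nsphere)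
  qed
qed

lemma continuous_on_coordinate: "continuous_on S (\<lambda>x. x i :: real)"
  by (rule continuous_on_subset[OF continuous_on_product_coordinates subset_UNIV])

lemma continuous_map_hemisphere_to_cube:
  "continuous_map (nsphere j) (cube j) (hemisphere_to_cube j)"
  unfolding continuous_map_into_cube
proof (intro conjI allI ballI)
  fix k
  have "continuous_on UNIV (\<lambda>x. hemisphere_to_cube j x k)"
  proof (cases "k < j")
    case True
    have "continuous_on UNIV (\<lambda>x. x k * (euclidean_norm j x / sup_norm j x))"
    proof (rule continuous_on_mult_divide)
      show "continuous_on UNIV (\<lambda>x::nat\<Rightarrow>real. x k)" by (rule continuous_on_coordinate)
      show "continuous_on UNIV (euclidean_norm j)"
        unfolding euclidean_norm_def
        by (intro continuous_on_real_sqrt continuous_on_sum continuous_on_power continuous_on_coordinate)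
      show "continuous_on UNIV (sup_norm j)"
        unfolding sup_norm_def
        by (intro continuous_on_radius continuous_on_divide continuous_on_add continuous_on_coordinate continuous_on_const) auto
      show "\<bar>x k\<bar> \<le> sup_norm j x" for x using True by (rule sup_norm_ge)
      show "euclidean_norm j x = 0" if "sup_norm j x = 0" for x using that unfolding norms_eq_0 .
    qed (rule norms_nonneg)
    then show ?thesis
      unfolding hemisphere_to_cube_def using True
      by (auto intro!: continuous_on_divide continuous_on_add continuous_on_const)
  qed (simp add: hemisphere_to_cube_def)
  then have "continuous_on (topspace (nsphere j)) (\<lambda>x. hemisphere_to_cube j x k)"
    by (rule continuous_on_subset) simp
  then show "continuous_map (nsphere j) euclideanreal (\<lambda>x. hemisphere_to_cube j x k)"
    by (subst nsphere_eq_top_of_set) simp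
qed (rule hemisphere_to_cube_in)

lemma continuous_map_cube_to_hemisphere:
  "continuous_map (cube j) (upper_hemisphere j) (cube_to_hemisphere j)"
  unfolding continuous_map_in_subtopology continuous_map_into_nsphere
proof (intro conjI allI ballI)
  fix k
  let ?S = "topspace (cube j)"
  let ?u = "\<lambda>s i. 2 * s i - (1::real)"
  have cu: "continuous_on ?S (\<lambda>s. ?u s i)" for i
    by (intro continuous_on_diff continuous_on_mult continuous_on_const continuous_on_coordinate)
  have cr: "continuous_on ?S (\<lambda>s. sup_norm j (?u s))"
    unfolding sup_norm_def
    by (intro continuous_on_radius continuous_on_divide continuous_on_add cu continuous_on_const) auto
  have "continuous_on ?S (\<lambda>s. cube_to_hemisphere j s k)"
  proof (cases k j rule: linorder_cases)
    case less
    have "continuous_on ?S (\<lambda>s. ?u s k * (sup_norm j (?u s) / euclidean_norm j (?u s)))"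
    proof (rule continuous_on_mult_divide[OF cu cr])
      show "continuous_on ?S (\<lambda>s. euclidean_norm j (?u s))"
        unfolding euclidean_norm_def
        by (intro continuous_on_real_sqrt continuous_on_sum continuous_on_power cu)
      show "\<bar>?u s k\<bar> \<le> euclidean_norm j (?u s)" for s using euclidean_norm_ge[OF less, of "?u s"] by simp
      show "sup_norm j (?u s) = 0" if "euclidean_norm j (?u s) = 0" for s using that unfolding norms_eq_0 .
    qed (rule norms_nonneg)
    then show ?thesis using less by (simp add: cube_to_hemisphere_def Let_def)
  next
    case equal
    then show ?thesis
      by (simp add: cube_to_hemisphere_def Let_def)
         (intro continuous_on_real_sqrt continuous_on_diff continuous_on_power cr continuous_on_const)
  qed (simp add: cube_to_hemisphere_def Let_def)
  then show "continuous_map (cube j) euclideanreal (\<lambda>s. cube_to_hemisphere j s k)"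
    by (subst cube_eq_top_of_set) simp
next
  show "cube_to_hemisphere j \<in> topspace (cube j) \<rightarrow> {x. 0 \<le> x j}"
    using cube_to_hemisphere_in(2) by blast
qed (rule cube_to_hemisphere_in(1))

section \<open>Extension from the upper hemisphere\<close>

lemma continuous_map_paired_antipode:
  "continuous_map (prod_topology T (nsphere j)) (prod_topology T (nsphere j)) (\<lambda>p. (fst p, antipode (snd p)))"
  by (intro continuous_map_pairedI continuous_map_fst continuous_map_antipode continuous_map_snd)

lemma hemisphere_extension:
  assumes A: "A = id \<or> A = antipode"
    and \<phi>: "continuous_map (prod_topology T (upper_hemisphere j)) (nsphere n) \<phi>"
    and eq: "\<And>t x. t \<in> topspace T \<Longrightarrow> x \<in> topspace (nsphere j) \<Longrightarrow> x j = 0 \<Longrightarrow> \<phi> (t, antipode x) = A (\<phi> (t, x))"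
  shows "\<exists>\<psi>. continuous_map (prod_topology T (nsphere j)) (nsphere n) \<psi> \<and>
    (\<forall>t\<in>topspace T. \<forall>x\<in>topspace (nsphere j). 0 \<le> x j \<longrightarrow> \<psi> (t, x) = \<phi> (t, x)) \<and>
    (\<forall>t\<in>topspace T. \<forall>x\<in>topspace (nsphere j). \<psi> (t, antipode x) = A (\<psi> (t, x)))"
proof -
  let ?X = "prod_topology T (nsphere j)"
  let ?\<psi> = "\<lambda>p. if 0 \<le> snd p j then \<phi> p else A (\<phi> (fst p, antipode (snd p)))"
  have AA: "A (A x) = x" for x using A by auto
  have Ac: "continuous_map X (nsphere n) (\<lambda>x. A (f x))" if "continuous_map X (nsphere n) f" for X :: "'b topology" and f
    using A continuous_map_antipode[OF that] that by auto
  have sj: "continuous_map ?X euclideanreal (\<lambda>p. snd p j)"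
    using continuous_map_compose[OF continuous_map_snd continuous_map_nsphere_projection] by (simp add: o_def)
  have into: "continuous_map S (prod_topology T (upper_hemisphere j)) f"
    if "continuous_map S ?X f" "\<And>x. x \<in> topspace S \<Longrightarrow> 0 \<le> snd (f x) j" for S :: "('a \<times> (nat \<Rightarrow> real)) topology" and f
    using that unfolding continuous_map_pairwise by (auto simp: continuous_map_in_subtopology)
  have "continuous_map ?X (nsphere n) ?\<psi>"
  proof (rule continuous_map_cases_le)
    let ?S = "subtopology ?X {x \<in> topspace ?X. 0 \<le> snd x j}"
    have "continuous_map ?S (prod_topology T (upper_hemisphere j)) (\<lambda>x. x)"
      by (rule into) (auto intro: continuous_map_from_subtopology)
    from continuous_map_compose[OF this \<phi>] show "continuous_map ?S (nsphere n) \<phi>" by (simp add: o_def)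
    let ?S = "subtopology ?X {x \<in> topspace ?X. snd x j \<le> 0}"
    have "continuous_map ?S (prod_topology T (upper_hemisphere j)) (\<lambda>p. (fst p, antipode (snd p)))"
      by (rule into) (auto intro: continuous_map_from_subtopology[OF continuous_map_paired_antipode])
    from Ac[OF continuous_map_compose[OF this \<phi>]]
    show "continuous_map ?S (nsphere n) (\<lambda>p. A (\<phi> (fst p, antipode (snd p))))" by (simp add: o_def)
    show "\<phi> p = A (\<phi> (fst p, antipode (snd p)))" if p: "p \<in> topspace ?X" "0 = snd p j" for p
      using eq[of "fst p" "snd p"] p by (cases p) (simp add: AA)
  qed (use sj in auto)
  moreover have "?\<psi> (t, antipode x) = A (?\<psi> (t, x))" if "t \<in> topspace T" "x \<in> topspace (nsphere j)" for t x
    using eq[OF that] AA by (cases "x j" "0::real" rule: linorder_cases) auto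
  ultimately show ?thesis by (intro exI[of _ ?\<psi>]) auto
qed

text \<open>The closed upper hemisphere is contractible, so the map lifts over it. On the equator
  the values at antipodal points lie on the same line; once their relative sign is seen to be
  constant, the lift extends to the whole sphere with that parity.\<close>

lemma RP_map_lift:
  assumes n: "n \<ge> 1" and f: "continuous_map (real_projective_space n) (real_projective_space n) f"
    and P: "P \<in> topspace (nsphere n)" and y: "y \<in> topspace (nsphere n)" "f (antipodal_pair P) = antipodal_pair y"
  shows "\<exists>F A. (A = id \<or> A = antipode) \<and> continuous_map (nsphere n) (nsphere n) F \<and> F P = y \<and>
     (\<forall>x\<in>topspace (nsphere n). antipodal_pair (F x) = f (antipodal_pair x) \<and> F (antipode x) = A (F x))"
proof -
  let ?D = "upper_hemisphere n"
  have qD: "continuous_map ?D (real_projective_space n) (\<lambda>x. f (antipodal_pair x))"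
    using continuous_map_compose[OF continuous_map_from_subtopology[OF continuous_map_RP] f] by (simp add: o_def)
  define z0 :: "nat \<Rightarrow> real" where "z0 = (if P n \<ge> 0 then P else antipode P)"
  have z0: "z0 \<in> topspace ?D" "f (antipodal_pair z0) = antipodal_pair y"
    using P y by (auto simp: z0_def)
  obtain \<Phi> where \<Phi>: "continuous_map ?D (nsphere n) \<Phi>"
    "\<And>z. z \<in> topspace ?D \<Longrightarrow> antipodal_pair (\<Phi> z) = f (antipodal_pair z)" "\<Phi> z0 = y"
  proof (rule RP_lift_contractible[where Z = ?D and \<phi> = "\<lambda>x. f (antipodal_pair x)" and ?z0.0 = z0 and y = y and n = n])
    show "contractible_space ?D" by (intro contractible_space_upper_hemisphere order_refl)
    show "compact_space ?D" by (rule compact_space_upper_hemisphere)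
  qed (use qD z0 y(1) in simp_all)
  \<comment> \<open>Half of the equator, connected even for \<open>n = 1\<close>, when the equator
    itself is a pair of points. Every equatorial point or its antipode lies in it.\<close>
  let ?E = "upper_hemisphere (n - 1)"
  have En: "x \<in> topspace (nsphere (n - 1)) \<longleftrightarrow> x \<in> topspace (nsphere n) \<and> x n = 0" for x
    using topspace_nsphere_Suc[of x "n - 1"] n by simp
  have Eq: "continuous_map ?E ?D (\<lambda>x. x)" "continuous_map ?E ?D antipode"
  proof -
    have id: "continuous_map ?E (nsphere n) (\<lambda>x. x)"
      by (rule continuous_map_nsphere_mono[of "n - 1"]) (auto intro: continuous_map_from_subtopology)
    then show "continuous_map ?E ?D (\<lambda>x. x)" "continuous_map ?E ?D antipode"
      using continuous_map_antipode[OF id] En by (auto simp: continuous_map_in_subtopology)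
  qed
  have q1: "antipodal_pair (\<Phi> x) = antipodal_pair (\<Phi> (antipode x))" if "x \<in> topspace (nsphere n)" "x n = 0" for x
    using \<Phi>(2)[of x] \<Phi>(2)[of "antipode x"] that by simp
  have "(\<forall>z\<in>topspace ?E. \<Phi> z = \<Phi> (antipode z)) \<or> (\<forall>z\<in>topspace ?E. \<Phi> z = antipode (\<Phi> (antipode z)))"
  proof (rule RP_lift_unique)
    show "connected_space ?E"
      by (intro contractible_imp_connected_space contractible_space_upper_hemisphere order_refl)
    show "continuous_map ?E (nsphere n) \<Phi>" "continuous_map ?E (nsphere n) (\<lambda>x. \<Phi> (antipode x))"
      using continuous_map_compose[OF Eq(1) \<Phi>(1)] continuous_map_compose[OF Eq(2) \<Phi>(1)] by (simp_all add: o_def)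
    show "antipodal_pair (\<Phi> z) = antipodal_pair (\<Phi> (antipode z))" if "z \<in> topspace ?E" for z
      by (rule q1) (use En[of z] that in simp_all)
  qed
  then have "\<exists>A. (A = id \<or> A = antipode) \<and> (\<forall>z\<in>topspace ?E. \<Phi> z = A (\<Phi> (antipode z)))"
  proof (elim disjE)
    assume "\<forall>z\<in>topspace ?E. \<Phi> z = \<Phi> (antipode z)"
    then have "\<forall>z\<in>topspace ?E. \<Phi> z = id (\<Phi> (antipode z))" unfolding id_apply .
    then show ?thesis by (intro exI[of _ id] conjI disjI1 refl)
  next
    assume "\<forall>z\<in>topspace ?E. \<Phi> z = antipode (\<Phi> (antipode z))"
    then show ?thesis by (intro exI[of _ antipode] conjI disjI2 refl)
  qed
  then obtain A where A: "A = id \<or> A = antipode" "\<forall>z\<in>topspace ?E. \<Phi> z = A (\<Phi> (antipode z))" by (elim exE conjE)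
  have AA: "A (A x) = x" for x using A(1) by auto
  have Aq: "antipodal_pair (A x) = antipodal_pair x" "A (antipode x) = antipode (A x)" for x using A(1) by auto
  have \<Phi>A: "\<Phi> (antipode x) = A (\<Phi> x)" if x: "x \<in> topspace (nsphere n)" "x n = 0" for x
  proof (cases "x (n - 1) \<ge> 0")
    case True
    then have "x \<in> topspace ?E" using x En[of x] by simp
    with A(2) have "\<Phi> x = A (\<Phi> (antipode x))" by (rule bspec)
    then show ?thesis by (simp add: AA)
  next
    case False
    then have "antipode x \<in> topspace ?E" using x En[of x] by simp
    with A(2) have "\<Phi> (antipode x) = A (\<Phi> (antipode (antipode x)))" by (rule bspec)
    then show ?thesis by simp
  qed
  \<comment> \<open>\<open>hemisphere_extension\<close> speaks of families, so \<open>\<Phi>\<close>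
    enters as a constant family and \<open>F\<close> is the slice at time 0.\<close>
  have c: "continuous_map (prod_topology unit_interval ?D) (nsphere n) (\<lambda>p. \<Phi> (snd p))"
    using continuous_map_compose[OF continuous_map_snd \<Phi>(1)] by (simp add: o_def)
  have "\<exists>\<psi>. continuous_map (prod_topology unit_interval (nsphere n)) (nsphere n) \<psi> \<and>
    (\<forall>t\<in>topspace unit_interval. \<forall>x\<in>topspace (nsphere n). 0 \<le> x n \<longrightarrow> \<psi> (t, x) = \<Phi> (snd (t, x))) \<and>
    (\<forall>t\<in>topspace unit_interval. \<forall>x\<in>topspace (nsphere n). \<psi> (t, antipode x) = A (\<psi> (t, x)))"
    by (rule hemisphere_extension[OF A(1) c]) (simp add: \<Phi>A)
  then obtain \<psi> where \<psi>: "continuous_map (prod_topology unit_interval (nsphere n)) (nsphere n) \<psi>"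
    "\<forall>t\<in>topspace unit_interval. \<forall>x\<in>topspace (nsphere n). 0 \<le> x n \<longrightarrow> \<psi> (t, x) = \<Phi> (snd (t, x))"
    "\<forall>t\<in>topspace unit_interval. \<forall>x\<in>topspace (nsphere n). \<psi> (t, antipode x) = A (\<psi> (t, x))"
    by (elim exE conjE)
  define F where "F = (\<lambda>x. \<psi> (0, x))"
  have F: "continuous_map (nsphere n) (nsphere n) F"
    using continuous_map_o_Pair[OF \<psi>(1), of 0] by (simp add: o_def F_def)
  have FA: "F (antipode x) = A (F x)" if "x \<in> topspace (nsphere n)" for x
    using \<psi>(3) that by (simp add: F_def)
  have FU: "F x = \<Phi> x" if "x \<in> topspace (nsphere n)" "0 \<le> x n" for x
    using \<psi>(2) that by (simp add: F_def)
  have Fq: "antipodal_pair (F x) = f (antipodal_pair x)" if x: "x \<in> topspace (nsphere n)" for x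
  proof (cases "0 \<le> x n")
    case True then show ?thesis using FU[OF x] \<Phi>(2)[of x] x by simp
  next
    case False
    then have "antipodal_pair (F (antipode x)) = f (antipodal_pair x)" using FU[of "antipode x"] \<Phi>(2)[of "antipode x"] x by simp
    then show ?thesis using FA[OF x] Aq(1) by simp
  qed
  have "antipodal_pair (F P) = antipodal_pair y" using Fq[OF P] y(2) by simp
  then have "F P = y \<or> antipode (F P) = y" by (auto simp: antipodal_pair_eq_iff)
  then show ?thesis
  proof
    assume "F P = y"
    then show ?thesis using A(1) F FA Fq by (intro exI[of _ F] exI[of _ A]) simp
  next
    assume "antipode (F P) = y"
    then show ?thesis using A(1) continuous_map_antipode[OF F] FA Fq Aq
      by (intro exI[of _ "\<lambda>x. antipode (F x)"] exI[of _ A]) simp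
  qed
qed

section \<open>Congruence rules, the standard base point and lifts of spheroids\<close>

lemma continuous_map_compose_pair:
  "continuous_map (prod_topology A B) Y h \<Longrightarrow> continuous_map S A c \<Longrightarrow> continuous_map S B g
     \<Longrightarrow> continuous_map S Y (\<lambda>p. h (c p, g p))"
  using continuous_map_compose[OF continuous_map_pairedI, of S A c B g Y h] by (simp add: o_def)

lemma continuous_map_fst_real: "continuous_map (prod_topology unit_interval X) euclideanreal fst"
  using continuous_map_fst continuous_map_in_subtopology by blast

lemma spheroid_homotopic_cong:
  assumes "spheroid_homotopic i X x0 a b"
    and "\<And>s. s \<in> topspace (cube i) \<Longrightarrow> a s = a' s" "\<And>s. s \<in> topspace (cube i) \<Longrightarrow> b s = b' s"
  shows "spheroid_homotopic i X x0 a' b'"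
  using assms unfolding spheroid_homotopic_alt by simp

lemma based_homotopic_cong:
  assumes "based_homotopic X x0 Y y0 f g" "x0 \<in> topspace X"
    and "\<And>x. x \<in> topspace X \<Longrightarrow> f x = f' x" "\<And>x. x \<in> topspace X \<Longrightarrow> g x = g' x"
  shows "based_homotopic X x0 Y y0 f' g'"
  using assms unfolding based_homotopic_alt[OF assms(2)] by simp

text \<open>The first coordinate vector lies on the spheres of all dimensions, and on the equator of
  each one of positive dimension, so a single base point serves the induction over equators.\<close>

definition base_vector :: "nat \<Rightarrow> real" where
  "base_vector = (\<lambda>i. if i = 0 then 1 else 0)"

lemma base_vector_in [simp]: "base_vector \<in> topspace (nsphere n)"
  unfolding base_vector_def by (rule in_topspace_nsphere)

lemma base_vector_neq_antipode [simp]: "antipode base_vector \<noteq> base_vector" "base_vector \<noteq> antipode base_vector"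
  by (auto simp: base_vector_def fun_eq_iff)

abbreviation origin :: "nat \<Rightarrow> real" where "origin \<equiv> \<lambda>i. 0"

lemma origin_in: "origin \<in> topspace (cube i)" "i \<ge> 1 \<Longrightarrow> origin \<in> cube_boundary i"
  by (auto simp: topspace_cube cube_boundary_def intro!: exI[of _ 0])

text \<open>The sign on the boundary stays open: for \<open>i = 1\<close> the lift of a
  noncontractible loop ends at the antipode of its starting point.\<close>

lemma RP_spheroid_lift:
  assumes i: "i \<ge> 1" and a: "spheroid i (real_projective_space n) (antipodal_pair P) a" and P: "P \<in> topspace (nsphere n)"
  shows "\<exists>b. continuous_map (cube i) (nsphere n) b \<and> (\<forall>s\<in>topspace (cube i). antipodal_pair (b s) = a s) \<and> b origin = P
     \<and> (\<forall>s\<in>cube_boundary i. b s = P \<or> b s = antipode P)"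
proof -
  have a0: "a s = antipodal_pair P" if "s \<in> cube_boundary i" for s
    using a that unfolding spheroid_def by blast
  have ac: "continuous_map (cube i) (real_projective_space n) a" using a unfolding spheroid_def by blast
  obtain b where b: "continuous_map (cube i) (nsphere n) b"
    "\<And>z. z \<in> topspace (cube i) \<Longrightarrow> antipodal_pair (b z) = a z" "b origin = P"
  proof (rule RP_lift_contractible[where Z = "cube i" and \<phi> = a and ?z0.0 = origin and y = P and n = n])
    show "a origin = antipodal_pair P" by (rule a0[OF origin_in(2)[OF i]])
  qed (use ac P origin_in contractible_space_cube compact_space_cube in simp_all)
  have "b s = P \<or> b s = antipode P" if s: "s \<in> cube_boundary i" for s
  proof -
    have "antipodal_pair (b s) = antipodal_pair P" using b(2)[of s] s a0[OF s] cube_boundary_subset by auto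
    then show ?thesis by (simp only: antipodal_pair_eq_iff)
  qed
  then show ?thesis using b by (intro exI[of _ b]) simp
qed

lemma continuous_lift_unique_at:
  assumes "connected_space Z" "continuous_map Z (nsphere n) f" "continuous_map Z (nsphere n) g"
    and "\<And>z. z \<in> topspace Z \<Longrightarrow> antipodal_pair (f z) = antipodal_pair (g z)"
    and "z0 \<in> topspace Z" "f z0 = g z0" "z \<in> topspace Z"
  shows "f z = g z"
proof -
  have "f z0 \<noteq> antipode (g z0)"
    using nsphere_dot_ge(2)[of "g z0" n "g z0"] continuous_map_nsphere_in[OF assms(3,5)] assms(6)
    by (auto simp: topspace_nsphere)
  then show ?thesis
    using RP_lift_unique[OF assms(1-4)] assms(5,7) by blast
qed

section \<open>Surjectivity on homotopy groups, upstairs\<close>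

text \<open>The first half of \<open>induces_iso_iff\<close>.\<close>

abbreviation surjective_on_homotopy :: "nat \<Rightarrow> 'a topology \<Rightarrow> 'a \<Rightarrow> ('a \<Rightarrow> 'a) \<Rightarrow> bool" where
  "surjective_on_homotopy i X x0 f \<equiv>
     \<forall>b. spheroid i X x0 b \<longrightarrow> (\<exists>a. spheroid i X x0 a \<and> spheroid_homotopic i X x0 (f \<circ> a) b)"

text \<open>If the lift \<open>F\<close> were even, it would send both lifts of the base point to
  \<open>base_vector\<close>. Then the image under \<open>f\<close> of any loop would lift to a
  closed path, whereas the projection of half a great circle is a loop whose lift is not closed, and
  it could not be reached.\<close>

lemma RP_odd_lift:
  assumes n: "n \<ge> 1" and f: "continuous_map (real_projective_space n) (real_projective_space n) f"
    and f0: "f (antipodal_pair base_vector) = antipodal_pair base_vector"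
    and surj: "surjective_on_homotopy 1 (real_projective_space n) (antipodal_pair base_vector) f"
  shows "\<exists>F. continuous_map (nsphere n) (nsphere n) F \<and> F base_vector = base_vector \<and>
     (\<forall>x\<in>topspace (nsphere n). antipodal_pair (F x) = f (antipodal_pair x) \<and> F (antipode x) = antipode (F x))"
proof -
  let ?p = "antipodal_pair base_vector"
  obtain F A where A: "A = id \<or> A = antipode" and F: "continuous_map (nsphere n) (nsphere n) F" "F base_vector = base_vector"
    and Fx: "\<forall>x\<in>topspace (nsphere n). antipodal_pair (F x) = f (antipodal_pair x) \<and> F (antipode x) = A (F x)"
    using RP_map_lift[OF n f base_vector_in base_vector_in f0] by (elim exE conjE)
  have "A \<noteq> id"
  proof
    assume "A = id"
    \<comment> \<open>Half a great circle from \<open>base_vector\<close> to its antipode; it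
      becomes a loop in projective space.\<close>
    define c where "c \<equiv> \<lambda>s :: nat \<Rightarrow> real. \<lambda>i :: nat. if i = 0 then cos (pi * s 0) else if i = 1 then sin (pi * s 0) else (0::real)"
    let ?one = "\<lambda>i :: nat. if i = 0 then 1 else (0::real)"
    have dc: "dot n (c s) (c s) = 1" for s
    proof -
      have "dot n (c s) (c s) = (\<Sum>i\<in>{0, 1}. c s i * c s i)"
        unfolding dot_def by (rule sum.mono_neutral_right) (use n in \<open>auto simp: c_def\<close>)
      then show ?thesis by (simp add: c_def power2_eq_square[symmetric])
    qed
    have cS: "c s \<in> topspace (nsphere n)" for s
      using dc n by (auto simp: topspace_nsphere c_def)
    have "continuous_map (cube 1) euclideanreal (\<lambda>s. c s k)" for k
    proof -
      have lin: "continuous_map (cube 1) euclideanreal (\<lambda>s. pi * s 0)"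
        by (intro continuous_map_real_mult continuous_map_cube_projection) auto
      have cs: "continuous_map euclideanreal euclideanreal cos" "continuous_map euclideanreal euclideanreal sin"
        by (auto intro: continuous_intros)
      have "continuous_map (cube 1) euclideanreal (\<lambda>s. cos (pi * s 0))"
         "continuous_map (cube 1) euclideanreal (\<lambda>s. sin (pi * s 0))"
        using continuous_map_compose[OF lin cs(1)] continuous_map_compose[OF lin cs(2)] by (simp_all add: o_def)
      then show ?thesis by (cases "k = 0"; cases "k = 1") (simp_all add: c_def)
    qed
    then have cc: "continuous_map (cube 1) (nsphere n) c"
      unfolding continuous_map_into_nsphere using cS by simp
    have c0: "c origin = base_vector" "c ?one = antipode base_vector"
      by (auto simp: c_def base_vector_def fun_eq_iff)
    have bd1: "s = origin \<or> s = ?one" if s: "s \<in> cube_boundary 1" for s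
    proof -
      have "s i = 0" if "i \<ge> 1" for i using s that by (auto simp: cube_boundary_def topspace_cube)
      moreover have "s 0 = 0 \<or> s 0 = 1" using s by (auto simp: cube_boundary_def)
      ultimately show ?thesis by (auto simp: fun_eq_iff) (metis One_nat_def Suc_leI gr0I)+
    qed
    have one_in: "?one \<in> cube_boundary 1" by (auto simp: cube_boundary_def topspace_cube)
    have "spheroid 1 (real_projective_space n) ?p (antipodal_pair \<circ> c)"
      unfolding spheroid_def
    proof
      show "continuous_map (cube 1) (real_projective_space n) (antipodal_pair \<circ> c)"
        by (rule continuous_map_compose[OF cc continuous_map_RP])
      show "(antipodal_pair \<circ> c) ` cube_boundary 1 \<subseteq> {?p}"
        using bd1 c0 by fastforce
    qed
    then obtain a where a: "spheroid 1 (real_projective_space n) ?p a"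
      "spheroid_homotopic 1 (real_projective_space n) ?p (f \<circ> a) (antipodal_pair \<circ> c)"
      using surj by blast
    obtain b where b: "continuous_map (cube 1) (nsphere n) b" "\<forall>s\<in>topspace (cube 1). antipodal_pair (b s) = a s"
       "b origin = base_vector" "\<forall>s\<in>cube_boundary 1. b s = base_vector \<or> b s = antipode base_vector"
      using RP_spheroid_lift[OF order_refl a(1) base_vector_in] by (elim exE conjE)
    have bS: "b s \<in> topspace (nsphere n)" if "s \<in> topspace (cube 1)" for s using continuous_map_nsphere_in[OF b(1) that] .
    have "spheroid_homotopic 1 (real_projective_space n) ?p (antipodal_pair \<circ> (F \<circ> b)) (antipodal_pair \<circ> c)"
      by (rule spheroid_homotopic_cong[OF a(2)]) (use Fx b(2) bS in auto)
    then obtain K where K: "continuous_map (prod_topology unit_interval (cube 1)) (nsphere n) K"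
      "\<And>s. s \<in> topspace (cube 1) \<Longrightarrow> antipodal_pair (K (1, s)) = (antipodal_pair \<circ> c) s"
      "\<And>t s. t \<in> {0..1} \<Longrightarrow> s \<in> cube_boundary 1 \<Longrightarrow> K (t, s) = (F \<circ> b) s"
      by (rule RP_spheroid_homotopy_lift[OF continuous_map_compose[OF b(1) F(1)]]) (rule that)
    have K1: "continuous_map (cube 1) (nsphere n) (\<lambda>s. K (1, s))"
      using continuous_map_o_Pair[OF K(1), of 1] by (simp add: o_def)
    \<comment> \<open>\<open>K\<close> keeps the endpoints of \<open>F \<circ> b\<close>, and its
      end stage is the lift of the projected half circle that starts at \<open>base_vector\<close>,
      hence is \<open>c\<close>. So \<open>c\<close> would end where \<open>F \<circ> b\<close>
      ends.\<close>
    have "K (1, ?one) = c ?one"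
    proof (rule continuous_lift_unique_at[OF connected_space_cube K1 cc _ origin_in(1)])
      show "antipodal_pair (K (1, z)) = antipodal_pair (c z)" if "z \<in> topspace (cube 1)" for z using K(2)[OF that] by simp
      show "K (1, origin) = c origin" using K(3)[of 1 origin] origin_in(2)[of 1] b(3) F(2) c0(1) by simp
      show "?one \<in> topspace (cube 1)" using one_in cube_boundary_subset by blast
    qed
    moreover have "K (1, ?one) = F (b ?one)" using K(3)[of 1, OF _ one_in] by simp
    moreover have "F (b ?one) = base_vector"
      using b(4) one_in Fx F(2) \<open>A = id\<close> base_vector_in[of n] by auto
    ultimately show False using c0(2) by simp
  qed
  then show ?thesis using A F Fx by (intro exI[of _ F]) simp
qed

text \<open>Lift a preimage \<open>a'\<close> of the projected spheroid and the homotopy. What has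
  to be excluded is that the lift of \<open>a'\<close> takes the antipodal value somewhere on the
  boundary, as it might for \<open>n = 1\<close>.\<close>

lemma sphere_surjective_on_homotopy:
  assumes n: "n \<ge> 1" and F: "continuous_map (nsphere n) (nsphere n) F" "F base_vector = base_vector"
    and Fx: "\<forall>x\<in>topspace (nsphere n). antipodal_pair (F x) = f (antipodal_pair x) \<and> F (antipode x) = antipode (F x)"
    and surj: "surjective_on_homotopy n (real_projective_space n) (antipodal_pair base_vector) f"
  shows "surjective_on_homotopy n (nsphere n) base_vector F"
proof (intro allI impI)
  let ?p = "antipodal_pair base_vector"
  fix b assume b: "spheroid n (nsphere n) base_vector b"
  then have bc: "continuous_map (cube n) (nsphere n) b" and b0: "\<And>s. s \<in> cube_boundary n \<Longrightarrow> b s = base_vector"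
    unfolding spheroid_def by blast+
  have "spheroid n (real_projective_space n) ?p (antipodal_pair \<circ> b)"
    unfolding spheroid_def using continuous_map_compose[OF bc continuous_map_RP] b0 by auto
  then obtain a' where a': "spheroid n (real_projective_space n) ?p a'"
    "spheroid_homotopic n (real_projective_space n) ?p (f \<circ> a') (antipodal_pair \<circ> b)"
    using surj by blast
  obtain a where a: "continuous_map (cube n) (nsphere n) a" "\<forall>s\<in>topspace (cube n). antipodal_pair (a s) = a' s"
     "a origin = base_vector" "\<forall>s\<in>cube_boundary n. a s = base_vector \<or> a s = antipode base_vector"
    using RP_spheroid_lift[OF n a'(1) base_vector_in] by (elim exE conjE)
  obtain K where K: "continuous_map (prod_topology unit_interval (cube n)) (nsphere n) K"
    "\<And>s. s \<in> topspace (cube n) \<Longrightarrow> K (0, s) = b s"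
    "\<And>s. s \<in> topspace (cube n) \<Longrightarrow> antipodal_pair (K (1, s)) = (f \<circ> a') s"
    "\<And>t s. t \<in> {0..1} \<Longrightarrow> s \<in> cube_boundary n \<Longrightarrow> K (t, s) = b s"
    by (rule RP_spheroid_homotopy_lift[OF bc spheroid_homotopic_sym[OF a'(2)]]) (rule that)
  have K1: "continuous_map (cube n) (nsphere n) (\<lambda>s. K (1, s))"
    using continuous_map_o_Pair[OF K(1), of 1] by (simp add: o_def)
  have Fa: "continuous_map (cube n) (nsphere n) (\<lambda>s. F (a s))"
    using continuous_map_compose[OF a(1) F(1)] by (simp add: o_def)
  have KF: "K (1, s) = F (a s)" if s: "s \<in> topspace (cube n)" for s
  proof (rule continuous_lift_unique_at[OF connected_space_cube K1 Fa _ origin_in(1) _ s])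
    show "antipodal_pair (K (1, z)) = antipodal_pair (F (a z))" if "z \<in> topspace (cube n)" for z
      using K(3)[OF that] a(2) that Fx continuous_map_nsphere_in[OF a(1) that] by simp
    show "K (1, origin) = F (a origin)" using K(4)[of 1 origin] origin_in(2)[OF n] b0 a(3) F(2) by simp
  qed
  have a0: "a s = base_vector" if s: "s \<in> cube_boundary n" for s
  proof -
    have "s \<in> topspace (cube n)" using s cube_boundary_subset by blast
    then have "F (a s) = base_vector" using KF[of s] K(4)[of 1 s] s b0[OF s] by simp
    \<comment> \<open>\<open>F\<close> is odd, so the value \<open>antipode base_vector\<close> of
      \<open>a\<close> would be sent to the wrong point.\<close>
    moreover have "F (antipode base_vector) = antipode base_vector"
      using Fx F(2) base_vector_in[of n] by auto
    ultimately show ?thesis using a(4) s by auto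
  qed
  have "spheroid n (nsphere n) base_vector a" unfolding spheroid_def using a(1) a0 by auto
  moreover have "spheroid_homotopic n (nsphere n) base_vector b (F \<circ> a)"
    unfolding spheroid_homotopic_alt using K KF b0 by (intro exI[of _ K]) simp
  ultimately show "\<exists>a. spheroid n (nsphere n) base_vector a \<and> spheroid_homotopic n (nsphere n) base_vector (F \<circ> a) b"
    by (intro exI[of _ a] conjI spheroid_homotopic_sym[of n "nsphere n" base_vector b])
qed

section \<open>Odd homotopies below the top cell\<close>

lemma nsphere_0: "x \<in> topspace (nsphere 0) \<Longrightarrow> x = base_vector \<or> x = antipode base_vector"
proof -
  assume x: "x \<in> topspace (nsphere 0)"
  then have "x 0 * x 0 = 1" and z: "\<forall>i>0. x i = 0" by (simp_all add: topspace_nsphere dot_def)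
  then have "x 0 = 1 \<or> x 0 = -1" by (simp add: square_eq_1_iff)
  then show ?thesis
    using z by (auto simp: base_vector_def fun_eq_iff)
qed

text \<open>Induction over the equatorial spheres. A homotopy on the \<open>k\<close>-sphere
  prescribes the boundary track on the upper hemisphere of the next sphere; it extends over that
  cell because its dimension is below \<open>n\<close>, and it is reflected to the lower one. The
  start is trivial: the 0-sphere consists of the base point and its antipode, both fixed by
  \<open>F\<close>.\<close>

lemma odd_homotopy_to_inclusion:
  assumes F: "continuous_map (nsphere n) (nsphere n) F" "F base_vector = base_vector"
    and odd: "\<And>x. x \<in> topspace (nsphere n) \<Longrightarrow> F (antipode x) = antipode (F x)"
  shows "k < n \<Longrightarrow> \<exists>H. continuous_map (prod_topology unit_interval (nsphere k)) (nsphere n) H \<and>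
     (\<forall>x\<in>topspace (nsphere k). H (0, x) = F x \<and> H (1, x) = x) \<and>
     (\<forall>t\<in>{0..1}. \<forall>x\<in>topspace (nsphere k). H (t, antipode x) = antipode (H (t, x))) \<and>
     (\<forall>t\<in>{0..1}. H (t, base_vector) = base_vector)"
proof (induction k)
  case 0
  have "F x = x" if "x \<in> topspace (nsphere 0)" for x
    using nsphere_0[OF that] F(2) odd base_vector_in[of n] by auto
  moreover have "continuous_map (prod_topology unit_interval (nsphere 0)) (nsphere n) snd"
    by (rule continuous_map_nsphere_mono[OF _ continuous_map_snd]) simp
  ultimately show ?case by (intro exI[of _ snd]) simp
next
  case (Suc k)
  let ?j = "Suc k" and ?\<eta> = "hemisphere_to_cube (Suc k)" and ?\<theta> = "cube_to_hemisphere (Suc k)"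
  have j: "?j < n" "k < n" using Suc.prems by auto
  obtain H where H: "continuous_map (prod_topology unit_interval (nsphere k)) (nsphere n) H"
     "\<forall>x\<in>topspace (nsphere k). H (0, x) = F x \<and> H (1, x) = x"
     "\<forall>t\<in>{0..1}. \<forall>x\<in>topspace (nsphere k). H (t, antipode x) = antipode (H (t, x))"
     "\<forall>t\<in>{0..1}. H (t, base_vector) = base_vector"
    using Suc.IH[OF j(2)] by (elim exE conjE)
  have \<theta>j: "continuous_map (cube ?j) (nsphere ?j) ?\<theta>"
    using continuous_map_cube_to_hemisphere[of ?j] by (simp add: continuous_map_in_subtopology)
  have \<theta>: "continuous_map (cube ?j) (nsphere n) ?\<theta>"
    by (rule continuous_map_nsphere_mono[OF _ \<theta>j]) (use j in simp)
  have F\<theta>: "continuous_map (cube ?j) (nsphere n) (\<lambda>s. F (?\<theta> s))"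
    using continuous_map_compose[OF \<theta> F(1)] by (simp add: o_def)
  have \<theta>E: "?\<theta> s \<in> topspace (nsphere k)" if "s \<in> cube_boundary ?j" for s
    unfolding topspace_nsphere_Suc[of "?\<theta> s" k]
    using cube_to_hemisphere_in(1)[of s ?j] cube_to_hemisphere_boundary[OF that] that cube_boundary_subset by blast
  have \<theta>b: "continuous_map (bcube ?j) (nsphere k) ?\<theta>"
    unfolding continuous_map_into_nsphere
    using continuous_map_nsphere_component[OF continuous_map_from_subtopology[OF \<theta>]] \<theta>E by simp
  have h: "continuous_map (prod_topology unit_interval (bcube ?j)) (nsphere n) (\<lambda>p. H (fst p, ?\<theta> (snd p)))"
    by (rule continuous_map_compose_pair[OF H(1) continuous_map_fst])
       (use continuous_map_compose[OF continuous_map_snd \<theta>b] in \<open>simp add: o_def\<close>)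
  obtain K where K: "continuous_map (prod_topology unit_interval (cube ?j)) (nsphere n) K"
    "\<And>s. s \<in> topspace (cube ?j) \<Longrightarrow> K (0, s) = F (?\<theta> s)" "\<And>s. s \<in> topspace (cube ?j) \<Longrightarrow> K (1, s) = ?\<theta> s"
    "\<And>t s. t \<in> {0..1} \<Longrightarrow> s \<in> cube_boundary ?j \<Longrightarrow> K (t, s) = H (fst (t, s), ?\<theta> (snd (t, s)))"
    by (rule sphere_homotopy_rel_boundary[OF j(1) F\<theta> \<theta> h]) (use H(2) \<theta>E in simp, use H(2) \<theta>E in simp, rule that)
  have \<eta>: "?\<eta> x \<in> topspace (cube ?j)" "?\<theta> (?\<eta> x) = x" if "x \<in> topspace (nsphere ?j)" "0 \<le> x ?j" for x
    using hemisphere_to_cube_in[OF that(1)] cube_to_hemisphere_inverse[OF that] by auto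
  define \<phi> where "\<phi> \<equiv> \<lambda>p. K (fst p, ?\<eta> (snd p))"
  have \<phi>: "continuous_map (prod_topology unit_interval (upper_hemisphere ?j)) (nsphere n) \<phi>"
    unfolding \<phi>_def
    by (rule continuous_map_compose_pair[OF K(1) continuous_map_fst])
       (use continuous_map_compose[OF continuous_map_snd continuous_map_from_subtopology[OF continuous_map_hemisphere_to_cube]]
        in \<open>simp add: o_def\<close>)
  have E: "\<phi> (t, x) = H (t, x)" if "t \<in> {0..1}" "x \<in> topspace (nsphere ?j)" "x ?j = 0" for t x
    using K(4)[OF that(1) hemisphere_to_cube_boundary[OF _ that(2,3)]] \<eta>(2)[of x] that by (simp add: \<phi>_def)
  have "\<exists>\<psi>. continuous_map (prod_topology unit_interval (nsphere ?j)) (nsphere n) \<psi> \<and>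
    (\<forall>t\<in>topspace unit_interval. \<forall>x\<in>topspace (nsphere ?j). 0 \<le> x ?j \<longrightarrow> \<psi> (t, x) = \<phi> (t, x)) \<and>
    (\<forall>t\<in>topspace unit_interval. \<forall>x\<in>topspace (nsphere ?j). \<psi> (t, antipode x) = antipode (\<psi> (t, x)))"
  proof (rule hemisphere_extension[where A = antipode, OF disjI2[OF refl] \<phi>])
    fix t x assume tx: "t \<in> topspace unit_interval" "x \<in> topspace (nsphere ?j)" "x ?j = 0"
    then have "x \<in> topspace (nsphere k)" by (simp add: topspace_nsphere_Suc[of x k])
    then show "\<phi> (t, antipode x) = antipode (\<phi> (t, x))"
      using E[of t x] E[of t "antipode x"] tx H(3) by simp
  qed
  then obtain \<psi> where \<psi>: "continuous_map (prod_topology unit_interval (nsphere ?j)) (nsphere n) \<psi>"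
    "\<And>t x. t \<in> {0..1} \<Longrightarrow> x \<in> topspace (nsphere ?j) \<Longrightarrow> 0 \<le> x ?j \<Longrightarrow> \<psi> (t, x) = \<phi> (t, x)"
    "\<And>t x. t \<in> {0..1} \<Longrightarrow> x \<in> topspace (nsphere ?j) \<Longrightarrow> \<psi> (t, antipode x) = antipode (\<psi> (t, x))"
    by auto
  have up: "\<psi> (0, x) = F x \<and> \<psi> (1, x) = x" if "x \<in> topspace (nsphere ?j)" "0 \<le> x ?j" for x
    using \<psi>(2)[of _ x] that \<eta>[OF that] K(2,3) by (simp add: \<phi>_def)
  have ends: "\<psi> (0, x) = F x \<and> \<psi> (1, x) = x" if x: "x \<in> topspace (nsphere ?j)" for x
  proof (cases "0 \<le> x ?j")
    case False
    then have "\<psi> (0, antipode x) = F (antipode x) \<and> \<psi> (1, antipode x) = antipode x" using up[of "antipode x"] x by simp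
    moreover have "x \<in> topspace (nsphere n)" by (rule nsphere_mono[OF _ x]) (use j in simp)
    ultimately have "antipode (\<psi> (0, x)) = antipode (F x) \<and> antipode (\<psi> (1, x)) = antipode x"
      using \<psi>(3)[of 0 x] \<psi>(3)[of 1 x] x odd[of x] by simp
    then show ?thesis by (metis antipode_antipode)
  qed (use up x in blast)
  \<comment> \<open>The base point is on the equator, where the new homotopy agrees with the old
    one.\<close>
  have "\<psi> (t, base_vector) = base_vector" if "t \<in> {0..1}" for t
  proof -
    have "base_vector ?j = 0" by (simp add: base_vector_def)
    then show ?thesis
      using \<psi>(2)[OF that, of base_vector] E[OF that, of base_vector] H(4) that by simp
  qed
  then show ?case
    by (intro exI[of _ \<psi>] conjI ballI \<psi>(1,3) ends[THEN conjunct1] ends[THEN conjunct2])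
qed

section \<open>The top cell\<close>

text \<open>Homotopy extension for the pair \<open>(I\<^sup>i \<times> I, \<partial>(I\<^sup>i \<times> I))\<close>.\<close>

lemma homotopy_change_track:
  assumes i: "i \<ge> 1" and M: "continuous_map (prod_topology unit_interval (cube i)) Y M"
    and \<tau>: "continuous_map (prod_topology unit_interval (prod_topology unit_interval (bcube i))) Y \<tau>"
    and \<tau>0: "\<And>t s. t \<in> {0..1} \<Longrightarrow> s \<in> cube_boundary i \<Longrightarrow> \<tau> (0, t, s) = M (t, s)"
    and \<tau>e: "\<And>r s. r \<in> {0..1} \<Longrightarrow> s \<in> cube_boundary i \<Longrightarrow> \<tau> (r, 0, s) = M (0, s) \<and> \<tau> (r, 1, s) = M (1, s)"
  shows "\<exists>M'. continuous_map (prod_topology unit_interval (cube i)) Y M' \<and>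
    (\<forall>s\<in>topspace (cube i). M' (0, s) = M (0, s) \<and> M' (1, s) = M (1, s)) \<and>
    (\<forall>t\<in>{0..1}. \<forall>s\<in>cube_boundary i. M' (t, s) = \<tau> (1, t, s))"
proof -
  let ?p = "\<lambda>u. u(i := (0::real))"
  have rp: "radius i (?p u) = radius i u" for u by (rule radius_cong) simp
  have cubeS: "u i \<in> {0..1} \<and> ?p u \<in> topspace (cube i)" if "u \<in> topspace (cube (Suc i))" for u
    using that by (auto simp: topspace_cube)
  have pc: "continuous_map (cube (Suc i)) euclideanreal (\<lambda>u. ?p u k)" for k
    by (cases "k = i") (auto simp: continuous_map_cube_projection)
  have last: "continuous_map (cube (Suc i)) unit_interval (\<lambda>u. u i)"
    unfolding continuous_map_into_unit_interval using continuous_map_cube_projection cubeS by auto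
  have p: "continuous_map (cube (Suc i)) (cube i) ?p"
    unfolding continuous_map_into_cube using pc cubeS by simp
  have v: "continuous_map (cube (Suc i)) Y (\<lambda>u. M (u i, ?p u))"
    by (rule continuous_map_compose_pair[OF M last p])
  let ?B = "prod_topology unit_interval (bcube (Suc i))"
  have bd: "max (radius i u) \<bar>2 * u i - 1\<bar> = 1" "\<forall>j\<ge>Suc i. u j = 0" if "u \<in> cube_boundary (Suc i)" for u
    using that in_cube_boundary_iff_radius[of "Suc i" u] by auto
  have in_bd: "?p u \<in> cube_boundary i" if "u \<in> cube_boundary (Suc i)" "radius i u = 1" for u
    using that i rp[of u] bd(2)[OF that(1)] by (auto simp: in_cube_boundary_iff_radius Suc_le_eq)
  have bc: "continuous_map ?B (cube (Suc i)) snd"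
    using continuous_map_snd[of unit_interval "bcube (Suc i)"] by (simp add: continuous_map_in_subtopology)
  \<comment> \<open>The prism is read as a cube of dimension \<open>Suc i\<close> with time as
    coordinate \<open>i\<close>. Bottom and top stand still while the sides move along
    \<open>\<tau>\<close>; the end of the extended motion is the required homotopy.\<close>
  define h where "h \<equiv> \<lambda>q. if radius i (snd q) \<le> \<bar>2 * snd q i - 1\<bar> then M (snd q i, ?p (snd q)) else \<tau> (fst q, snd q i, ?p (snd q))"
  have "continuous_map ?B Y h"
    unfolding h_def
  proof (rule continuous_map_cases_le)
    show "continuous_map ?B euclideanreal (\<lambda>q. radius i (snd q))"
      by (intro continuous_map_radius continuous_map_cube_component[OF bc])
    show "continuous_map ?B euclideanreal (\<lambda>q. \<bar>2 * snd q i - 1\<bar>)"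
      by (intro continuous_map_real_abs continuous_map_diff continuous_map_real_mult continuous_map_cube_component[OF bc]) auto
    show "continuous_map (subtopology ?B {q \<in> topspace ?B. radius i (snd q) \<le> \<bar>2 * snd q i - 1\<bar>}) Y (\<lambda>q. M (snd q i, ?p (snd q)))"
      using continuous_map_from_subtopology[OF continuous_map_compose[OF bc v]] by (simp add: o_def)
    let ?T = "subtopology ?B {q \<in> topspace ?B. \<bar>2 * snd q i - 1\<bar> \<le> radius i (snd q)}"
    have Tb: "?p (snd q) \<in> cube_boundary i" if "q \<in> topspace ?T" for q
    proof -
      have "snd q \<in> cube_boundary (Suc i)" "\<bar>2 * snd q i - 1\<bar> \<le> radius i (snd q)" using that by auto
      then show ?thesis using bd(1)[of "snd q"] in_bd by auto
    qed
    have "continuous_map ?T (prod_topology unit_interval (bcube i)) (\<lambda>q. (snd q i, ?p (snd q)))"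
    proof (rule continuous_map_pairedI)
      show "continuous_map ?T unit_interval (\<lambda>q. snd q i)"
        using continuous_map_from_subtopology[OF continuous_map_compose[OF bc last]] by (simp add: o_def)
      show "continuous_map ?T (bcube i) (\<lambda>q. ?p (snd q))"
        using continuous_map_from_subtopology[OF continuous_map_compose[OF bc p]] Tb
        by (auto simp: o_def continuous_map_in_subtopology)
    qed
    then show "continuous_map ?T Y (\<lambda>q. \<tau> (fst q, snd q i, ?p (snd q)))"
      by (rule continuous_map_compose_pair[OF \<tau>, rotated])
         (intro continuous_map_from_subtopology continuous_map_fst)
    fix q assume q: "q \<in> topspace ?B" and e: "radius i (snd q) = \<bar>2 * snd q i - 1\<bar>"
    have u: "snd q \<in> cube_boundary (Suc i)" and r: "fst q \<in> {0..1}" using q by (auto simp del: topspace_subtopology simp: topspace_bcube)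
    have r1: "radius i (snd q) = 1" and ui: "snd q i = 0 \<or> snd q i = 1"
      using bd(1)[OF u] e by (auto simp: abs_if split: if_splits)
    show "M (snd q i, ?p (snd q)) = \<tau> (fst q, snd q i, ?p (snd q))"
      using ui \<tau>e[OF r in_bd[OF u r1]] by auto
  qed
  moreover have "h (0, u) = M (u i, ?p u)" if u: "u \<in> cube_boundary (Suc i)" for u
  proof (cases "radius i u \<le> \<bar>2 * u i - 1\<bar>")
    case False
    then have "radius i u = 1" using bd(1)[OF u] by (auto simp: max_def split: if_splits)
    moreover have "u i \<in> {0..1}" using cubeS[of u] u cube_boundary_subset by blast
    ultimately show ?thesis using \<tau>0[OF _ in_bd[OF u]] by (simp add: h_def)
  qed (simp add: h_def)
  ultimately obtain V where V: "continuous_map (prod_topology unit_interval (cube (Suc i))) Y V"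
    "\<And>s. s \<in> topspace (cube (Suc i)) \<Longrightarrow> V (0, s) = M (s i, ?p s)"
    "\<And>t s. t \<in> {0..1} \<Longrightarrow> s \<in> cube_boundary (Suc i) \<Longrightarrow> V (t, s) = h (t, s)"
  proof (rule cube_homotopy_extension[OF le_add1[of 1 i, unfolded plus_1_eq_Suc] v])
    fix V assume "continuous_map (prod_topology unit_interval (cube (Suc i))) Y V"
      "\<And>s. s \<in> topspace (cube (Suc i)) \<Longrightarrow> V (0, s) = M (s i, ?p s)"
      "\<And>t s. t \<in> {0..1} \<Longrightarrow> s \<in> cube_boundary (Suc i) \<Longrightarrow> V (t, s) = h (t, s)"
    then show thesis by (rule that)
  qed
  let ?M' = "\<lambda>q. V (1, (snd q)(i := fst q))"
  have in_cube: "s(i := t) \<in> topspace (cube (Suc i))" if "t \<in> {0..1}" "s \<in> topspace (cube i)" for t s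
    using that by (auto simp: topspace_cube less_Suc_eq)
  have in_bd1: "s(i := t) \<in> cube_boundary (Suc i)" if "t = 0 \<or> t = 1" "s \<in> topspace (cube i)" for t s
    using in_cube[of t s] that by (auto simp: cube_boundary_def intro!: exI[of _ i])
  have in_bd2: "s(i := t) \<in> cube_boundary (Suc i)" if t: "t \<in> {0..1}" and s: "s \<in> cube_boundary i" for t s
  proof -
    obtain j where "j < i" "s j = 0 \<or> s j = 1" "s \<in> topspace (cube i)" using s by (auto simp: cube_boundary_def)
    then show ?thesis using in_cube[OF t] unfolding cube_boundary_def by (auto intro!: exI[of _ j])
  qed
  have pu: "?p (s(i := t)) = s" if "s \<in> topspace (cube i)" for s t
    using that by (auto simp: topspace_cube fun_eq_iff)
  have ri: "radius i (s(i := t)) = radius i s" for s t by (rule radius_cong) simp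
  show ?thesis
  proof (intro exI[of _ ?M'] conjI ballI)
    have "continuous_map (prod_topology unit_interval (cube i)) (cube (Suc i)) (\<lambda>q. (snd q)(i := fst q))"
      unfolding continuous_map_into_cube
    proof (intro conjI allI ballI)
      show "continuous_map (prod_topology unit_interval (cube i)) euclideanreal (\<lambda>q. ((snd q)(i := fst q)) k)" for k
        using continuous_map_cube_component[OF continuous_map_snd] continuous_map_fst_real by (cases "k = i") auto
    qed (use in_cube in auto)
    moreover have "continuous_map (prod_topology unit_interval (cube i)) unit_interval (\<lambda>q. 1)" by simp
    ultimately show "continuous_map (prod_topology unit_interval (cube i)) Y ?M'"
      by (intro continuous_map_compose_pair[OF V(1)])
    fix s assume s: "s \<in> topspace (cube i)"
    have "V (1, s(i := t)) = M (t, s)" if t: "t = 0 \<or> t = 1" for t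
    proof -
      have "V (1, s(i := t)) = h (1, s(i := t))" using V(3)[of 1, OF _ in_bd1[OF t s]] by simp
      also have "\<dots> = M (t, s)"
        using t s ri[of s t] pu[OF s] by (auto simp: h_def in_cube_iff_radius)
      finally show ?thesis .
    qed
    then show "?M' (0, s) = M (0, s)" "?M' (1, s) = M (1, s)" by simp_all
  next
    fix t :: real and s assume t: "t \<in> {0..1}" and s: "s \<in> cube_boundary i"
    have s': "s \<in> topspace (cube i)" using s cube_boundary_subset by blast
    have r: "radius i s = 1" using s i by (simp add: in_cube_boundary_iff_radius)
    have "V (1, s(i := t)) = h (1, s(i := t))" using V(3)[of 1, OF _ in_bd2[OF t s]] by simp
    also have "\<dots> = \<tau> (1, t, s)"
    proof (cases "1 \<le> \<bar>2 * t - 1\<bar>")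
      case True
      then have "t = 0 \<or> t = 1" using t by (auto simp: abs_if split: if_splits)
      then show ?thesis using \<tau>e[of 1, OF _ s] pu[OF s'] r ri[of s t] by (auto simp: h_def)
    qed (use pu[OF s'] r ri[of s t] in \<open>simp add: h_def\<close>)
    finally show "?M' (t, s) = \<tau> (1, t, s)" by simp
  qed
qed

text \<open>A straight homotopy from the equator to \<open>base_vector\<close> fails, because the
  antipode of \<open>base_vector\<close> is on the equator. The detour through the pole
  \<open>e\<close> meets no antipodal pair.\<close>

lemma equator_null_homotopic:
  assumes n: "n \<ge> 1"
  shows "\<exists>\<kappa>. continuous_map (prod_topology unit_interval (nsphere (n - 1))) (nsphere n) \<kappa> \<and>
     (\<forall>x\<in>topspace (nsphere (n - 1)). \<kappa> (0, x) = x \<and> \<kappa> (1, x) = base_vector)"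
proof -
  define e :: "nat \<Rightarrow> real" where "e = (\<lambda>i. if i = n then 1 else 0)"
  let ?E = "nsphere (n - 1)"
  have En: "x n = 0" if "x \<in> topspace ?E" for x
    using that n by (simp add: topspace_nsphere)
  have e: "e \<in> topspace (nsphere n)"
    by (simp add: topspace_nsphere e_def dot_def if_distrib[where f = "\<lambda>x. x * _"] cong: if_cong)
  have incl: "continuous_map ?E (nsphere n) (\<lambda>x. x)"
    by (rule continuous_map_nsphere_mono[of "n - 1"]) auto
  have ce: "continuous_map ?E (nsphere n) (\<lambda>x. e)" and cb: "continuous_map ?E (nsphere n) (\<lambda>x. base_vector)"
    using e by auto
  have 1: "x \<noteq> antipode e" if "x \<in> topspace ?E" for x
    using En[OF that] by (auto simp: e_def)
  have "e n \<noteq> antipode base_vector n"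
    using n by (simp add: e_def base_vector_def)
  then have 2: "e \<noteq> antipode base_vector" by metis
  obtain h1 where h1: "continuous_map (prod_topology unit_interval ?E) (nsphere n) h1"
    "\<And>x. x \<in> topspace ?E \<Longrightarrow> h1 (0, x) = x" "\<And>x. x \<in> topspace ?E \<Longrightarrow> h1 (1, x) = e"
    using homotopic_non_antipodal[OF incl ce 1] by metis
  obtain h2 where h2: "continuous_map (prod_topology unit_interval ?E) (nsphere n) h2"
    "\<And>x. x \<in> topspace ?E \<Longrightarrow> h2 (0, x) = e" "\<And>x. x \<in> topspace ?E \<Longrightarrow> h2 (1, x) = base_vector"
    using homotopic_non_antipodal[OF ce cb 2] by metis
  have "homotopic_with (\<lambda>x. True) ?E (nsphere n) (\<lambda>x. x) (\<lambda>x. e)"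
    using h1 by (subst homotopic_with) auto
  moreover have "homotopic_with (\<lambda>x. True) ?E (nsphere n) (\<lambda>x. e) (\<lambda>x. base_vector)"
    using h2 by (subst homotopic_with) auto
  ultimately have "homotopic_with (\<lambda>x. True) ?E (nsphere n) (\<lambda>x. x) (\<lambda>x. base_vector)"
    by (rule homotopic_with_trans)
  then obtain \<kappa> where "continuous_map (prod_topology unit_interval ?E) (nsphere n) \<kappa>"
     "\<forall>x. \<kappa> (0, x) = x" "\<forall>x. \<kappa> (1, x) = base_vector"
    unfolding homotopic_with_def by blast
  then show ?thesis by (intro exI[of _ \<kappa>]) simp
qed

text \<open>On the top cell the homotopy \<open>F G \<simeq> id\<close> is assembled as follows. The path \<open>\<omega> s\<close> leads from the
  inclusion of the equator through \<open>F\<close> to the base point. Pushing the cell along \<open>\<omega>\<close> gives a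
  spheroid \<open>b\<close>, which is homotopic to \<open>F a\<close>; \<open>G\<close> is \<open>a\<close> pushed back along the null homotopy \<open>\<kappa>\<close>. The
  boundary track of the resulting homotopy runs along \<open>\<omega>\<close> out and back, hence it can be replaced by
  the odd homotopy \<open>H\<close>.\<close>

lemma odd_right_inverse:
  assumes n: "n \<ge> 1" and F: "continuous_map (nsphere n) (nsphere n) F" "F base_vector = base_vector"
    and Fodd: "\<forall>x\<in>topspace (nsphere n). F (antipode x) = antipode (F x)"
    and surj: "surjective_on_homotopy n (nsphere n) base_vector F"
  shows "\<exists>G K. continuous_map (nsphere n) (nsphere n) G \<and> G base_vector = base_vector \<and>
     (\<forall>x\<in>topspace (nsphere n). G (antipode x) = antipode (G x)) \<and>
     continuous_map (prod_topology unit_interval (nsphere n)) (nsphere n) K \<and>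
     (\<forall>x\<in>topspace (nsphere n). K (0, x) = F (G x) \<and> K (1, x) = x) \<and>
     (\<forall>t\<in>{0..1}. \<forall>x\<in>topspace (nsphere n). K (t, antipode x) = antipode (K (t, x))) \<and>
     (\<forall>t\<in>{0..1}. K (t, base_vector) = base_vector)"
proof -
  have odd: "F (antipode x) = antipode (F x)" if "x \<in> topspace (nsphere n)" for x
    using Fodd that by (rule bspec)
  let ?E = "nsphere (n - 1)" and ?\<eta> = "hemisphere_to_cube n" and ?\<theta> = "cube_to_hemisphere n"
  have En: "x \<in> topspace ?E \<longleftrightarrow> x \<in> topspace (nsphere n) \<and> x n = 0" for x
    using topspace_nsphere_Suc[of x "n - 1"] n by simp
  obtain H where H: "continuous_map (prod_topology unit_interval ?E) (nsphere n) H"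
     "\<forall>x\<in>topspace ?E. H (0, x) = F x \<and> H (1, x) = x"
     "\<forall>t\<in>{0..1}. \<forall>x\<in>topspace ?E. H (t, antipode x) = antipode (H (t, x))"
     "\<forall>t\<in>{0..1}. H (t, base_vector) = base_vector"
    using odd_homotopy_to_inclusion[OF F odd, of "n - 1"] n by auto
  obtain \<kappa> where \<kappa>: "continuous_map (prod_topology unit_interval ?E) (nsphere n) \<kappa>"
     "\<forall>x\<in>topspace ?E. \<kappa> (0, x) = x \<and> \<kappa> (1, x) = base_vector"
    using equator_null_homotopic[OF n] by (elim exE conjE)
  have \<theta>: "continuous_map (cube n) (nsphere n) ?\<theta>"
    using continuous_map_cube_to_hemisphere[of n] by (simp add: continuous_map_in_subtopology)
  have \<theta>E: "?\<theta> s \<in> topspace ?E" if "s \<in> cube_boundary n" for s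
    unfolding En using cube_to_hemisphere_in(1)[of s n] cube_to_hemisphere_boundary[OF that] that cube_boundary_subset by blast
  have \<theta>b: "continuous_map (bcube n) ?E ?\<theta>"
    unfolding continuous_map_into_nsphere[of _ "n - 1"]
    using continuous_map_nsphere_component[OF continuous_map_from_subtopology[OF \<theta>]] \<theta>E by simp

  define \<omega> where "\<omega> \<equiv> \<lambda>q. if fst q \<le> 1/2 then H (1 - 2 * fst q, ?\<theta> (snd q)) else F (\<kappa> (2 * fst q - 1, ?\<theta> (snd q)))"
  let ?IB = "prod_topology unit_interval (bcube n)"
  have \<theta>s: "continuous_map ?IB ?E (\<lambda>q. ?\<theta> (snd q))"
    using continuous_map_compose[OF continuous_map_snd \<theta>b] by (simp add: o_def)
  have \<omega>: "continuous_map ?IB (nsphere n) \<omega>"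
    unfolding \<omega>_def
  proof (rule continuous_map_cases_le)
    show "continuous_map ?IB euclideanreal fst" by (rule continuous_map_fst_real)
    let ?T = "subtopology ?IB {x \<in> topspace ?IB. fst x \<le> 1/2}"
    have "continuous_map ?T unit_interval (\<lambda>q. 1 - 2 * fst q)"
      unfolding continuous_map_into_unit_interval
      by (auto intro!: continuous_map_diff continuous_map_real_mult continuous_map_from_subtopology[OF continuous_map_fst_real])
    then show "continuous_map ?T (nsphere n) (\<lambda>q. H (1 - 2 * fst q, ?\<theta> (snd q)))"
      by (rule continuous_map_compose_pair[OF H(1)]) (rule continuous_map_from_subtopology[OF \<theta>s])
    let ?T = "subtopology ?IB {x \<in> topspace ?IB. 1/2 \<le> fst x}"
    have "continuous_map ?T unit_interval (\<lambda>q. 2 * fst q - 1)"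
      unfolding continuous_map_into_unit_interval
      by (auto intro!: continuous_map_diff continuous_map_real_mult continuous_map_from_subtopology[OF continuous_map_fst_real])
    then have "continuous_map ?T (nsphere n) (\<lambda>q. \<kappa> (2 * fst q - 1, ?\<theta> (snd q)))"
      by (rule continuous_map_compose_pair[OF \<kappa>(1)]) (rule continuous_map_from_subtopology[OF \<theta>s])
    from continuous_map_compose[OF this F(1)]
    show "continuous_map ?T (nsphere n) (\<lambda>q. F (\<kappa> (2 * fst q - 1, ?\<theta> (snd q))))" by (simp add: o_def)
    show "H (1 - 2 * fst q, ?\<theta> (snd q)) = F (\<kappa> (2 * fst q - 1, ?\<theta> (snd q)))"
      if "q \<in> topspace ?IB" "fst q = 1/2" for q
    proof -
      have "?\<theta> (snd q) \<in> topspace ?E" using \<theta>E[of "snd q"] that(1) by auto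
      moreover have e: "1 - 2 * fst q = 0" "2 * fst q - 1 = 0" using that(2) by simp_all
      ultimately show ?thesis unfolding e using H(2) \<kappa>(2) by simp
    qed
  qed simp
  have \<omega>0: "\<omega> (0, s) = ?\<theta> s" and \<omega>1: "\<omega> (1, s) = base_vector" if "s \<in> cube_boundary n" for s
    using H(2) \<kappa>(2) \<theta>E[OF that] F(2) by (simp_all add: \<omega>_def)

  obtain V where V: "continuous_map (prod_topology unit_interval (cube n)) (nsphere n) V"
    "\<And>s. s \<in> topspace (cube n) \<Longrightarrow> V (0, s) = ?\<theta> s"
    "\<And>t s. t \<in> {0..1} \<Longrightarrow> s \<in> cube_boundary n \<Longrightarrow> V (t, s) = \<omega> (t, s)"
  proof (rule cube_homotopy_extension[OF n \<theta> \<omega> \<omega>0])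
    fix V assume "continuous_map (prod_topology unit_interval (cube n)) (nsphere n) V"
      "\<And>s. s \<in> topspace (cube n) \<Longrightarrow> V (0, s) = ?\<theta> s"
      "\<And>t s. t \<in> {0..1} \<Longrightarrow> s \<in> cube_boundary n \<Longrightarrow> V (t, s) = \<omega> (t, s)"
    then show thesis by (rule that)
  qed
  have "spheroid n (nsphere n) base_vector (\<lambda>s. V (1, s))"
    unfolding spheroid_def
    using continuous_map_o_Pair[OF V(1), of 1] V(3)[of 1] \<omega>1 by (auto simp: o_def)
  then obtain a where a: "spheroid n (nsphere n) base_vector a"
     "spheroid_homotopic n (nsphere n) base_vector (F \<circ> a) (\<lambda>s. V (1, s))"
    using surj by blast
  have ac: "continuous_map (cube n) (nsphere n) a" and ab: "a s = base_vector" if "s \<in> cube_boundary n" for s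
    using a(1) that unfolding spheroid_def by blast+
  obtain L where L: "continuous_map (prod_topology unit_interval (cube n)) (nsphere n) L"
     "\<forall>s\<in>topspace (cube n). L (0, s) = (F \<circ> a) s" "\<forall>s\<in>topspace (cube n). L (1, s) = V (1, s)"
     "\<forall>t\<in>{0..1}. \<forall>s\<in>cube_boundary n. L (t, s) = base_vector"
    using a(2) unfolding spheroid_homotopic_alt by (elim exE conjE)
  have ac: "continuous_map (cube n) (nsphere n) a" using a(1) unfolding spheroid_def by blast

  have \<kappa>r: "continuous_map ?IB (nsphere n) (\<lambda>q. \<kappa> (1 - fst q, ?\<theta> (snd q)))"
  proof (rule continuous_map_compose_pair[OF \<kappa>(1) _ \<theta>s])
    show "continuous_map ?IB unit_interval (\<lambda>q. 1 - fst q)"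
      unfolding continuous_map_into_unit_interval
      by (auto intro!: continuous_map_diff continuous_map_fst_real)
  qed
  obtain A where A: "continuous_map (prod_topology unit_interval (cube n)) (nsphere n) A"
    "\<And>s. s \<in> topspace (cube n) \<Longrightarrow> A (0, s) = a s"
    "\<And>t s. t \<in> {0..1} \<Longrightarrow> s \<in> cube_boundary n \<Longrightarrow> A (t, s) = \<kappa> (1 - t, ?\<theta> s)"
  proof (rule cube_homotopy_extension[OF n ac \<kappa>r])
    show "\<kappa> (1 - fst (0, s), ?\<theta> (snd (0::real, s))) = a s" if "s \<in> cube_boundary n" for s
      using \<kappa>(2) \<theta>E[OF that] ab[OF that] by simp
    fix A assume "continuous_map (prod_topology unit_interval (cube n)) (nsphere n) A"
      "\<And>s. s \<in> topspace (cube n) \<Longrightarrow> A (0, s) = a s"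
      "\<And>t s. t \<in> {0..1} \<Longrightarrow> s \<in> cube_boundary n \<Longrightarrow> A (t, s) = \<kappa> (1 - fst (t, s), ?\<theta> (snd (t, s)))"
    then show thesis unfolding fst_conv snd_conv by (rule that)
  qed
  \<comment> \<open>On the boundary \<open>g\<close> agrees with \<open>?\<theta>\<close>.
    Transported to the upper hemisphere it is therefore the identity on the equator, so the odd
    extension is well defined and fixes the base point.\<close>
  define g where "g = (\<lambda>s. A (1, s))"
  have gc: "continuous_map (cube n) (nsphere n) g"
    using continuous_map_o_Pair[OF A(1), of 1] by (simp add: o_def g_def)
  have gb: "g s = ?\<theta> s" if "s \<in> cube_boundary n" for s
    using A(3)[of 1, OF _ that] \<kappa>(2) \<theta>E[OF that] by (simp add: g_def)

  let ?IC = "prod_topology unit_interval (cube n)"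
  \<comment> \<open>Three legs: from \<open>F \<circ> g\<close> back to \<open>F \<circ> a\<close>,
    across to the spheroid \<open>V\<close> at time 1, and back along \<open>V\<close> to
    \<open>?\<theta>\<close>.\<close>
  define M where "M \<equiv> \<lambda>q. if fst q \<le> 1/3 then F (A (1 - 3 * fst q, snd q))
       else if fst q \<le> 2/3 then L (3 * fst q - 1, snd q) else V (3 - 3 * fst q, snd q)"
  have M: "continuous_map ?IC (nsphere n) M"
    unfolding M_def
  proof (rule continuous_map_cases_le)
    show "continuous_map ?IC euclideanreal fst" by (rule continuous_map_fst_real)
    let ?T = "subtopology ?IC {x \<in> topspace ?IC. fst x \<le> 1/3}"
    have "continuous_map ?T unit_interval (\<lambda>q. 1 - 3 * fst q)"
      unfolding continuous_map_into_unit_interval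
      by (auto intro!: continuous_map_diff continuous_map_real_mult continuous_map_from_subtopology[OF continuous_map_fst_real])
    then have "continuous_map ?T (nsphere n) (\<lambda>q. A (1 - 3 * fst q, snd q))"
      by (rule continuous_map_compose_pair[OF A(1)]) (rule continuous_map_from_subtopology[OF continuous_map_snd])
    from continuous_map_compose[OF this F(1)]
    show "continuous_map ?T (nsphere n) (\<lambda>q. F (A (1 - 3 * fst q, snd q)))" by (simp add: o_def)
    let ?T = "subtopology ?IC {x \<in> topspace ?IC. 1/3 \<le> fst x}"
    show "continuous_map ?T (nsphere n) (\<lambda>q. if fst q \<le> 2/3 then L (3 * fst q - 1, snd q) else V (3 - 3 * fst q, snd q))"
    proof (rule continuous_map_cases_le)
      show "continuous_map ?T euclideanreal fst" by (rule continuous_map_from_subtopology[OF continuous_map_fst_real])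
      let ?U = "subtopology ?T {x \<in> topspace ?T. fst x \<le> 2/3}"
      have "continuous_map ?U unit_interval (\<lambda>q. 3 * fst q - 1)"
        unfolding continuous_map_into_unit_interval
        by (auto intro!: continuous_map_diff continuous_map_real_mult
            continuous_map_from_subtopology[OF continuous_map_from_subtopology[OF continuous_map_fst_real]])
      then show "continuous_map ?U (nsphere n) (\<lambda>q. L (3 * fst q - 1, snd q))"
        by (rule continuous_map_compose_pair[OF L(1)])
           (rule continuous_map_from_subtopology[OF continuous_map_from_subtopology[OF continuous_map_snd]])
      let ?U = "subtopology ?T {x \<in> topspace ?T. 2/3 \<le> fst x}"
      have "continuous_map ?U unit_interval (\<lambda>q. 3 - 3 * fst q)"
        unfolding continuous_map_into_unit_interval
        by (auto intro!: continuous_map_diff continuous_map_real_mult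
            continuous_map_from_subtopology[OF continuous_map_from_subtopology[OF continuous_map_fst_real]])
      then show "continuous_map ?U (nsphere n) (\<lambda>q. V (3 - 3 * fst q, snd q))"
        by (rule continuous_map_compose_pair[OF V(1)])
           (rule continuous_map_from_subtopology[OF continuous_map_from_subtopology[OF continuous_map_snd]])
      show "L (3 * fst q - 1, snd q) = V (3 - 3 * fst q, snd q)" if "q \<in> topspace ?T" "fst q = 2/3" for q
      proof -
        have "snd q \<in> topspace (cube n)" using that(1) by auto
        moreover have e: "3 * fst q - 1 = 1" "3 - 3 * fst q = 1" using that(2) by simp_all
        ultimately show ?thesis unfolding e using L(3) by simp
      qed
    qed simp
    show "F (A (1 - 3 * fst q, snd q)) = (if fst q \<le> 2/3 then L (3 * fst q - 1, snd q) else V (3 - 3 * fst q, snd q))"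
      if "q \<in> topspace ?IC" "fst q = 1/3" for q
    proof -
      have "snd q \<in> topspace (cube n)" using that(1) by auto
      moreover have e: "1 - 3 * fst q = 0" "3 * fst q - 1 = 0" "fst q \<le> 2/3" using that(2) by simp_all
      ultimately show ?thesis unfolding e(1,2) using L(2) A(2) e(3) by simp
    qed
  qed simp
  have M0: "M (0, s) = F (g s)" for s by (simp add: M_def g_def)
  have M1: "M (1, s) = ?\<theta> s" if "s \<in> topspace (cube n)" for s using V(2)[OF that] by (simp add: M_def)
  \<comment> \<open>The position on the path \<open>\<omega>\<close> that a boundary point occupies
    at time \<open>t\<close> of \<open>M\<close>: it starts at 1/2, climbs to 1 during the first
    leg, waits during the second and returns to 0 in the third.\<close>
  define \<mu> where "\<mu> \<equiv> \<lambda>t::real. min (min (1/2 + 3 * t / 2) 1) (3 - 3 * t)"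
  have \<mu>01: "0 \<le> \<mu> t \<and> \<mu> t \<le> 1" if "t \<in> {0..1}" for t using that by (auto simp: \<mu>_def min_def)
  have Mb: "M (t, s) = \<omega> (\<mu> t, s)" if t: "t \<in> {0..1}" and s: "s \<in> cube_boundary n" for t s
  proof -
    consider "t \<le> 1/3" | "1/3 < t" "t \<le> 2/3" | "2/3 < t" by linarith
    then show ?thesis
    proof cases
      case 1
      then have \<mu>: "\<mu> t = 1/2 + 3 * t / 2" by (simp add: \<mu>_def min_def)
      have "A (1 - 3 * t, s) = \<kappa> (3 * t, ?\<theta> s)" using A(3)[of "1 - 3 * t", OF _ s] 1 t by simp
      then have "M (t, s) = F (\<kappa> (3 * t, ?\<theta> s))" using 1 by (simp add: M_def)
      moreover have "\<omega> (\<mu> t, s) = F (\<kappa> (3 * t, ?\<theta> s))"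
      proof (cases "t = 0")
        case True
        have e: "\<mu> t = 1/2" "3 * t = 0" unfolding \<mu> using True by simp_all
        show ?thesis unfolding e using H(2) \<kappa>(2) \<theta>E[OF s] by (simp add: \<omega>_def)
      next
        case False
        then have "\<not> \<mu> t \<le> 1/2" "2 * \<mu> t - 1 = 3 * t" using \<mu> t by auto
        then show ?thesis by (simp add: \<omega>_def)
      qed
      ultimately show ?thesis by simp
    next
      case 2
      then have "\<mu> t = 1" by (simp add: \<mu>_def min_def)
      moreover have "L (3 * t - 1, s) = base_vector" using L(4) 2 s by simp
      ultimately show ?thesis using 2 \<omega>1[OF s] by (simp add: M_def)
    next
      case 3
      then have "\<mu> t = 3 - 3 * t" by (simp add: \<mu>_def min_def)
      moreover have "V (3 - 3 * t, s) = \<omega> (3 - 3 * t, s)" using V(3)[OF _ s] 3 t by simp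
      ultimately show ?thesis using 3 by (simp add: M_def)
    qed
  qed
  \<comment> \<open>Linear interpolation from \<open>\<mu>\<close> to the direct route
    \<open>(1 - t) / 2\<close>, which has the same ends 1/2 and 0. Along the direct route
    \<open>\<omega>\<close> traverses only its first half, that is, \<open>H\<close> from 0 to
    1.\<close>
  define \<tau> where "\<tau> \<equiv> \<lambda>w. \<omega> ((1 - fst w) * \<mu> (fst (snd w)) + fst w * ((1 - fst (snd w)) / 2), snd (snd w))"
  let ?IIB = "prod_topology unit_interval ?IB"
  have c01: "0 \<le> (1 - r) * \<mu> t + r * ((1 - t) / 2) \<and> (1 - r) * \<mu> t + r * ((1 - t) / 2) \<le> 1"
    if "r \<in> {0..1}" "t \<in> {0..1}" for r t
  proof
    show "0 \<le> (1 - r) * \<mu> t + r * ((1 - t) / 2)" using \<mu>01[OF that(2)] that by simp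
    have "(1 - r) * \<mu> t \<le> (1 - r) * 1" "r * ((1 - t) / 2) \<le> r * 1"
      using \<mu>01[OF that(2)] that by (intro mult_left_mono; simp)+
    then show "(1 - r) * \<mu> t + r * ((1 - t) / 2) \<le> 1" by simp
  qed
  have ft: "continuous_map ?IIB euclideanreal (\<lambda>w. fst (snd w))"
    using continuous_map_compose[OF continuous_map_snd continuous_map_fst_real] by (simp add: o_def)
  have \<tau>: "continuous_map ?IIB (nsphere n) \<tau>"
    unfolding \<tau>_def
  proof (rule continuous_map_compose_pair[OF \<omega>])
    have "continuous_map ?IIB euclideanreal (\<lambda>w. \<mu> (fst (snd w)))"
      unfolding \<mu>_def
      by (intro continuous_map_real_min continuous_map_add continuous_map_diff continuous_map_real_divide
          continuous_map_real_mult ft) auto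
    then have "continuous_map ?IIB euclideanreal (\<lambda>w. (1 - fst w) * \<mu> (fst (snd w)) + fst w * ((1 - fst (snd w)) / 2))"
      by (intro continuous_map_add continuous_map_diff continuous_map_real_divide
          continuous_map_real_mult ft continuous_map_fst_real) auto
    then show "continuous_map ?IIB unit_interval (\<lambda>w. (1 - fst w) * \<mu> (fst (snd w)) + fst w * ((1 - fst (snd w)) / 2))"
      unfolding continuous_map_into_unit_interval using c01 by auto
    show "continuous_map ?IIB (bcube n) (\<lambda>w. snd (snd w))"
      using continuous_map_compose[OF continuous_map_snd continuous_map_snd] by (simp add: o_def)
  qed
  have "\<exists>M'. continuous_map ?IC (nsphere n) M' \<and>
    (\<forall>s\<in>topspace (cube n). M' (0, s) = M (0, s) \<and> M' (1, s) = M (1, s)) \<and>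
    (\<forall>t\<in>{0..1}. \<forall>s\<in>cube_boundary n. M' (t, s) = \<tau> (1, t, s))"
  proof (rule homotopy_change_track[OF n M \<tau>])
    show "\<tau> (0, t, s) = M (t, s)" if "t \<in> {0..1}" "s \<in> cube_boundary n" for t s
      using Mb[OF that] by (simp add: \<tau>_def)
    show "\<tau> (r, 0, s) = M (0, s) \<and> \<tau> (r, 1, s) = M (1, s)" if "r \<in> {0..1}" "s \<in> cube_boundary n" for r s
    proof -
      have m: "\<mu> 0 = 1/2" "\<mu> 1 = 0" by (simp_all add: \<mu>_def)
      have e: "(1 - r) * (1/2) + r * ((1 - 0) / 2) = 1/2" "(1 - r) * 0 + r * ((1 - 1) / 2) = 0"
        by (simp_all add: field_simps)
      have "M (0, s) = \<omega> (1/2, s)" "M (1, s) = \<omega> (0, s)"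
        using Mb[of 0 s] Mb[of 1 s] that(2) unfolding m by simp_all
      then show ?thesis unfolding \<tau>_def fst_conv snd_conv m e by simp
    qed
  qed
  then obtain M' where M': "continuous_map ?IC (nsphere n) M'"
    "\<forall>s\<in>topspace (cube n). M' (0, s) = M (0, s) \<and> M' (1, s) = M (1, s)"
    "\<forall>t\<in>{0..1}. \<forall>s\<in>cube_boundary n. M' (t, s) = \<tau> (1, t, s)"
    by (elim exE conjE)
  have M'b: "M' (t, s) = H (t, ?\<theta> s)" if "t \<in> {0..1}" "s \<in> cube_boundary n" for t s
  proof -
    have e: "1 - 2 * ((1 - t) / 2) = t" by (simp add: field_simps)
    have "M' (t, s) = \<tau> (1, t, s)" using M'(3) that by simp
    also have "\<dots> = \<omega> ((1 - t) / 2, s)" by (simp add: \<tau>_def)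
    also have "\<dots> = H (1 - 2 * ((1 - t) / 2), ?\<theta> s)"
      unfolding \<omega>_def fst_conv snd_conv by (rule if_P) (use that(1) in simp)
    finally show ?thesis unfolding e .
  qed

  let ?D = "upper_hemisphere n"
  have \<eta>D: "continuous_map ?D (cube n) ?\<eta>"
    by (rule continuous_map_from_subtopology[OF continuous_map_hemisphere_to_cube])
  have \<eta>: "?\<eta> x \<in> topspace (cube n)" "?\<theta> (?\<eta> x) = x" if "x \<in> topspace (nsphere n)" "0 \<le> x n" for x
    using hemisphere_to_cube_in[OF that(1)] cube_to_hemisphere_inverse[OF that] by auto
  have \<eta>b: "?\<eta> x \<in> cube_boundary n" if "x \<in> topspace (nsphere n)" "x n = 0" for x
    by (rule hemisphere_to_cube_boundary[OF n that])
  have "\<exists>\<psi>. continuous_map (prod_topology unit_interval (nsphere n)) (nsphere n) \<psi> \<and>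
    (\<forall>t\<in>topspace unit_interval. \<forall>x\<in>topspace (nsphere n). 0 \<le> x n \<longrightarrow> \<psi> (t, x) = g (?\<eta> (snd (t, x)))) \<and>
    (\<forall>t\<in>topspace unit_interval. \<forall>x\<in>topspace (nsphere n). \<psi> (t, antipode x) = antipode (\<psi> (t, x)))"
  proof (rule hemisphere_extension[where A = antipode, OF disjI2[OF refl]])
    show "continuous_map (prod_topology unit_interval ?D) (nsphere n) (\<lambda>q. g (?\<eta> (snd q)))"
      using continuous_map_compose[OF continuous_map_compose[OF continuous_map_snd \<eta>D] gc] by (simp add: o_def)
    show "g (?\<eta> (snd (t, antipode x))) = antipode (g (?\<eta> (snd (t, x))))"
      if "x \<in> topspace (nsphere n)" "x n = 0" for t :: real and x
      using gb[OF \<eta>b[OF that]] gb[OF \<eta>b[of "antipode x"]] \<eta>(2)[of x] \<eta>(2)[of "antipode x"] that by simp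
  qed
  then obtain \<psi> where \<psi>: "continuous_map (prod_topology unit_interval (nsphere n)) (nsphere n) \<psi>"
    "\<forall>t\<in>topspace unit_interval. \<forall>x\<in>topspace (nsphere n). 0 \<le> x n \<longrightarrow> \<psi> (t, x) = g (?\<eta> (snd (t, x)))"
    "\<forall>t\<in>topspace unit_interval. \<forall>x\<in>topspace (nsphere n). \<psi> (t, antipode x) = antipode (\<psi> (t, x))"
    by (elim exE conjE)
  define G where "G = (\<lambda>x. \<psi> (0, x))"
  have G: "continuous_map (nsphere n) (nsphere n) G"
    using continuous_map_o_Pair[OF \<psi>(1), of 0] by (simp add: o_def G_def)
  have GU: "G x = g (?\<eta> x)" if "x \<in> topspace (nsphere n)" "0 \<le> x n" for x using \<psi>(2) that by (simp add: G_def)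
  have Godd: "G (antipode x) = antipode (G x)" if "x \<in> topspace (nsphere n)" for x using \<psi>(3) that by (simp add: G_def)

  define \<Theta> where "\<Theta> \<equiv> \<lambda>q. M' (fst q, ?\<eta> (snd q))"
  have \<Theta>: "continuous_map (prod_topology unit_interval ?D) (nsphere n) \<Theta>"
    unfolding \<Theta>_def
    by (rule continuous_map_compose_pair[OF M'(1) continuous_map_fst])
       (use continuous_map_compose[OF continuous_map_snd \<eta>D] in \<open>simp add: o_def\<close>)
  have \<Theta>E: "\<Theta> (t, x) = H (t, x)" if "t \<in> {0..1}" "x \<in> topspace (nsphere n)" "x n = 0" for t x
    using M'b[OF that(1) \<eta>b[OF that(2,3)]] \<eta>(2)[of x] that by (simp add: \<Theta>_def)
  have "\<exists>K. continuous_map (prod_topology unit_interval (nsphere n)) (nsphere n) K \<and>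
    (\<forall>t\<in>topspace unit_interval. \<forall>x\<in>topspace (nsphere n). 0 \<le> x n \<longrightarrow> K (t, x) = \<Theta> (t, x)) \<and>
    (\<forall>t\<in>topspace unit_interval. \<forall>x\<in>topspace (nsphere n). K (t, antipode x) = antipode (K (t, x)))"
  proof (rule hemisphere_extension[where A = antipode, OF disjI2[OF refl] \<Theta>])
    fix t x assume tx: "t \<in> topspace unit_interval" "x \<in> topspace (nsphere n)" "x n = 0"
    then have "x \<in> topspace ?E" by (simp only: En simp_thms)
    then show "\<Theta> (t, antipode x) = antipode (\<Theta> (t, x))"
      using \<Theta>E[of t x] \<Theta>E[of t "antipode x"] tx H(3) by simp
  qed
  then obtain K where K: "continuous_map (prod_topology unit_interval (nsphere n)) (nsphere n) K"
    "\<forall>t\<in>topspace unit_interval. \<forall>x\<in>topspace (nsphere n). 0 \<le> x n \<longrightarrow> K (t, x) = \<Theta> (t, x)"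
    "\<forall>t\<in>topspace unit_interval. \<forall>x\<in>topspace (nsphere n). K (t, antipode x) = antipode (K (t, x))"
    by (elim exE conjE)
  have Kodd: "K (t, antipode x) = antipode (K (t, x))" if "t \<in> {0..1}" "x \<in> topspace (nsphere n)" for t x
    using K(3) that by simp
  have up: "K (0, x) = F (G x) \<and> K (1, x) = x" if "x \<in> topspace (nsphere n)" "0 \<le> x n" for x
  proof -
    have "K (0, x) = M' (0, ?\<eta> x)" "K (1, x) = M' (1, ?\<eta> x)" using K(2) that by (simp_all add: \<Theta>_def)
    then show ?thesis using M'(2) \<eta>[OF that] M0[of "?\<eta> x"] M1[OF \<eta>(1)[OF that]] GU[OF that] by simp
  qed
  have ends: "K (0, x) = F (G x) \<and> K (1, x) = x" if x: "x \<in> topspace (nsphere n)" for x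
  proof (cases "0 \<le> x n")
    case False
    then have "K (0, antipode x) = F (G (antipode x)) \<and> K (1, antipode x) = antipode x" using up[of "antipode x"] x by simp
    then have "antipode (K (0, x)) = antipode (F (G x)) \<and> antipode (K (1, x)) = antipode x"
      using Kodd[OF _ x, of 0] Kodd[OF _ x, of 1] Godd[OF x] odd[OF continuous_map_nsphere_in[OF G x]] by simp
    then show ?thesis by (metis antipode_antipode)
  qed (use up x in blast)
  have bn: "base_vector n = 0" using n by (simp add: base_vector_def)
  have Kb: "K (t, base_vector) = base_vector" if "t \<in> {0..1}" for t
    using K(2) \<Theta>E[OF that base_vector_in bn] H(4) that bn by simp
  have Gb: "G base_vector = base_vector"
    using GU[of base_vector] gb[OF \<eta>b[of base_vector]] \<eta>(2)[of base_vector] bn by simp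
  show ?thesis
    by (rule exI[of _ G], rule exI[of _ K], intro conjI ballI)
       (rule G Gb Godd K(1) ends[THEN conjunct1] ends[THEN conjunct2] Kodd Kb; assumption)+
qed

section \<open>Self-maps of projective space that are surjective on homotopy groups\<close>

lemma RP_right_inverse_at_base:
  assumes n: "n \<ge> 1" and f: "based_map (real_projective_space n) (antipodal_pair base_vector) (real_projective_space n) (antipodal_pair base_vector) f"
    and s1: "surjective_on_homotopy 1 (real_projective_space n) (antipodal_pair base_vector) f"
    and sn: "surjective_on_homotopy n (real_projective_space n) (antipodal_pair base_vector) f"
  shows "\<exists>g. based_map (real_projective_space n) (antipodal_pair base_vector) (real_projective_space n) (antipodal_pair base_vector) g \<and>
     based_homotopic (real_projective_space n) (antipodal_pair base_vector) (real_projective_space n) (antipodal_pair base_vector) (f \<circ> g) id"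
proof -
  let ?X = "real_projective_space n" and ?p = "antipodal_pair base_vector"
  have fc: "continuous_map ?X ?X f" and f0: "f ?p = ?p" using f by (auto simp: based_map_def)
  have px: "?p \<in> topspace ?X" by (simp add: topspace_RP)
  obtain F where F: "continuous_map (nsphere n) (nsphere n) F" "F base_vector = base_vector"
     and Fx: "\<forall>x\<in>topspace (nsphere n). antipodal_pair (F x) = f (antipodal_pair x) \<and> F (antipode x) = antipode (F x)"
    using RP_odd_lift[OF n fc f0 s1] by (elim exE conjE)
  have odd: "\<forall>x\<in>topspace (nsphere n). F (antipode x) = antipode (F x)" using Fx by simp
  obtain G K where G: "continuous_map (nsphere n) (nsphere n) G" "G base_vector = base_vector"
     "\<forall>x\<in>topspace (nsphere n). G (antipode x) = antipode (G x)"
     and K: "continuous_map (prod_topology unit_interval (nsphere n)) (nsphere n) K"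
     "\<forall>x\<in>topspace (nsphere n). K (0, x) = F (G x) \<and> K (1, x) = x"
     "\<forall>t\<in>{0..1}. \<forall>x\<in>topspace (nsphere n). K (t, antipode x) = antipode (K (t, x))"
     "\<forall>t\<in>{0..1}. K (t, base_vector) = base_vector"
    using odd_right_inverse[OF n F odd sphere_surjective_on_homotopy[OF n F Fx sn]] by (elim exE conjE)
  obtain g where g: "continuous_map ?X ?X g" "\<And>x. x \<in> topspace (nsphere n) \<Longrightarrow> g (antipodal_pair x) = antipodal_pair (G x)"
    by (rule RP_map_from_odd[OF G(1)]) (use G(3) in auto)
  obtain k where k: "continuous_map (prod_topology unit_interval ?X) ?X k"
    "\<And>t x. t \<in> {0..1} \<Longrightarrow> x \<in> topspace (nsphere n) \<Longrightarrow> k (t, antipodal_pair x) = antipodal_pair (K (t, x))"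
    by (rule RP_homotopy_from_odd[OF K(1)]) (use K(3) in auto)
  have gp: "g ?p = ?p" using g(2)[OF base_vector_in] G(2) by simp
  have "based_homotopic ?X ?p ?X ?p (f \<circ> g) id"
    unfolding based_homotopic_alt[OF px]
  proof (intro exI[of _ k] conjI ballI)
    fix y assume "y \<in> topspace ?X"
    then obtain x where x: "y = antipodal_pair x" "x \<in> topspace (nsphere n)" unfolding topspace_RP by (rule imageE)
    show "k (0, y) = (f \<circ> g) y" "k (1, y) = id y"
      using k(2)[OF _ x(2), of 0] k(2)[OF _ x(2), of 1] K(2) x g(2)[OF x(2)] Fx continuous_map_nsphere_in[OF G(1) x(2)]
      by simp_all
  next
    show "k (t, ?p) = ?p" if "t \<in> {0..1}" for t
      using k(2)[OF that base_vector_in] K(4) that by simp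
  qed (rule k(1))
  then show ?thesis using g(1) gp by (intro exI[of _ g]) (simp add: based_map_def)
qed

text \<open>The Householder reflection that exchanges \<open>P\<close> and
  \<open>base_vector\<close>. If they coincide, \<open>w\<close> and \<open>d\<close> vanish, and
  division by zero turns the formula into the identity.\<close>

lemma RP_base_change:
  assumes P: "P \<in> topspace (nsphere n)"
  shows "\<exists>r. continuous_map (real_projective_space n) (real_projective_space n) r \<and>
     (\<forall>y\<in>topspace (real_projective_space n). r (r y) = y) \<and>
     r (antipodal_pair P) = antipodal_pair base_vector"
proof -
  let ?X = "real_projective_space n"
  define w where "w = (\<lambda>i. P i - base_vector i)"
  define d where "d = dot n w w"
  define R where "R \<equiv> \<lambda>x i. 1 * x i + (- 2 * dot n x w / d) * w i"
  have w0: "w i = 0" if "i > n" for i using P that by (simp add: w_def base_vector_def topspace_nsphere)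
  have RS: "R x \<in> topspace (nsphere n)" and Rw: "d \<noteq> 0 \<Longrightarrow> dot n (R x) w = - dot n x w" if x: "x \<in> topspace (nsphere n)" for x
  proof -
    show "d \<noteq> 0 \<Longrightarrow> dot n (R x) w = - dot n x w"
      unfolding R_def dot_linear d_def by simp
    have "dot n (R x) (R x) = 1 * dot n x (R x) + (- 2 * dot n x w / d) * dot n w (R x)"
      unfolding R_def by (rule dot_linear)
    also have "dot n x (R x) = 1 * dot n x x + (- 2 * dot n x w / d) * dot n x w"
      unfolding dot_commute[of n x "R x"] unfolding R_def dot_linear by (simp add: dot_commute[of n w x])
    also have "dot n w (R x) = 1 * dot n x w + (- 2 * dot n x w / d) * d"
      unfolding dot_commute[of n w "R x"] unfolding R_def dot_linear by (simp add: d_def)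
    finally have "dot n (R x) (R x) = 1"
      using x by (cases "d = 0") (simp_all add: topspace_nsphere field_simps)
    then show "R x \<in> topspace (nsphere n)"
      using x w0 by (simp add: topspace_nsphere) (simp add: R_def topspace_nsphere)
  qed
  have RR: "R (R x) = x" if x: "x \<in> topspace (nsphere n)" for x
  proof (cases "d = 0")
    case False
    have "R y = (\<lambda>i. 1 * y i + (- 2 * dot n y w / d) * w i)" for y by (simp only: R_def)
    from this[of "R x"] have "R (R x) = (\<lambda>i. 1 * R x i + (- 2 * (- dot n x w) / d) * w i)"
      by (simp only: Rw[OF x False])
    then show ?thesis by (simp add: R_def)
  qed (simp add: R_def)
  have RP: "R P = base_vector"
  proof -
    have b: "dot n base_vector base_vector = 1" using base_vector_in[of n] by (simp add: topspace_nsphere)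
    have p: "dot n P P = 1" using P by (simp add: topspace_nsphere)
    have w': "w = (\<lambda>i. 1 * P i + (-1) * base_vector i)" by (simp add: w_def)
    have pw: "dot n P w = 1 - dot n P base_vector"
      unfolding dot_commute[of n P w] unfolding w' dot_linear by (simp add: p dot_commute)
    have bw: "dot n base_vector w = dot n P base_vector - 1"
      unfolding dot_commute[of n base_vector w] unfolding w' dot_linear by (simp add: b dot_commute)
    have "d = 1 * dot n P w + (-1) * dot n base_vector w"
      unfolding d_def by (subst w') (rule dot_linear)
    \<comment> \<open>\<open>P\<close> and \<open>base_vector\<close> have equal length, so their
      inner products with the difference \<open>w\<close> are opposite; hence \<open>P\<close> is
      moved by exactly \<open>-w\<close>.\<close>
    then have d: "d = 2 * dot n P w" by (simp add: pw bw)
    show ?thesis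
    proof (cases "d = 0")
      case True
      then have "\<forall>i\<le>n. w i = 0" unfolding d_def dot_eq_0 .
      then have "w i = 0" for i using w0[of i] by (cases "i \<le> n") auto
      then have "P = base_vector" by (simp add: w_def fun_eq_iff)
      then show ?thesis using True by (simp add: R_def)
    next
      case False
      then have "- 2 * dot n P w / d = -1" unfolding d by simp
      then show ?thesis by (simp add: R_def w_def)
    qed
  qed
  have Rc: "continuous_map (nsphere n) (nsphere n) R"
    unfolding continuous_map_into_nsphere
  proof (intro conjI allI ballI)
    have "continuous_map (nsphere n) euclideanreal (\<lambda>x. dot n x w)"
      by (intro continuous_map_dot continuous_map_nsphere_projection) auto
    then show "continuous_map (nsphere n) euclideanreal (\<lambda>x. R x k)" for k
      unfolding R_def divide_inverse
      by (intro continuous_map_add continuous_map_real_mult continuous_map_nsphere_projection) auto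
  qed (rule RS)
  have "R (antipode x) = antipode (R x)" for x by (auto simp: R_def fun_eq_iff)
  then obtain r where r: "continuous_map ?X ?X r" "\<And>x. x \<in> topspace (nsphere n) \<Longrightarrow> r (antipodal_pair x) = antipodal_pair (R x)"
    by (rule RP_map_from_odd[OF Rc]) auto
  show ?thesis
  proof (intro exI[of _ r] conjI ballI)
    fix y assume "y \<in> topspace ?X"
    then obtain x where x: "y = antipodal_pair x" "x \<in> topspace (nsphere n)" unfolding topspace_RP by (rule imageE)
    then show "r (r y) = y" using r(2) RS RR by simp
  next
    show "r (antipodal_pair P) = antipodal_pair base_vector" using r(2)[OF P] RP by simp
  qed (rule r(1))
qed

text \<open>Conjugation with the involution \<open>r\<close> moves the problem to the standard base
  point and the solution back.\<close>

lemma RP_right_inverse: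
  assumes n: "n \<ge> 1" and p: "p \<in> topspace (real_projective_space n)"
    and f: "based_map (real_projective_space n) p (real_projective_space n) p f"
    and s1: "surjective_on_homotopy 1 (real_projective_space n) p f"
    and sn: "surjective_on_homotopy n (real_projective_space n) p f"
  shows "\<exists>g. based_map (real_projective_space n) p (real_projective_space n) p g \<and>
     based_homotopic (real_projective_space n) p (real_projective_space n) p (f \<circ> g) id"
proof -
  let ?X = "real_projective_space n" and ?e = "antipodal_pair base_vector"
  obtain P where P: "P \<in> topspace (nsphere n)" "p = antipodal_pair P" using p unfolding topspace_RP by blast
  obtain r where r: "continuous_map ?X ?X r" "\<forall>y\<in>topspace ?X. r (r y) = y" "r p = ?e"
    using RP_base_change[OF P(1)] unfolding P(2) by (elim exE conjE)
  have re: "r ?e = p" using r(2) p r(3) by metis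
  have rp: "based_map ?X p ?X ?e r" and rb: "based_map ?X ?e ?X p r" using r(1,3) re by (auto simp: based_map_def)
  have fX: "f y \<in> topspace ?X" if "y \<in> topspace ?X" for y
    using continuous_map_image_subset_topspace[of ?X ?X f] f that by (auto simp: based_map_def)
  have rX: "r y \<in> topspace ?X" if "y \<in> topspace ?X" for y
    using continuous_map_image_subset_topspace[OF r(1)] that by auto
  let ?f = "r \<circ> (f \<circ> r)"
  have f': "based_map ?X ?e ?X ?e ?f"
    by (rule based_map_comp[OF based_map_comp[OF rb f] rp])
  have surj: "surjective_on_homotopy i ?X ?e ?f" if s: "surjective_on_homotopy i ?X p f" for i
  proof (intro allI impI)
    fix b assume b: "spheroid i ?X ?e b"
    then have "spheroid i ?X p (r \<circ> b)" by (rule spheroid_comp[OF rb])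
    then obtain a where a: "spheroid i ?X p a" "spheroid_homotopic i ?X p (f \<circ> a) (r \<circ> b)" using s by blast
    have cX: "continuous_map (cube i) ?X a" "continuous_map (cube i) ?X b" using a(1) b by (simp_all add: spheroid_def)
    have inX: "a s \<in> topspace ?X" "b s \<in> topspace ?X" if "s \<in> topspace (cube i)" for s
      using continuous_map_image_subset_topspace[OF cX(1)] continuous_map_image_subset_topspace[OF cX(2)] that by auto
    have "spheroid_homotopic i ?X ?e (?f \<circ> (r \<circ> a)) b"
      by (rule spheroid_homotopic_cong[OF spheroid_homotopic_comp[OF rp a(2)]]) (use r(2) inX in auto)
    then show "\<exists>a. spheroid i ?X ?e a \<and> spheroid_homotopic i ?X ?e (?f \<circ> a) b"
      by (intro exI[of _ "r \<circ> a"] conjI spheroid_comp[OF rp a(1)])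
  qed
  obtain g where g: "based_map ?X ?e ?X ?e g" "based_homotopic ?X ?e ?X ?e (?f \<circ> g) id"
    using RP_right_inverse_at_base[OF n f' surj[OF s1] surj[OF sn]] by (elim exE conjE)
  have gX: "g y \<in> topspace ?X" if "y \<in> topspace ?X" for y
    using continuous_map_image_subset_topspace[of ?X ?X g] g(1) that by (auto simp: based_map_def)
  have "based_homotopic ?X p ?X p (r \<circ> (?f \<circ> g) \<circ> r) (r \<circ> id \<circ> r)"
    by (rule based_homotopic_comp_right[OF based_homotopic_comp_left[OF g(2) rb] rp])
  then have "based_homotopic ?X p ?X p (f \<circ> (r \<circ> (g \<circ> r))) id"
    by (rule based_homotopic_cong[OF _ p]) (use r(2) rX fX gX in auto)
  moreover have "based_map ?X p ?X p (r \<circ> (g \<circ> r))"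
    by (rule based_map_comp[OF based_map_comp[OF rp g(1)] rb])
  ultimately show ?thesis by (intro exI[of _ "r \<circ> (g \<circ> r)"] conjI)
qed

theorem RP_induces_iso_imp_equivalence:
  assumes n: "n \<ge> 1" and p: "p \<in> topspace (real_projective_space n)"
    and f: "based_map (real_projective_space n) p (real_projective_space n) p f"
    and iso: "\<And>i. i \<le> n \<Longrightarrow> induces_iso i (real_projective_space n) p (real_projective_space n) p f"
  shows "based_homotopy_equivalence (real_projective_space n) p (real_projective_space n) p f"
proof -
  let ?X = "real_projective_space n"
  have surj: "surjective_on_homotopy i ?X p f" if "i \<le> n" for i
    using iso[OF that] unfolding induces_iso_iff[OF f] by (rule conjunct1)
  have inj: "spheroid_homotopic i ?X p a a'"
    if "i \<le> n" "spheroid i ?X p a" "spheroid i ?X p a'" "spheroid_homotopic i ?X p (f \<circ> a) (f \<circ> a')" for i a a'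
    using iso[OF that(1)] that(2-4) unfolding induces_iso_iff[OF f] by blast
  obtain g where g: "based_map ?X p ?X p g" "based_homotopic ?X p ?X p (f \<circ> g) id"
    using RP_right_inverse[OF n p f surj[OF n] surj[OF order_refl]] by (elim exE conjE)
  have gs: "surjective_on_homotopy i ?X p g" if i: "i \<le> n" for i
  proof (intro allI impI)
    fix a assume a: "spheroid i ?X p a"
    have fa: "spheroid i ?X p (f \<circ> a)" by (rule spheroid_comp[OF f a])
    have gfa: "spheroid i ?X p (g \<circ> (f \<circ> a))" by (rule spheroid_comp[OF g(1) fa])
    have "spheroid_homotopic i ?X p (f \<circ> (g \<circ> (f \<circ> a))) (f \<circ> a)"
      using spheroid_homotopic_based_homotopic[OF g(2) fa] by (simp add: comp_assoc)
    \<comment> \<open>The only use of injectivity: cancelling \<open>f\<close> shows that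
      \<open>f \<circ> a\<close> is a preimage of \<open>a\<close> under \<open>g\<close>.\<close>
    then have "spheroid_homotopic i ?X p (g \<circ> (f \<circ> a)) a" by (rule inj[OF i gfa a])
    then show "\<exists>c. spheroid i ?X p c \<and> spheroid_homotopic i ?X p (g \<circ> c) a"
      by (intro exI[of _ "f \<circ> a"] conjI fa)
  qed
  obtain h where h: "based_map ?X p ?X p h" "based_homotopic ?X p ?X p (g \<circ> h) id"
    using RP_right_inverse[OF n p g(1) gs[OF n] gs[OF order_refl]] by (elim exE conjE)
  have "based_homotopic ?X p ?X p (f \<circ> (g \<circ> h)) (f \<circ> id)" by (rule based_homotopic_comp_left[OF h(2) f])
  moreover have "based_homotopic ?X p ?X p (f \<circ> g \<circ> h) (id \<circ> h)" by (rule based_homotopic_comp_right[OF g(2) h(1)])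
  \<comment> \<open>Both maps are homotopic to \<open>f \<circ> g \<circ> h\<close>; replacing
    \<open>h\<close> by \<open>f\<close> in \<open>g \<circ> h\<close> gives the missing left
    inverse.\<close>
  ultimately have "based_homotopic ?X p ?X p f h"
    using based_homotopic_trans[OF based_homotopic_sym[of ?X p ?X p "f \<circ> (g \<circ> h)" f]] by (simp add: comp_assoc)
  then have "based_homotopic ?X p ?X p (g \<circ> f) id"
    by (rule based_homotopic_trans[OF based_homotopic_comp_left[OF _ g(1)] h(2)])
  then show ?thesis
    unfolding based_homotopy_equivalence_def using f g by blast
qed

section \<open>The degree of a suspended power map\<close>

definition complex_part :: "(nat \<Rightarrow> real) \<Rightarrow> complex" where
  "complex_part x = Complex (x 0) (x 1)"

text \<open>The factor \<open>\<bar>z\<bar> / \<bar>z\<bar>\<^sup>3\<close> is \<open>0\<close> at \<open>z = 0\<close>, as it should be for continuity.\<close>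

definition twist :: "complex \<Rightarrow> (nat \<Rightarrow> real) \<Rightarrow> nat \<Rightarrow> real" where
  "twist c x = (let z = complex_part x; w = c * z ^ 3; r = norm z / norm z ^ 3 in
     (\<lambda>i. if i = 0 then Re w * r else if i = 1 then Im w * r else x i))"

lemma complex_part_twist: "complex_part (twist c x) = c * complex_part x ^ 3 * of_real (norm (complex_part x) / norm (complex_part x) ^ 3)"
proof -
  let ?z = "complex_part x"
  have "twist c x 0 = Re (c * ?z ^ 3) * (norm ?z / norm ?z ^ 3)" "twist c x 1 = Im (c * ?z ^ 3) * (norm ?z / norm ?z ^ 3)"
    by (simp_all only: twist_def Let_def if_True if_False refl one_neq_zero)
  then have "complex_part (twist c x) = Complex (Re (c * ?z ^ 3) * (norm ?z / norm ?z ^ 3)) (Im (c * ?z ^ 3) * (norm ?z / norm ?z ^ 3))"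
    unfolding complex_part_def[of "twist c x"] by (simp only:)
  also have "\<dots> = c * ?z ^ 3 * of_real (norm ?z / norm ?z ^ 3)"
    by (rule complex_eqI) (simp_all only: complex.sel Re_complex_of_real Im_complex_of_real times_complex.sel mult_zero_right diff_zero add_0 add_0_right)
  finally show ?thesis .
qed

lemma twist_above: "i \<ge> 2 \<Longrightarrow> twist c x i = x i"
  by (simp add: twist_def Let_def)

lemma norm_complex_part_twist:
  assumes "norm c = 1" shows "norm (complex_part (twist c x)) = norm (complex_part x)"
  using assms by (cases "complex_part x = 0") (simp_all add: complex_part_twist norm_mult norm_power norm_divide)

lemma dot_complex_part:
  assumes "n \<ge> 1" shows "dot n x x = (norm (complex_part x))\<^sup>2 + (\<Sum>i=2..n. x i * x i)"
proof -
  have "{..n} = insert 0 (insert 1 {2..n})" using assms by auto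
  then have "dot n x x = x 0 * x 0 + x 1 * x 1 + (\<Sum>i=2..n. x i * x i)" by (simp add: dot_def)
  moreover have "(norm (complex_part x))\<^sup>2 = (x 0)\<^sup>2 + (x 1)\<^sup>2" by (simp add: complex_part_def cmod_power2)
  ultimately show ?thesis by (simp only: power2_eq_square)
qed

lemma twist_in_nsphere:
  assumes "n \<ge> 1" "norm c = 1" "x \<in> topspace (nsphere n)"
  shows "twist c x \<in> topspace (nsphere n)"
proof -
  have "(\<Sum>i=2..n. twist c x i * twist c x i) = (\<Sum>i=2..n. x i * x i)"
    by (intro sum.cong) (simp_all add: twist_above)
  then have "dot n (twist c x) (twist c x) = dot n x x"
    using assms by (simp add: dot_complex_part norm_complex_part_twist)
  moreover have "twist c x i = 0" if "i > n" for i
    using that assms by (subst twist_above) (simp_all add: topspace_nsphere)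
  ultimately show ?thesis using assms(3) by (simp add: topspace_nsphere)
qed

lemma complex_part_antipode: "complex_part (antipode x) = - complex_part x"
  by (simp add: complex_part_def complex_eq_iff)

lemma twist_antipode: "twist c (antipode x) = antipode (twist c x)"
proof -
  have "c * (- complex_part x) ^ 3 = - (c * complex_part x ^ 3)" by (simp add: power3_eq_cube)
  then have w: "Re (c * (- complex_part x) ^ 3) = - Re (c * complex_part x ^ 3)" "Im (c * (- complex_part x) ^ 3) = - Im (c * complex_part x ^ 3)"
    by (simp_all only: uminus_complex.sel)
  show ?thesis
  proof
    show "twist c (antipode x) i = antipode (twist c x) i" for i
      unfolding twist_def Let_def complex_part_antipode w norm_minus_cancel
      by (cases "i = 0"; cases "i = 1") (simp_all only: antipode_apply if_True if_False refl mult_minus_left one_neq_zero)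
  qed
qed

text \<open>At \<open>z = 0\<close> the factor is an indeterminate quotient;
  \<open>continuous_on_mult_divide\<close> applies because the real and imaginary parts of
  \<open>c * z ^ 3\<close> are bounded by the denominator \<open>norm z ^ 3\<close>.\<close>

lemma continuous_map_twist:
  assumes "n \<ge> 1" "norm c = 1"
  shows "continuous_map (nsphere n) (nsphere n) (twist c)"
  unfolding continuous_map_into_nsphere
proof (intro conjI allI ballI)
  have z: "continuous_on UNIV complex_part"
  proof -
    have "complex_part = (\<lambda>x. of_real (x 0) + \<i> * of_real (x 1))" by (auto simp: complex_part_def complex_eq_iff)
    moreover have "continuous_on UNIV (\<lambda>x::nat\<Rightarrow>real. complex_of_real (x 0) + \<i> * of_real (x 1))"
      by (intro continuous_on_add continuous_on_mult continuous_on_of_real continuous_on_const continuous_on_coordinate)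
    ultimately show ?thesis by metis
  qed
  have le: "\<bar>Re (c * z ^ 3)\<bar> \<le> norm z ^ 3" "\<bar>Im (c * z ^ 3)\<bar> \<le> norm z ^ 3" for z
    using abs_Re_le_cmod[of "c * z ^ 3"] abs_Im_le_cmod[of "c * z ^ 3"] assms(2) by (simp_all add: norm_mult norm_power)
  have w: "continuous_on UNIV (\<lambda>x. c * complex_part x ^ 3)"
    by (intro continuous_on_mult continuous_on_power continuous_on_const z)
  have "continuous_on UNIV (\<lambda>x. Re (c * complex_part x ^ 3) * (norm (complex_part x) / norm (complex_part x) ^ 3))"
    "continuous_on UNIV (\<lambda>x. Im (c * complex_part x ^ 3) * (norm (complex_part x) / norm (complex_part x) ^ 3))"
    by (rule continuous_on_mult_divide;
        (rule le | intro continuous_on_Re continuous_on_Im continuous_on_norm continuous_on_power w z | simp))+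
  then have "continuous_on UNIV (\<lambda>x. twist c x k)" for k
    by (cases "k = 0"; cases "k = 1") (simp_all add: twist_def Let_def continuous_on_coordinate)
  then show "continuous_map (nsphere n) euclideanreal (\<lambda>x. twist c x k)" for k
    by (subst nsphere_eq_top_of_set) (simp add: continuous_on_subset[OF _ subset_UNIV])
qed (rule twist_in_nsphere[OF assms])

lemma twist_fixes:
  obtains c where "norm c = 1" "twist c x = x"
proof (cases "complex_part x = 0")
  case True
  then have "x 0 = 0" "x 1 = 0" by (simp_all add: complex_part_def complex_eq_iff)
  then show thesis using that[of 1] True by (auto simp: twist_def Let_def fun_eq_iff)
next
  case False
  let ?z = "complex_part x"
  \<comment> \<open>This is \<open>(norm z)\<^sup>2 / z\<^sup>2\<close>, the unit number that undoes
    the tripling of the angle at this one point, written so that it cancels against the factor in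
    \<open>twist\<close>.\<close>
  define c where "c = of_real (norm ?z ^ 3 / norm ?z) * ?z / ?z ^ 3"
  have "norm c = 1" using False by (simp add: c_def norm_mult norm_divide norm_power)
  moreover have cz: "complex_part (twist c x) = ?z"
    using False by (simp add: complex_part_twist c_def)
  have "twist c x i = x i" for i
  proof -
    consider "i = 0" | "i = 1" | "i \<ge> 2" by linarith
    then show ?thesis
      using cz by cases (simp_all add: complex_part_def twist_above)
  qed
  ultimately show thesis using that by blast
qed

subsection \<open>The winding cochain\<close>

text \<open>Barycentric coordinates on the standard 1-simplex, running from vertex 0 to vertex
  1.\<close>

definition edge :: "real \<Rightarrow> nat \<Rightarrow> real" where
  "edge t = (\<lambda>j. if j = 0 then 1 - t else if j = 1 then t else 0)"

definition angle_lift :: "((nat \<Rightarrow> real) \<Rightarrow> nat \<Rightarrow> real) \<Rightarrow> (real \<Rightarrow> real) \<Rightarrow> bool" where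
  "angle_lift \<sigma> \<theta> \<longleftrightarrow> continuous_on {0..1} \<theta> \<and> (\<forall>t\<in>{0..1}. complex_part (\<sigma> (edge t)) = cis (\<theta> t))"

text \<open>The total change of angle along a 1-simplex, in radians and without any requirement that
  the path close up, so that it is a real cochain. It is meaningful when an angle lift
  exists.\<close>

definition winding :: "((nat \<Rightarrow> real) \<Rightarrow> nat \<Rightarrow> real) \<Rightarrow> real" where
  "winding \<sigma> = (let \<theta> = (SOME \<theta>. angle_lift \<sigma> \<theta>) in \<theta> 1 - \<theta> 0)"

text \<open>Two angle functions differ by a continuous function with values in the multiples of
  \<open>2 * pi\<close>, which is constant on the interval.\<close>

lemma winding_eq:
  assumes "angle_lift \<sigma> \<theta>" shows "winding \<sigma> = \<theta> 1 - \<theta> 0"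
proof -
  define \<theta>' where "\<theta>' = (SOME \<theta>. angle_lift \<sigma> \<theta>)"
  have l: "angle_lift \<sigma> \<theta>'" unfolding \<theta>'_def by (rule someI[of _ \<theta>]) (rule assms)
  let ?d = "\<lambda>t. (\<theta> t - \<theta>' t) / (2 * pi)"
  have int: "?d t \<in> \<int>" if "t \<in> {0..1}" for t
  proof -
    have "cis (\<theta> t) = cis (\<theta>' t)" using assms l that by (auto simp: angle_lift_def)
    then have "cis (\<theta> t - \<theta>' t) = 1" by (simp flip: cis_divide)
    then have "cos (\<theta> t - \<theta>' t) = 1" by (simp add: complex_eq_iff)
    then obtain k :: int where "\<theta> t - \<theta>' t = of_int k * 2 * pi" unfolding cos_one_2pi_int by auto
    then show ?thesis by simp
  qed
  have "continuous_on {0..1} ?d"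
    using assms l unfolding angle_lift_def by (intro continuous_on_divide continuous_on_diff continuous_on_const) auto
  then have con: "connected (?d ` {0..1})" by (intro connected_continuous_image connected_Icc)
  have no: False if mk: "m \<in> ?d ` {0..1}" "k \<in> ?d ` {0..1}" "m < k" for m k :: real
  proof -
    have "m \<in> \<int>" "k \<in> \<int>" using mk(1,2) int by blast+
    then obtain a b :: int where ab: "m = of_int a" "k = of_int b" by (elim Ints_cases)
    \<comment> \<open>Between two different integer values the intermediate value
      \<open>m + 1/2\<close> would be taken, and it is not an integer.\<close>
    then have "m \<le> m + 1/2" "m + 1/2 \<le> k" using mk(3) by auto
    then have "m + 1/2 \<in> ?d ` {0..1}" by (rule connectedD_interval[OF con mk(1,2)])
    then have "m + 1/2 \<in> \<int>" using int by auto
    then obtain l :: int where "m + 1/2 = of_int l" by (auto elim: Ints_cases)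
    then have "real_of_int (2 * a + 1) = real_of_int (2 * l)" using ab by simp
    then have "2 * a + 1 = 2 * l" by (simp only: of_int_eq_iff)
    then show False by presburger
  qed
  have "?d 0 \<in> ?d ` {0..1}" "?d 1 \<in> ?d ` {0..1}" by auto
  then have "\<not> ?d 0 < ?d 1" "\<not> ?d 1 < ?d 0" using no by blast+
  then have "?d 0 = ?d 1" by linarith
  then have "\<theta> 0 - \<theta>' 0 = \<theta> 1 - \<theta>' 1" by simp
  then show ?thesis unfolding winding_def \<theta>'_def[symmetric] Let_def by simp
qed

section \<open>Linear extension to chains\<close>

definition winding_chain :: "(nat \<Rightarrow> real) chain \<Rightarrow> real" where
  "winding_chain c = (\<Sum>\<sigma>\<in>Poly_Mapping.keys c. of_int (Poly_Mapping.lookup c \<sigma>) * winding \<sigma>)"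

lemma winding_chain_superset:
  assumes "finite S" "Poly_Mapping.keys c \<subseteq> S"
  shows "winding_chain c = (\<Sum>\<sigma>\<in>S. of_int (Poly_Mapping.lookup c \<sigma>) * winding \<sigma>)"
  unfolding winding_chain_def
  by (rule sum.mono_neutral_left) (use assms in \<open>auto simp: in_keys_iff\<close>)

lemma winding_chain_of [simp]: "winding_chain (frag_of \<sigma>) = winding \<sigma>"
  by (simp add: winding_chain_def)

lemma winding_chain_0 [simp]: "winding_chain 0 = 0"
  by (simp add: winding_chain_def)

lemma winding_chain_add: "winding_chain (a + b) = winding_chain a + winding_chain b"
proof -
  let ?S = "Poly_Mapping.keys a \<union> Poly_Mapping.keys b"
  have "Poly_Mapping.keys (a + b) \<subseteq> ?S" by (rule Poly_Mapping.keys_add)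
  then show ?thesis
    using winding_chain_superset[of ?S a] winding_chain_superset[of ?S b] winding_chain_superset[of ?S "a + b"]
    by (simp add: lookup_add distrib_right sum.distrib)
qed

lemma winding_chain_diff: "winding_chain (a - b) = winding_chain a - winding_chain b"
  using winding_chain_add[of "a - b" b] by simp

lemma winding_chain_minus: "winding_chain (- a) = - winding_chain a"
  using winding_chain_diff[of 0 a] by simp

lemma edge_in: "t \<in> {0..1} \<Longrightarrow> edge t \<in> standard_simplex 1"
  by (auto simp: edge_def standard_simplex_def)

text \<open>The angle is defined on the whole triangle, which is contractible. On each edge the
  winding is the difference of its values at the two vertices, and the alternating sum
  cancels.\<close>

lemma winding_boundary_simplex:
  assumes \<tau>: "singular_simplex 2 (nsphere 1) \<tau>"
  shows "winding_chain (chain_boundary 2 (frag_of \<tau>)) = 0"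
proof -
  \<comment> \<open>Parametrisation of the 2-simplex by a plane triangle; the vertices 0, 1 and 2
    correspond to (0,0), (1,0) and (0,1).\<close>
  define p :: "real \<times> real \<Rightarrow> nat \<Rightarrow> real"
    where "p = (\<lambda>q j. if j = 0 then 1 - fst q - snd q else if j = 1 then fst q else if j = 2 then snd q else 0)"
  define T :: "(real \<times> real) set" where "T = {q. 0 \<le> fst q \<and> 0 \<le> snd q \<and> fst q + snd q \<le> 1}"
  have pT: "p q \<in> standard_simplex 2" if "q \<in> T" for q
  proof -
    have "{..2::nat} = {0, 1, 2}" by auto
    then show ?thesis using that by (auto simp: p_def T_def standard_simplex_def)
  qed
  have \<tau>c: "continuous_map (subtopology (powertop_real UNIV) (standard_simplex 2)) (nsphere 1) \<tau>"
    using \<tau> by (simp add: singular_simplex_def)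
  have p: "continuous_map (top_of_set T) (subtopology (powertop_real UNIV) (standard_simplex 2)) p"
    unfolding continuous_map_in_subtopology continuous_map_componentwise_UNIV
  proof (intro conjI allI)
    have "continuous_on T (\<lambda>q. p q k)" for k
      unfolding p_def
      by (cases "k = 0"; cases "k = 1"; cases "k = 2") (auto intro!: continuous_intros)
    then show "continuous_map (top_of_set T) euclideanreal (\<lambda>q. p q k)" for k by simp
  qed (use pT in auto)
  have \<tau>p: "continuous_map (top_of_set T) (nsphere 1) (\<lambda>q. \<tau> (p q))"
    using continuous_map_compose[OF p \<tau>c] by (simp add: o_def)
  let ?f = "\<lambda>q. complex_part (\<tau> (p q))"
  have f: "continuous_on T ?f"
  proof -
    have "continuous_on T (\<lambda>q. \<tau> (p q) k)" for k
      using continuous_map_nsphere_component[OF \<tau>p, of k] by simp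
    then have "continuous_on T (\<lambda>q. complex_of_real (\<tau> (p q) 0) + \<i> * of_real (\<tau> (p q) 1))"
      by (intro continuous_on_add continuous_on_mult continuous_on_of_real continuous_on_const)
    moreover have "?f = (\<lambda>q. of_real (\<tau> (p q) 0) + \<i> * of_real (\<tau> (p q) 1))"
      by (auto simp: complex_part_def complex_eq_iff)
    ultimately show ?thesis by metis
  qed
  have n1: "norm (?f q) = 1" if "q \<in> T" for q
  proof -
    have "\<tau> (p q) \<in> topspace (nsphere 1)" using continuous_map_nsphere_in[OF \<tau>p, of q] that by simp
    then have "(norm (?f q))\<^sup>2 = 1" using dot_complex_part[of 1 "\<tau> (p q)"] by (simp add: topspace_nsphere)
    then show ?thesis by (simp add: power2_eq_1_iff) (metis norm_ge_zero not_one_le_zero neg_0_le_iff_le)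
  qed
  have "convex T"
  proof (rule convexI)
    fix x y and u v :: real assume x: "x \<in> T" and y: "y \<in> T" and u: "0 \<le> u" "0 \<le> v" "u + v = 1"
    have "u * (fst x + snd x) + v * (fst y + snd y) \<le> 1"
      by (rule convex_bound_le) (use x y u in \<open>auto simp: T_def\<close>)
    then show "u *\<^sub>R x + v *\<^sub>R y \<in> T"
      using x y u by (simp add: T_def distrib_left)
  qed
  then have T: "contractible T" by (rule convex_imp_contractible)
  have nz: "?f q \<noteq> 0" if "q \<in> T" for q using n1[OF that] by auto
  obtain g where g: "continuous_on T g" "\<And>q. q \<in> T \<Longrightarrow> ?f q = exp (g q)"
    by (rule continuous_logarithm_on_contractible[OF f T nz]) (assumption, rule that)
  define \<theta> where "\<theta> = (\<lambda>q. Im (g q))"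
  have \<theta>c: "continuous_on T \<theta>" unfolding \<theta>_def by (intro continuous_on_Im g)
  have \<theta>: "?f q = cis (\<theta> q)" if "q \<in> T" for q
  proof -
    have "exp (Re (g q)) = 1" using n1[OF that] g(2)[OF that] by (simp add: norm_exp_eq_Re)
    then have "Re (g q) = 0" by simp
    then show ?thesis using g(2)[OF that] by (simp add: \<theta>_def exp_eq_polar)
  qed
  have face: "winding (singular_face 2 k \<tau>) = \<theta> (q 1) - \<theta> (q 0)"
    if q: "continuous_on {0..1} q" "\<And>t. t \<in> {0..1} \<Longrightarrow> q t \<in> T"
      and e: "\<And>t. t \<in> {0..1} \<Longrightarrow> simplical_face k (edge t) = p (q t)" for k and q :: "real \<Rightarrow> real \<times> real"
  proof (rule winding_eq[of _ "\<lambda>t. \<theta> (q t)"])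
    have "q ` {0..1} \<subseteq> T" using q(2) by (rule image_subsetI)
    then have "continuous_on {0..1} (\<lambda>t. \<theta> (q t))"
      by (rule continuous_on_compose2[OF \<theta>c q(1)])
    moreover have "complex_part (singular_face 2 k \<tau> (edge t)) = cis (\<theta> (q t))" if "t \<in> {0..1}" for t
      using edge_in[OF that] e[OF that] \<theta>[OF q(2)[OF that]] by (simp add: singular_face_def)
    ultimately show "angle_lift (singular_face 2 k \<tau>) (\<lambda>t. \<theta> (q t))" by (simp add: angle_lift_def)
  qed
  have "winding (singular_face 2 0 \<tau>) = \<theta> (0, 1) - \<theta> (1, 0)"
  proof -
    have "simplical_face 0 (edge t) = p (1 - t, t)" for t
      by (auto simp: simplical_face_def edge_def p_def fun_eq_iff)
    moreover have "continuous_on {0..1} (\<lambda>t. (1 - t, t) :: real \<times> real)" by (intro continuous_intros)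
    ultimately show ?thesis using face[of "\<lambda>t. (1 - t, t)" 0] by (simp add: T_def)
  qed
  moreover have "winding (singular_face 2 1 \<tau>) = \<theta> (0, 1) - \<theta> (0, 0)"
  proof -
    have "simplical_face 1 (edge t) = p (0, t)" for t
      by (auto simp: simplical_face_def edge_def p_def fun_eq_iff)
    moreover have "continuous_on {0..1} (\<lambda>t. (0, t) :: real \<times> real)" by (intro continuous_intros)
    ultimately show ?thesis using face[of "\<lambda>t. (0, t)" 1] by (simp add: T_def)
  qed
  moreover have "winding (singular_face 2 2 \<tau>) = \<theta> (1, 0) - \<theta> (0, 0)"
  proof -
    have "simplical_face 2 (edge t) = p (t, 0)" for t
      by (auto simp: simplical_face_def edge_def p_def fun_eq_iff)
    moreover have "continuous_on {0..1} (\<lambda>t. (t, 0) :: real \<times> real)" by (intro continuous_intros)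
    ultimately show ?thesis using face[of "\<lambda>t. (t, 0)" 2] by (simp add: T_def)
  qed
  moreover have "{..2::nat} = {0, 1, 2}" by auto
  ultimately show ?thesis
    by (simp add: chain_boundary_of winding_chain_add winding_chain_diff winding_chain_minus)
qed

lemma winding_chain_boundary:
  assumes "singular_chain 2 (nsphere 1) d"
  shows "winding_chain (chain_boundary 2 d) = 0"
proof -
  have "Poly_Mapping.keys d \<subseteq> Collect (singular_simplex 2 (nsphere 1))"
    using assms by (simp add: singular_chain_def)
  then show ?thesis
  proof (induction d rule: frag_induction)
    case (one \<tau>)
    then show ?case by (simp add: winding_boundary_simplex)
  next
    case (diff a b)
    then show ?case by (simp add: chain_boundary_diff winding_chain_diff)
  qed simp
qed

text \<open>Since winding vanishes on boundaries and is additive, it descends to a homomorphism from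
  the first homology group of the circle to the reals, which turns powers into multiples.\<close>

lemma winding_power:
  assumes x: "singular_relcycle 1 (nsphere 1) {} a" and y: "singular_relcycle 1 (nsphere 1) {} b"
    and eq: "homologous_rel_set 1 (nsphere 1) {} b = homologous_rel_set 1 (nsphere 1) {} a [^]\<^bsub>homology_group 1 (nsphere 1)\<^esub> (d::int)"
  shows "winding_chain b = d * winding_chain a"
proof -
  let ?G = "homology_group 1 (nsphere 1)" and ?r = "homologous_rel_set 1 (nsphere 1) {}"
  interpret group ?G by simp
  have car: "carrier ?G = ?r ` singular_relcycle_set 1 (nsphere 1) {}"
    using carrier_relative_homology_group[of 1 "nsphere 1" "{}"] by simp
  have hom: "winding_chain u = winding_chain v" if "homologous_rel 1 (nsphere 1) {} u v" for u v
  proof -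
    have "\<exists>e. singular_chain (Suc 1) (nsphere 1) e \<and> chain_boundary (Suc 1) e = u - v"
      using that by (simp only: homologous_rel_def singular_boundary)
    then obtain e where "singular_chain 2 (nsphere 1) e" "chain_boundary 2 e = u - v"
      unfolding Suc_1 by (elim exE conjE)
    then have "winding_chain (u - v) = 0" using winding_chain_boundary[of e] by (simp only:)
    then show ?thesis by (simp add: winding_chain_diff)
  qed
  \<comment> \<open>The descended homomorphism, evaluated on an arbitrary representative;
    \<open>hom\<close> makes the choice immaterial.\<close>
  define \<Psi> where "\<Psi> = (\<lambda>R. winding_chain (SOME c. c \<in> R))"
  have \<Psi>: "\<Psi> (?r u) = winding_chain u" for u
  proof -
    have "(SOME c. c \<in> ?r u) \<in> ?r u" by (rule someI[of _ u]) simp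
    then show ?thesis unfolding \<Psi>_def using hom by simp
  qed
  have mult: "\<Psi> (A \<otimes>\<^bsub>?G\<^esub> B) = \<Psi> A + \<Psi> B" if AB: "A \<in> carrier ?G" "B \<in> carrier ?G" for A B
  proof -
    obtain u v where uv: "A = ?r u" "B = ?r v" using AB unfolding car by blast
    have "A \<otimes>\<^bsub>?G\<^esub> B \<in> carrier ?G" using AB by (rule m_closed)
    then obtain w where w: "A \<otimes>\<^bsub>?G\<^esub> B = ?r w" unfolding car by blast
    have "u \<in> A" "v \<in> B" using uv by auto
    then have "u + v \<in> A \<otimes>\<^bsub>?G\<^esub> B"
      using mult_relative_homology_group[of 1 "nsphere 1" "{}"] by auto
    then have "homologous_rel 1 (nsphere 1) {} w (u + v)" unfolding w by simp
    then have "winding_chain w = winding_chain u + winding_chain v" using hom winding_chain_add by metis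
    then show ?thesis unfolding w unfolding uv by (simp only: \<Psi>)
  qed
  have xa: "?r a \<in> carrier ?G" unfolding car using x by blast
  define f where "f = (\<lambda>k::int. \<Psi> (?r a [^]\<^bsub>?G\<^esub> k))"
  have add: "f (k + l) = f k + f l" for k l
    unfolding f_def using int_pow_mult[OF xa, of k l] mult[OF int_pow_closed[OF xa] int_pow_closed[OF xa]] by simp
  have f1: "f 1 = winding_chain a" unfolding f_def using int_pow_1[OF xa] \<Psi> by simp
  have f0: "f 0 = 0" using add[of 0 0] by simp
  have fm: "f (k - 1) = f k - f 1" for k using add[of "k - 1" 1] by simp
  have "f d = d * f 1"
    by (induction d rule: int_induct[of _ 0]) (simp_all add: f0 add fm algebra_simps)
  moreover have "f d = winding_chain b" unfolding f_def using eq \<Psi>[of b] by simp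
  ultimately show ?thesis using f1 by simp
qed

text \<open>The degree acts as a power on every class, so any one cycle of nonzero winding
  determines it. The loop once around the circle has winding \<open>2 * pi\<close> and its image
  \<open>6 * pi\<close>.\<close>

lemma degree_twist_circle:
  assumes c: "norm c = 1"
  shows "Brouwer_degree2 1 (twist c) = 3"
proof -
  let ?S = "nsphere 1" and ?G = "homology_group 1 (nsphere 1)"
  obtain \<alpha> where \<alpha>: "c = cis \<alpha>" using c by (metis complex_norm_eq_1_exp cis_conv_exp)
  define \<gamma>0 :: "(nat \<Rightarrow> real) \<Rightarrow> nat \<Rightarrow> real"
    where "\<gamma>0 = (\<lambda>x i. if i = 0 then cos (2 * pi * x 1) else if i = 1 then sin (2 * pi * x 1) else 0)"
  \<comment> \<open>The restriction makes the path extensional, as a singular simplex must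
    be.\<close>
  define \<gamma> where "\<gamma> = restrict \<gamma>0 (standard_simplex 1)"
  have \<gamma>in: "\<gamma>0 x \<in> topspace ?S" for x
  proof -
    have "{..1::nat} = {0, 1}" by auto
    then show ?thesis by (simp add: topspace_nsphere dot_def \<gamma>0_def power2_eq_square[symmetric])
  qed
  have z\<gamma>: "complex_part (\<gamma>0 x) = cis (2 * pi * x 1)" for x by (simp add: complex_part_def \<gamma>0_def complex_eq_iff)
  have \<gamma>: "singular_simplex 1 ?S \<gamma>"
    unfolding singular_simplex_def
  proof
    have "continuous_map (subtopology (powertop_real UNIV) (standard_simplex 1)) euclideanreal (\<lambda>x. \<gamma>0 x k)" for k
    proof -
      have "continuous_on (standard_simplex 1) (\<lambda>x. 2 * pi * x 1)"
        by (intro continuous_on_mult continuous_on_const continuous_on_coordinate)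
      then have "continuous_on (standard_simplex 1) (\<lambda>x. \<gamma>0 x k)"
        unfolding \<gamma>0_def by (cases "k = 0"; cases "k = 1") (auto intro: continuous_on_cos continuous_on_sin)
      then show ?thesis by (simp add: euclidean_product_topology)
    qed
    then have "continuous_map (subtopology (powertop_real UNIV) (standard_simplex 1)) ?S \<gamma>0"
      unfolding continuous_map_into_nsphere using \<gamma>in by simp
    then show "continuous_map (subtopology (powertop_real UNIV) (standard_simplex 1)) ?S \<gamma>"
      by (rule continuous_map_eq) (simp add: \<gamma>_def)
  qed (simp add: \<gamma>_def)
  have cycle: "singular_relcycle 1 ?S {} (frag_of \<gamma>)"
  proof -
    have "singular_face 1 0 \<gamma> = singular_face 1 1 \<gamma>"
    proof
      fix x
      show "singular_face 1 0 \<gamma> x = singular_face 1 1 \<gamma> x"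
      proof (cases "x \<in> standard_simplex 0")
        case True
        then have x: "x = (\<lambda>j. if j = 0 then 1 else 0)" by (simp add: standard_simplex_0)
        have "simplical_face 0 x \<in> standard_simplex 1" "simplical_face 1 x \<in> standard_simplex 1"
          using simplical_face_in_standard_simplex[of 1 _ x] True by auto
        then have "\<gamma> (simplical_face 0 x) = \<gamma>0 (simplical_face 0 x)" "\<gamma> (simplical_face 1 x) = \<gamma>0 (simplical_face 1 x)"
          by (simp_all add: \<gamma>_def)
        moreover have "\<gamma>0 (simplical_face 0 x) = \<gamma>0 (simplical_face 1 x)"
          by (auto simp: \<gamma>0_def simplical_face_def x fun_eq_iff)
        ultimately show ?thesis using True by (simp add: singular_face_def)
      qed (simp add: singular_face_def)
    qed
    then have "chain_boundary 1 (frag_of \<gamma>) = 0" by (simp add: chain_boundary_of)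
    then show ?thesis using \<gamma> by (simp add: singular_cycle singular_chain_of)
  qed
  have F: "continuous_map ?S ?S (twist c)" by (rule continuous_map_twist[OF order_refl c])
  have red: "reduced_homology_group (int 1) ?S = ?G" using un_reduced_homology_group[of "int 1" ?S] by simp
  let ?x = "homologous_rel_set 1 ?S {} (frag_of \<gamma>)"
  have xc: "?x \<in> carrier ?G"
    using carrier_relative_homology_group[of 1 ?S "{}"] cycle by auto
  have "hom_induced (int 1) ?S {} ?S {} (twist c) ?x = ?x [^]\<^bsub>?G\<^esub> Brouwer_degree2 1 (twist c)"
    using Brouwer_degree2[of ?x 1 "twist c"] xc unfolding red by simp
  moreover have "hom_induced (int 1) ?S {} ?S {} (twist c) ?x = homologous_rel_set 1 ?S {} (chain_map 1 (twist c) (frag_of \<gamma>))"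
    by (rule hom_induced_chain_map[OF F _ cycle]) simp
  ultimately have eq: "homologous_rel_set 1 ?S {} (chain_map 1 (twist c) (frag_of \<gamma>)) = ?x [^]\<^bsub>?G\<^esub> Brouwer_degree2 1 (twist c)"
    by simp
  have cycle': "singular_relcycle 1 ?S {} (chain_map 1 (twist c) (frag_of \<gamma>))"
    by (rule singular_relcycle_chain_map[OF cycle F]) simp
  have "winding_chain (chain_map 1 (twist c) (frag_of \<gamma>)) = of_int (Brouwer_degree2 1 (twist c)) * winding_chain (frag_of \<gamma>)"
    by (rule winding_power[OF cycle cycle' eq])
  moreover have "winding \<gamma> = 2 * pi"
  proof -
    have "angle_lift \<gamma> (\<lambda>t. 2 * pi * t)"
      unfolding angle_lift_def using edge_in z\<gamma> by (auto simp: \<gamma>_def edge_def intro!: continuous_intros)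
    from winding_eq[OF this] show ?thesis by simp
  qed
  moreover have "winding (simplex_map 1 (twist c) \<gamma>) = 6 * pi"
  proof -
    have "complex_part (simplex_map 1 (twist c) \<gamma> (edge t)) = cis (\<alpha> + 6 * pi * t)" if t: "t \<in> {0..1}" for t
    proof -
      have "simplex_map 1 (twist c) \<gamma> (edge t) = twist c (\<gamma>0 (edge t))"
        using edge_in[OF t] by (simp add: simplex_map_def \<gamma>_def)
      moreover have "cis (2 * pi * t) ^ 3 = cis (6 * pi * t)" using Complex.DeMoivre[of "2 * pi * t" 3] by (simp only: mult.assoc[symmetric]) simp
      then have "cis \<alpha> * cis (2 * pi * t) ^ 3 = cis (\<alpha> + 6 * pi * t)" by (simp only: cis_mult)
      moreover have "complex_part (\<gamma>0 (edge t)) = cis (2 * pi * t)" unfolding z\<gamma> by (simp add: edge_def)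
      ultimately show ?thesis unfolding \<alpha> by (simp only: complex_part_twist norm_cis power_one div_by_1 of_real_1 mult_1_right)
    qed
    then have "angle_lift (simplex_map 1 (twist c) \<gamma>) (\<lambda>t. \<alpha> + 6 * pi * t)"
      unfolding angle_lift_def by (auto intro!: continuous_intros)
    from winding_eq[OF this] show ?thesis by simp
  qed
  ultimately have "6 * pi = of_int (Brouwer_degree2 1 (twist c)) * (2 * pi)" by simp
  then have "of_int (Brouwer_degree2 1 (twist c)) = (3 :: real)" by simp
  then show ?thesis by linarith
qed

subsection \<open>Suspension\<close>

lemma iso_int_pow:
  assumes "h \<in> iso G H" "group G" "group H" "x \<in> carrier G"
  shows "h (x [^]\<^bsub>G\<^esub> (d::int)) = h x [^]\<^bsub>H\<^esub> d"
proof -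
  interpret group_hom G H h
    using assms by (simp add: group_hom_def group_hom_axioms_def iso_def)
  show ?thesis by (rule hom_int_pow) (rule assms)
qed

lemma iso_injD: "h \<in> iso G H \<Longrightarrow> x \<in> carrier G \<Longrightarrow> y \<in> carrier G \<Longrightarrow> h x = h y \<Longrightarrow> x = y"
  by (auto simp: iso_def bij_betw_def inj_on_def)

text \<open>\<open>F\<close> respects both closed hemispheres, hence the equator. The isomorphisms
  from the homology of the sphere to that relative to the upper hemisphere, from there by excision
  to the lower hemisphere relative to the equator, and by the boundary map to the equator are
  natural, so \<open>F\<close> acts by the same power at both ends.\<close>

lemma degree_suspension:
  assumes F: "continuous_map (nsphere (Suc m)) (nsphere (Suc m)) F"
    and up: "\<And>x. 0 \<le> x (Suc m) \<Longrightarrow> 0 \<le> F x (Suc m)" and low: "\<And>x. x (Suc m) \<le> 0 \<Longrightarrow> F x (Suc m) \<le> 0"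
  shows "Brouwer_degree2 (Suc m) F = Brouwer_degree2 m F"
proof (rule Brouwer_degree2_unique[OF F])
  let ?X = "nsphere (Suc m)" and ?U = "{x::nat\<Rightarrow>real. 0 \<le> x (Suc m)}"
  let ?Lw = "subtopology ?X {x. x (Suc m) \<le> 0}" and ?E = "{x::nat\<Rightarrow>real. x (Suc m) = 0}"
  let ?p = "int (Suc m)" and ?d = "Brouwer_degree2 m F"
  have FU: "F \<in> ?U \<rightarrow> ?U" and FE: "F \<in> ?E \<rightarrow> ?E"
    using up low by (auto intro: antisym)
  have FL: "continuous_map ?Lw ?Lw F"
    using F low by (auto simp: continuous_map_in_subtopology intro: continuous_map_from_subtopology)
  have E: "subtopology ?Lw ?E = nsphere m"
  proof -
    have "subtopology ?Lw ?E = subtopology ?X ?E"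
      unfolding subtopology_subtopology by (rule arg_cong[where f = "subtopology ?X"]) auto
    then show ?thesis by (simp only: subtopology_nsphere_equator)
  qed
  define i where "i = hom_induced ?p ?X {} ?X ?U id"
  define j where "j = hom_induced ?p ?Lw ?E ?X ?U id"
  define bd where "bd = hom_boundary ?p ?Lw ?E"
  let ?R = "reduced_homology_group ?p ?X" and ?A = "relative_homology_group ?p ?X ?U"
  let ?B = "relative_homology_group ?p ?Lw ?E" and ?C = "reduced_homology_group (int m) (nsphere m)"
  have i: "i \<in> iso ?R ?A" unfolding i_def by (rule iso_reduced_homology_group_upper_hemisphere) simp
  have j: "j \<in> iso ?B ?A" unfolding j_def by (rule iso_relative_homology_group_lower_hemisphere)
  have d: "bd \<in> iso ?B ?C"
    unfolding bd_def using iso_lower_hemisphere_reduced_homology_group[of "int m" m] by simp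
  fix z assume z: "z \<in> carrier ?R"
  have "i z \<in> carrier ?A" using i z by (auto simp: iso_def bij_betw_def)
  then have "i z \<in> j ` carrier ?B" using j by (simp only: iso_def bij_betw_def mem_Collect_eq)
  then obtain w where w: "w \<in> carrier ?B" "j w = i z" by (elim imageE) (rule that, assumption, erule sym)
  let ?FL = "hom_induced ?p ?Lw ?E ?Lw ?E F" and ?FU = "hom_induced ?p ?X ?U ?X ?U F"
  let ?F0 = "hom_induced ?p ?X {} ?X {} F" and ?FE = "hom_induced (int m) (nsphere m) {} (nsphere m) {} F"
  have grp: "group ?R" "group ?A" "group ?B" "group ?C" by simp_all
  have wd: "w [^]\<^bsub>?B\<^esub> ?d \<in> carrier ?B" using group.int_pow_closed[OF grp(3) w(1)] .
  have zd: "z [^]\<^bsub>?R\<^esub> ?d \<in> carrier ?R" using group.int_pow_closed[OF grp(1) z] .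
  \<comment> \<open>The power is known on the equator; the injective boundary map transfers it to
    the relative group. The ladder is then climbed through \<open>j\<close> and
    \<open>i\<close>.\<close>
  have FLw: "?FL w = w [^]\<^bsub>?B\<^esub> ?d"
  proof (rule iso_injD[OF d _ wd])
    show "?FL w \<in> carrier ?B" by (rule hom_induced_carrier)
    have "bd (?FL w) = ?FE (bd w)"
      using naturality_hom_induced[OF FL FE, of ?p] unfolding E bd_def by (simp add: fun_eq_iff)
    also have "\<dots> = bd w [^]\<^bsub>?C\<^esub> ?d"
      by (rule Brouwer_degree2) (use d w(1) in \<open>auto simp: iso_def bij_betw_def\<close>)
    also have "\<dots> = bd (w [^]\<^bsub>?B\<^esub> ?d)" by (rule iso_int_pow[OF d grp(3,4) w(1), symmetric])
    finally show "bd (?FL w) = bd (w [^]\<^bsub>?B\<^esub> ?d)" .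
  qed
  have idc: "continuous_map ?Lw ?X id" by (simp add: continuous_map_from_subtopology)
  have "?FU \<circ> j = hom_induced ?p ?Lw ?E ?X ?U (F \<circ> id)"
    unfolding j_def by (rule hom_induced_compose[symmetric, OF idc _ F FU]) auto
  moreover have "j \<circ> ?FL = hom_induced ?p ?Lw ?E ?X ?U (id \<circ> F)"
    unfolding j_def by (rule hom_induced_compose[symmetric, OF FL FE idc]) auto
  ultimately have jF: "?FU (j w) = j (?FL w)" by (simp add: fun_eq_iff)
  have "?FU \<circ> i = hom_induced ?p ?X {} ?X ?U (F \<circ> id)"
    unfolding i_def by (rule hom_induced_compose[symmetric, OF continuous_map_id _ F FU]) auto
  moreover have "i \<circ> ?F0 = hom_induced ?p ?X {} ?X ?U (id \<circ> F)"
    unfolding i_def by (rule hom_induced_compose[symmetric, OF F _ continuous_map_id]) auto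
  ultimately have iF: "?FU (i z) = i (?F0 z)" by (simp add: fun_eq_iff)
  show "?F0 z = z [^]\<^bsub>?R\<^esub> ?d"
  proof (rule iso_injD[OF i _ zd])
    show "?F0 z \<in> carrier ?R" by (rule hom_induced_reduced[OF z])
    have "i (?F0 z) = j (w [^]\<^bsub>?B\<^esub> ?d)" using iF jF w(2) FLw by simp
    also have "\<dots> = i z [^]\<^bsub>?A\<^esub> ?d" using iso_int_pow[OF j grp(3,2) w(1)] w(2) by simp
    also have "\<dots> = i (z [^]\<^bsub>?R\<^esub> ?d)" by (rule iso_int_pow[OF i grp(1,2) z, symmetric])
    finally show "i (?F0 z) = i (z [^]\<^bsub>?R\<^esub> ?d)" .
  qed
qed

text \<open>From dimension 2 on, the last coordinate is untouched by \<open>twist\<close>, so each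
  further sphere is a suspension step.\<close>

lemma degree_twist:
  assumes "n \<ge> 1" "norm c = 1"
  shows "Brouwer_degree2 n (twist c) = 3"
  using assms(1)
proof (induction n rule: dec_induct)
  case base
  then show ?case using degree_twist_circle[OF assms(2)] by simp
next
  case (step m)
  have "Brouwer_degree2 (Suc m) (twist c) = Brouwer_degree2 m (twist c)"
    by (rule degree_suspension) (use step.hyps assms(2) in \<open>auto simp: twist_above intro!: continuous_map_twist\<close>)
  then show ?case using step.IH by simp
qed

section \<open>A self-map inducing the identity below dimension n\<close>

lemma connected_space_nsphere:
  assumes "n \<ge> 1" shows "connected_space (nsphere n)"
proof -
  obtain m where n: "n = Suc m" using assms by (cases n) auto
  let ?U = "topspace (nsphere n) \<inter> {x. x n \<ge> 0}" and ?L = "topspace (nsphere n) \<inter> {x. x n \<le> 0}"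
  have "connectedin (nsphere n) ?U" "connectedin (nsphere n) ?L"
    using contractible_imp_connected_space[OF contractible_space_upper_hemisphere[of n n]]
      contractible_imp_connected_space[OF contractible_space_lower_hemisphere[of n n]]
    unfolding connectedin_def subtopology_restrict by simp_all
  moreover have "base_vector \<in> ?U \<inter> ?L"
    using base_vector_in[of n] by (simp add: base_vector_def n)
  then have "?U \<inter> ?L \<noteq> {}" by blast
  ultimately have "connectedin (nsphere n) (?U \<union> ?L)" by (rule connectedin_Un)
  moreover have "?U \<union> ?L = topspace (nsphere n)" by auto
  ultimately show ?thesis by (simp only: connectedin_topspace)
qed

text \<open>Lifted to the sphere, the spheroid has boundary values only in \<open>P\<close> and its
  antipode, and \<open>F\<close> fixes both. So the lift and its image under \<open>F\<close> agree
  on the boundary, and in dimension below \<open>n\<close> they are homotopic rel boundary.\<close>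

lemma sphere_map_fixing_antipodal_pair:
  assumes i: "i < n" and F: "continuous_map (nsphere n) (nsphere n) F"
    and odd: "\<And>x. F (antipode x) = antipode (F x)" and FP: "F P = P"
    and f: "\<And>x. x \<in> topspace (nsphere n) \<Longrightarrow> f (antipodal_pair x) = antipodal_pair (F x)"
    and b: "spheroid i (real_projective_space n) (antipodal_pair P) b"
  shows "spheroid_homotopic i (real_projective_space n) (antipodal_pair P) (f \<circ> b) b"
proof -
  have bc: "continuous_map (cube i) (real_projective_space n) b"
    and b0: "\<And>s. s \<in> cube_boundary i \<Longrightarrow> b s = antipodal_pair P"
    using b unfolding spheroid_def by auto
  have "b origin \<in> topspace (real_projective_space n)" using continuous_map_image_subset_topspace[OF bc] origin_in(1) by blast
  then obtain y where y: "y \<in> topspace (nsphere n)" "b origin = antipodal_pair y" unfolding topspace_RP by (elim imageE) (rule that)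
  obtain l where l: "continuous_map (cube i) (nsphere n) l" "\<And>s. s \<in> topspace (cube i) \<Longrightarrow> antipodal_pair (l s) = b s"
    by (rule RP_lift_contractible[where ?z0.0 = origin and y = y, OF contractible_space_cube[of i] compact_space_cube bc origin_in(1) y]) (rule that)
  have fix_bd: "F (l s) = l s" if s: "s \<in> cube_boundary i" for s
  proof -
    have "antipodal_pair (l s) = antipodal_pair P" using l(2) b0 s cube_boundary_subset by (metis subsetD)
    then have "l s = P \<or> l s = antipode P" by (simp only: antipodal_pair_eq_iff)
    then show ?thesis using odd FP by auto
  qed
  have Fl: "continuous_map (cube i) (nsphere n) (\<lambda>s. F (l s))"
    using continuous_map_compose[OF l(1) F] by (simp add: o_def)
  have h: "continuous_map (prod_topology unit_interval (bcube i)) (nsphere n) (\<lambda>p. l (snd p))"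
    using continuous_map_compose[OF continuous_map_snd continuous_map_from_subtopology[OF l(1)]] by (simp add: o_def)
  obtain K where K: "continuous_map (prod_topology unit_interval (cube i)) (nsphere n) K"
    "\<And>s. s \<in> topspace (cube i) \<Longrightarrow> K (0, s) = F (l s)" "\<And>s. s \<in> topspace (cube i) \<Longrightarrow> K (1, s) = l s"
    "\<And>t s. t \<in> {0..1} \<Longrightarrow> s \<in> cube_boundary i \<Longrightarrow> K (t, s) = l (snd (t, s))"
    by (rule sphere_homotopy_rel_boundary[OF i Fl l(1) h]) (use fix_bd in \<open>simp; fail\<close>, simp, rule that)
  show ?thesis
    unfolding spheroid_homotopic_alt
  proof (intro exI conjI ballI)
    show "continuous_map (prod_topology unit_interval (cube i)) (real_projective_space n) (\<lambda>p. antipodal_pair (K p))"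
      by (rule continuous_map_antipodal_pair[OF K(1)])
    show "antipodal_pair (K (1, s)) = b s" if "s \<in> topspace (cube i)" for s
      using K(3)[OF that] l(2)[OF that] by simp
    show "antipodal_pair (K (0, s)) = (f \<circ> b) s" if s: "s \<in> topspace (cube i)" for s
      using K(2)[OF s] l(2)[OF s] f[OF continuous_map_nsphere_in[OF l(1) s]] by simp
    show "antipodal_pair (K (t, s)) = antipodal_pair P" if "t \<in> {0..1}" "s \<in> cube_boundary i" for t s
      using K(4)[OF that] l(2)[of s] b0[OF that(2)] cube_boundary_subset[of i] that(2) by (auto simp: subset_iff)
  qed
qed

lemma induces_iso_if_homotopic_id:
  assumes f: "based_map X x0 X x0 f" and id: "\<And>b. spheroid i X x0 b \<Longrightarrow> spheroid_homotopic i X x0 (f \<circ> b) b"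
  shows "induces_iso i X x0 X x0 f"
  unfolding induces_iso_iff[OF f]
proof (intro conjI allI impI)
  show "\<exists>a. spheroid i X x0 a \<and> spheroid_homotopic i X x0 (f \<circ> a) b" if "spheroid i X x0 b" for b
    using id that by blast
  show "spheroid_homotopic i X x0 a a'"
    if a: "spheroid i X x0 a" "spheroid i X x0 a'" "spheroid_homotopic i X x0 (f \<circ> a) (f \<circ> a')" for a a'
  proof -
    have "spheroid_homotopic i X x0 a (f \<circ> a)" using id[OF a(1)] unfolding spheroid_homotopic_def by (rule homotopic_with_symD)
    then have "spheroid_homotopic i X x0 a (f \<circ> a')" using a(3) unfolding spheroid_homotopic_def by (rule homotopic_with_trans)
    then show ?thesis using id[OF a(2)] unfolding spheroid_homotopic_def by (rule homotopic_with_trans)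
  qed
qed

text \<open>A homotopy from \<open>g \<circ> f\<close> to the identity lifts to one that starts at
  \<open>G \<circ> F\<close> and ends at a map covering the identity, that is, at the identity or
  the antipodal map. The product of the integer degrees of \<open>G\<close> and \<open>F\<close> is
  therefore a unit.\<close>

lemma RP_equivalence_degree:
  assumes n: "n \<ge> 1" and F: "continuous_map (nsphere n) (nsphere n) F" and P: "P \<in> topspace (nsphere n)"
    and f: "\<And>x. x \<in> topspace (nsphere n) \<Longrightarrow> f (antipodal_pair x) = antipodal_pair (F x)"
    and eq: "based_homotopy_equivalence (real_projective_space n) (antipodal_pair P) (real_projective_space n) (antipodal_pair P) f"
  shows "\<bar>Brouwer_degree2 n F\<bar> = 1"
proof -
  let ?X = "real_projective_space n" and ?S = "nsphere n" and ?p = "antipodal_pair P"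
  have pX: "?p \<in> topspace ?X" using P unfolding topspace_RP by blast
  obtain g where g: "based_map ?X ?p ?X ?p g" and gf: "based_homotopic ?X ?p ?X ?p (g \<circ> f) id"
    using eq unfolding based_homotopy_equivalence_def by blast
  have gc: "continuous_map ?X ?X g" and gp: "g ?p = antipodal_pair P" using g unfolding based_map_def by auto
  obtain G where G: "continuous_map ?S ?S G" "\<And>x. x \<in> topspace ?S \<Longrightarrow> antipodal_pair (G x) = g (antipodal_pair x)"
    using RP_map_lift[OF n gc P P gp] by blast
  obtain h where h: "continuous_map (prod_topology unit_interval ?X) ?X h"
    "\<And>x. x \<in> topspace ?X \<Longrightarrow> h (0, x) = (g \<circ> f) x" "\<And>x. x \<in> topspace ?X \<Longrightarrow> h (1, x) = x"
    using gf unfolding based_homotopic_alt[OF pX] by (elim exE conjE) (rule that, assumption, simp_all)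
  have hq: "continuous_map (prod_topology unit_interval ?S) ?X (\<lambda>u. h (fst u, antipodal_pair (snd u)))"
    by (rule continuous_map_compose_pair[OF h(1) continuous_map_fst continuous_map_antipodal_pair[OF continuous_map_snd]])
  have qX: "antipodal_pair x \<in> topspace ?X" if "x \<in> topspace ?S" for x using that unfolding topspace_RP by blast
  have FS: "F x \<in> topspace ?S" if "x \<in> topspace ?S" for x by (rule continuous_map_nsphere_in[OF F that])
  have h0: "h (fst (0::real, x), antipodal_pair (snd (0::real, x))) = antipodal_pair ((G \<circ> F) x)" if x: "x \<in> topspace ?S" for x
    using h(2)[OF qX[OF x]] f[OF x] G(2)[OF FS[OF x]] by simp
  obtain K where K: "continuous_map (prod_topology unit_interval ?S) ?S K"
    "\<And>t x. t \<in> {0..1} \<Longrightarrow> x \<in> topspace ?S \<Longrightarrow> antipodal_pair (K (t, x)) = h (fst (t, x), antipodal_pair (snd (t, x)))"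
    "\<And>x. x \<in> topspace ?S \<Longrightarrow> K (0, x) = (G \<circ> F) x"
    by (rule RP_homotopy_lift[OF hq compact_space_nsphere continuous_map_compose[OF F G(1)] h0]) (assumption, rule that)
  define k where "k = (\<lambda>x. K (1, x))"
  have kc: "continuous_map ?S ?S k"
    unfolding k_def by (rule continuous_map_compose_pair[OF K(1)]) (simp_all add: continuous_map_id[unfolded id_def])
  have hom: "homotopic_with (\<lambda>x. True) ?S ?S (G \<circ> F) k"
    by (subst homotopic_with) (use K(1,3) in \<open>auto simp: k_def intro!: exI[of _ K]\<close>)
  have "antipodal_pair (k x) = antipodal_pair (id x)" if x: "x \<in> topspace ?S" for x
    using K(2)[of 1 x] h(3)[OF qX[OF x]] x by (simp add: k_def)
  from RP_lift_unique[OF connected_space_nsphere[OF n] kc continuous_map_id this]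
  have "(\<forall>x\<in>topspace ?S. k x = x) \<or> (\<forall>x\<in>topspace ?S. k x = antipode x)" by simp
  then have "Brouwer_degree2 n k = Brouwer_degree2 n id \<or> Brouwer_degree2 n k = Brouwer_degree2 n antipode"
    using Brouwer_degree2_eq[of n k id] Brouwer_degree2_eq[of n k antipode] by auto
  moreover have "\<bar>Brouwer_degree2 n antipode\<bar> = 1"
  proof -
    have ac: "continuous_map ?S ?S antipode"
      using continuous_map_antipode[OF continuous_map_id] by simp
    \<comment> \<open>An involution has degree of square 1; which sign occurs depends on the
      dimension and is irrelevant here.\<close>
    have "antipode \<circ> antipode = id" by (simp add: fun_eq_iff)
    then have "Brouwer_degree2 n antipode * Brouwer_degree2 n antipode = 1"
      using Brouwer_degree2_compose[OF ac ac] by simp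
    then show ?thesis by (metis abs_mult_self_eq abs_zmult_eq_1 abs_1)
  qed
  ultimately have "\<bar>Brouwer_degree2 n k\<bar> = 1" by auto
  moreover have "Brouwer_degree2 n k = Brouwer_degree2 n G * Brouwer_degree2 n F"
    using Brouwer_degree2_homotopic[OF hom] Brouwer_degree2_compose[OF F G(1)] by simp
  ultimately show ?thesis by (metis abs_zmult_eq_1 mult.commute)
qed

theorem theorem13:
  fixes n :: nat and p :: "(nat \<Rightarrow> real) set"
  assumes "n \<ge> 1"
    and "p \<in> topspace (real_projective_space n)"
  shows "self_closeness_number (real_projective_space n) p = enat n"
  unfolding self_closeness_number_def
proof (rule Least_equality)
  let ?X = "real_projective_space n"
  show "A_sharp (enat n) ?X p = self_equivalences ?X p"
  proof (rule A_sharp_eq_self_equivalencesI)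
    fix f assume "based_map ?X p ?X p f" "\<And>i. enat i \<le> enat n \<Longrightarrow> induces_iso i ?X p ?X p f"
    then show "based_homotopy_equivalence ?X p ?X p f"
      using RP_induces_iso_imp_equivalence[OF assms] by simp
  qed
  obtain P where P: "P \<in> topspace (nsphere n)" "p = antipodal_pair P" using assms(2) unfolding topspace_RP by blast
  \<comment> \<open>Fixing the lift \<open>P\<close> makes the descended map based at
    \<open>p\<close>, so no change of base point is required in this half.\<close>
  obtain c where c: "norm c = 1" "twist c P = P" by (rule twist_fixes)
  have F: "continuous_map (nsphere n) (nsphere n) (twist c)" by (rule continuous_map_twist[OF assms(1) c(1)])
  obtain f where f: "continuous_map ?X ?X f" "\<And>x. x \<in> topspace (nsphere n) \<Longrightarrow> f (antipodal_pair x) = antipodal_pair (twist c x)"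
    by (rule RP_map_from_odd[OF F twist_antipode]) (rule that)
  have bf: "based_map ?X p ?X p f" unfolding based_map_def using f c(2) P by simp
  have no: "\<not> based_homotopy_equivalence ?X p ?X p f"
  proof
    assume "based_homotopy_equivalence ?X p ?X p f"
    then have eq: "based_homotopy_equivalence ?X (antipodal_pair P) ?X (antipodal_pair P) f" unfolding P(2) .
    have "\<bar>Brouwer_degree2 n (twist c)\<bar> = 1"
      by (rule RP_equivalence_degree[OF assms(1) F P(1) f(2) eq])
    then show False using degree_twist[OF assms(1) c(1)] by simp
  qed
  show "enat n \<le> k" if k: "A_sharp k ?X p = self_equivalences ?X p" for k
  proof (rule ccontr)
    assume "\<not> enat n \<le> k"
    \<comment> \<open>A bound below \<open>enat n\<close> admits only degrees \<open>i < n\<close>,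
      infinity being excluded; in these degrees \<open>f\<close> induces the identity.\<close>
    then have kn: "k < enat n" by simp
    have "induces_iso i ?X p ?X p f" if i: "enat i \<le> k" for i
    proof (rule induces_iso_if_homotopic_id[OF bf])
      have "enat i < enat n" using i kn by (rule order.strict_trans1)
      then have "i < n" by simp
      then show "spheroid_homotopic i ?X p (f \<circ> b) b" if b: "spheroid i ?X p b" for b
        unfolding P(2) by (rule sphere_map_fixing_antipodal_pair[OF _ F twist_antipode c(2) f(2) b[unfolded P(2)]])
    qed
    then show False using A_sharp_neq_self_equivalencesI[OF bf _ no] k by blast
  qed
qed

end
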